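(* Let $1\le k\le d$ be integers and let $M\subset\mathbb R^d$ be a smooth submanifold of dimension $k$. Suppose that for some $D\in\mathbb N$, every point of $M$ is $D$-nondegenerate. Then $\mathrm{BA}_M(\psi_{c(k,d)})$ is hyperplane winning relative to $M$.
   Context: $\mathbb N=\{1,2,\dots\}$, $\mathbb N_0=\mathbb N\cup\{0\}$. $\mathbb R^d$ and $\mathbb R^k$ carry the distance $\mathrm{dist}$ given by the max norm. All balls $B(\mathbf x,\rho)$ are closed; $S^{(\epsilon)}$ is the closed $\epsilon$-thickening of a set $S$. A local parameterization of $M$ is a diffeomorphism from an open subset of $\mathbb R^k$ onto an open subset of $M$. Height: for $\mathbf r\in\mathbb Q^d$ write $\mathbf r=\mathbf p/q$ in reduced form ($\mathbf p\in\mathbb Z^d$, $q\in\mathbb N$, no common factor of $q$ and all the coordinates of $\mathbf p$); $H(\mathbf r):=q$. For $c>0$, $\psi_c(t):=t^{-c}$. For $\psi:(0,\infty)\to(0,\infty)$, $$\mathrm{BA}_M(\psi)=\{\mathbf x\in M:\exists\, c_{\mathbf x}>0 \text{ such that } \mathrm{dist}(\mathbf x,\mathbf r)\ge c_{\mathbf x}\,\psi(H(\mathbf r))\ \text{ for all } \mathbf r\in\mathbb Q^d\cap M\}.$$ The constant $c(k,d)$: let $[n,m]:=\binom{n+m}{m}$. Let $n_{k,d}\in\mathbb N$ be maximal such that $d=[k-1,1]+[k-1,2]+\dots+[k-1,n_{k,d}]+m_{k,d}$ for some $m_{k,d}\ge 0$, and let $m_{k,d}$ be the unique integer satisfying this.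 Put $N_{k,d}:=1[k-1,1]+2[k-1,2]+\dots+n_{k,d}[k-1,n_{k,d}]+(n_{k,d}+1)m_{k,d}$ and $c(k,d):=(d+1)/N_{k,d}$. Nondegeneracy: for $\mathbf x\in M$, $j\in\mathbb N$ and a local parameterization $\Phi:U\to M$ with $\Phi(\mathbf v)=\mathbf x$, let $T^{(j)}_{\mathbf x}(M)=\mathrm{Span}\{\partial^\alpha\Phi(\mathbf v):\alpha\in\mathbb N_0^k,\ 0<|\alpha|\le j\}\subset\mathbb R^d$. A point $\mathbf x\in M$ is $D$-nondegenerate if $T^{(D)}_{\mathbf x}(M)=\mathbb R^d$. Hyperplane game: for $\beta>0$, the $\beta$-hyperplane game is played on $\mathbb R^k$ by Alice and Bob. Bob chooses an initial ball $B_0=B(\mathbf x_0,\rho_0)\subset\mathbb R^k$. After Bob's $n$th move $B_n=B(\mathbf x_n,\rho_n)$, Alice chooses an affine hyperplane $A_n\subset\mathbb R^k$; then Bob chooses a ball $B_{n+1}=B(\mathbf x_{n+1},\rho_{n+1})$ with $B_{n+1}\subset B_n\setminus A_n^{(\beta\rho_n)}$ and $\rho_{n+1}\ge\beta\rho_n$. If Bob is unable to choose such a ball, he loses. A set $S\subset\mathbb R^k$ is $\beta$-hyperplane winning if Alice has a strategy which guarantees (unless Bob loses by being unable to move) that $\bigcap_{n=1}^\infty B_n\cap S\ne\emptyset$; it is hyperplane winning if it is $\beta$-hyperplane winning for all $\beta>0$. A subset $S$ of the manifold $M$ is hyperplane winning relative to $M$ if whenever $\Psi:U\to M$ is a local parameterization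 of $M$ and $K\subset U$ is compact, the set $\Psi^{-1}(S)\cup(\mathbb R^k\setminus K)$ is hyperplane winning. *)

theory Defs
  imports "HOL-Analysis.Analysis"
begin

text \<open>
  Throughout, \<open>\<real>\<^sup>d\<close> is \<open>real ^ 'd\<close> and \<open>\<real>\<^sup>k\<close> is \<open>real ^ 'k\<close>, with \<open>d = CARD('d)\<close> and
  \<open>k = CARD('k)\<close>. All metric quantities (distances, balls, thickenings) are taken in the max norm,
  which is \<^const>\<open>infnorm\<close>; only topological and differential notions use the standard instances,
  and these do not depend on the choice of a norm.
\<close>

section \<open>Smooth maps, partial derivatives, submanifolds\<close>

primrec Ck_on :: "nat \<Rightarrow> 'a::euclidean_space set \<Rightarrow> ('a \<Rightarrow> 'b::euclidean_space) \<Rightarrow> bool" where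
  "Ck_on 0 W f \<longleftrightarrow> continuous_on W f"
| "Ck_on (Suc n) W f \<longleftrightarrow>
     (\<forall>x\<in>W. f differentiable (at x)) \<and> (\<forall>v. Ck_on n W (\<lambda>x. frechet_derivative f (at x) v))"

text \<open>A map on an arbitrary subset of a Euclidean space is smooth if near each point of the subset
  it extends to a \<open>C\<^sup>\<infinity>\<close> map on an open set. For open \<open>S\<close> this is the usual notion.\<close>

definition smooth_map_on :: "'a::euclidean_space set \<Rightarrow> ('a \<Rightarrow> 'b::euclidean_space) \<Rightarrow> bool" where
  "smooth_map_on S f \<longleftrightarrow>
     (\<forall>x\<in>S. \<exists>W F. open W \<and> x \<in> W \<and> (\<forall>n. Ck_on n W F) \<and> (\<forall>y\<in>S \<inter> W. F y = f y))"

definition diffeomorphism_on ::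
    "'a::euclidean_space set \<Rightarrow> 'b::euclidean_space set \<Rightarrow> ('a \<Rightarrow> 'b) \<Rightarrow> bool" where
  "diffeomorphism_on U V f \<longleftrightarrow>
     (\<exists>g. homeomorphism U V f g \<and> smooth_map_on U f \<and> smooth_map_on V g)"

definition local_parameterization ::
    "(real ^ 'd) set \<Rightarrow> (real ^ 'k) set \<Rightarrow> (real ^ 'k \<Rightarrow> real ^ 'd) \<Rightarrow> bool" where
  "local_parameterization M U \<Phi> \<longleftrightarrow>
     open U \<and> openin (top_of_set M) (\<Phi> ` U) \<and> diffeomorphism_on U (\<Phi> ` U) \<Phi>"

text \<open>The first argument only fixes the dimension \<open>CARD('k)\<close>. As for submanifolds in the usual sense
  (locally diffeomorphic to \<open>\<real>\<^sup>k\<close>), \<open>M\<close> need not be closed, connected or nonempty.\<close>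

definition smooth_submanifold :: "'k::finite itself \<Rightarrow> (real ^ 'd) set \<Rightarrow> bool" where
  "smooth_submanifold _ M \<longleftrightarrow>
     (\<forall>x\<in>M. \<exists>U (\<Phi> :: real ^ 'k \<Rightarrow> real ^ 'd). local_parameterization M U \<Phi> \<and> x \<in> \<Phi> ` U)"

definition partial_deriv :: "'k \<Rightarrow> (real ^ 'k \<Rightarrow> real ^ 'd) \<Rightarrow> real ^ 'k \<Rightarrow> real ^ 'd" where
  "partial_deriv i f x = frechet_derivative f (at x) (axis i 1)"

text \<open>\<open>\<partial>\<^sup>\<alpha> f\<close> for a multi-index \<open>\<alpha>\<close>: differentiate \<open>\<alpha> i\<close> times in direction \<open>i\<close>, for every \<open>i\<close>. The
  order of differentiation is immaterial for smooth \<open>f\<close>; since the index type carries no order,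
  some list with the prescribed multiplicities is chosen.\<close>

definition multi_partial ::
    "('k \<Rightarrow> nat) \<Rightarrow> (real ^ 'k \<Rightarrow> real ^ 'd) \<Rightarrow> real ^ 'k \<Rightarrow> real ^ 'd" where
  "multi_partial \<alpha> f = foldr partial_deriv (SOME xs. \<forall>i. count_list xs i = \<alpha> i) f"

definition osculating_space ::
    "nat \<Rightarrow> (real ^ 'k \<Rightarrow> real ^ 'd) \<Rightarrow> real ^ 'k \<Rightarrow> (real ^ 'd) set" where
  "osculating_space j \<Phi> v =
     span {multi_partial \<alpha> \<Phi> v | \<alpha>. 0 < (\<Sum>i\<in>UNIV. \<alpha> i) \<and> (\<Sum>i\<in>UNIV. \<alpha> i) \<le> j}"

text \<open>The space \<open>T\<^sub>x\<^sup>(\<^sup>j\<^sup>)(M)\<close> does not depend on the local parameterization, so that it suffices to ask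
  for one.\<close>

definition nondegenerate_at :: "'k::finite itself \<Rightarrow> nat \<Rightarrow> (real ^ 'd) set \<Rightarrow> real ^ 'd \<Rightarrow> bool" where
  "nondegenerate_at _ D M x \<longleftrightarrow>
     (\<exists>U (\<Phi> :: real ^ 'k \<Rightarrow> real ^ 'd) v.
        local_parameterization M U \<Phi> \<and> v \<in> U \<and> \<Phi> v = x \<and> osculating_space D \<Phi> v = UNIV)"

section \<open>Badly approximable points\<close>

definition rational_point :: "real ^ 'd \<Rightarrow> bool" where
  "rational_point r \<longleftrightarrow> (\<forall>i. r $ i \<in> \<rat>)"

definition height :: "real ^ 'd \<Rightarrow> nat" where
  "height r = (THE q. 0 < q \<and> (\<exists>p :: int ^ 'd.
     Gcd (insert (int q) (range (\<lambda>i. p $ i))) = 1 \<and> r = (\<chi> i. of_int (p $ i) / of_nat q)))"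

definition psi :: "real \<Rightarrow> real \<Rightarrow> real" where
  "psi c t = t powr (- c)"

definition BA :: "(real ^ 'd) set \<Rightarrow> (real \<Rightarrow> real) \<Rightarrow> (real ^ 'd) set" where
  "BA M \<psi> = {x \<in> M. \<exists>c>0. \<forall>r\<in>M. rational_point r \<longrightarrow> infnorm (x - r) \<ge> c * \<psi> (real (height r))}"

section \<open>The exponent\<close>

definition bin :: "nat \<Rightarrow> nat \<Rightarrow> nat" where
  "bin n m = (n + m) choose m"

definition n_kd :: "nat \<Rightarrow> nat \<Rightarrow> nat" where
  "n_kd k d = (GREATEST n. 1 \<le> n \<and> (\<exists>m. d = (\<Sum>j=1..n. bin (k - 1) j) + m))"

definition m_kd :: "nat \<Rightarrow> nat \<Rightarrow> nat" where
  "m_kd k d = (THE m. d = (\<Sum>j=1..n_kd k d. bin (k - 1) j) + m)"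

definition N_kd :: "nat \<Rightarrow> nat \<Rightarrow> nat" where
  "N_kd k d = (\<Sum>j=1..n_kd k d. j * bin (k - 1) j) + (n_kd k d + 1) * m_kd k d"

definition c_kd :: "nat \<Rightarrow> nat \<Rightarrow> real" where
  "c_kd k d = (real d + 1) / real (N_kd k d)"

section \<open>The hyperplane game\<close>

definition max_ball :: "real ^ 'k \<Rightarrow> real \<Rightarrow> (real ^ 'k) set" where
  "max_ball x \<rho> = {y. infnorm (y - x) \<le> \<rho>}"

definition thickening :: "(real ^ 'k) set \<Rightarrow> real \<Rightarrow> (real ^ 'k) set" where
  "thickening S \<epsilon> = {x. S \<noteq> {} \<and> (INF s\<in>S. infnorm (x - s)) \<le> \<epsilon>}"

definition affine_hyperplane :: "(real ^ 'k) set \<Rightarrow> bool" where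
  "affine_hyperplane A \<longleftrightarrow> (\<exists>a b. a \<noteq> 0 \<and> A = {x. a \<bullet> x = b})"

text \<open>A strategy of Alice maps the finite list of balls \<open>B\<^sub>0, \<dots>, B\<^sub>n\<close> that Bob has played (as pairs of
  centre and radius) to her move \<open>A\<^sub>n\<close>. A play that respects the rules for ever is an infinite
  sequence of such pairs; a play in which Bob gets stuck yields no such sequence and is
  won by Alice.\<close>

definition legal_play ::
    "real \<Rightarrow> (((real ^ 'k) \<times> real) list \<Rightarrow> (real ^ 'k) set) \<Rightarrow>
     (nat \<Rightarrow> real ^ 'k) \<Rightarrow> (nat \<Rightarrow> real) \<Rightarrow> bool" where
  "legal_play \<beta> \<sigma> x \<rho> \<longleftrightarrow>
     (\<forall>n. 0 < \<rho> n) \<and>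
     (\<forall>n. max_ball (x (Suc n)) (\<rho> (Suc n)) \<subseteq>
            max_ball (x n) (\<rho> n) -
            thickening (\<sigma> (map (\<lambda>i. (x i, \<rho> i)) [0..<Suc n])) (\<beta> * \<rho> n) \<and>
          \<rho> (Suc n) \<ge> \<beta> * \<rho> n)"

definition beta_hyperplane_winning :: "real \<Rightarrow> (real ^ 'k) set \<Rightarrow> bool" where
  "beta_hyperplane_winning \<beta> S \<longleftrightarrow>
     (\<exists>\<sigma>. (\<forall>h. affine_hyperplane (\<sigma> h)) \<and>
          (\<forall>x \<rho>. legal_play \<beta> \<sigma> x \<rho> \<longrightarrow> (\<Inter>n\<in>{1..}. max_ball (x n) (\<rho> n)) \<inter> S \<noteq> {}))"

definition hyperplane_winning :: "(real ^ 'k) set \<Rightarrow> bool" where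
  "hyperplane_winning S \<longleftrightarrow> (\<forall>\<beta>>0. beta_hyperplane_winning \<beta> S)"

text \<open>A local parameterization is a total function here, only its values on \<open>U\<close> matter; hence the
  preimage is taken inside \<open>U\<close>.\<close>

definition hyperplane_winning_rel ::
    "'k::finite itself \<Rightarrow> (real ^ 'd) set \<Rightarrow> (real ^ 'd) set \<Rightarrow> bool" where
  "hyperplane_winning_rel _ M S \<longleftrightarrow>
     (\<forall>U (\<Psi> :: real ^ 'k \<Rightarrow> real ^ 'd) K.
        local_parameterization M U \<Psi> \<and> compact K \<and> K \<subseteq> U \<longrightarrow>
        hyperplane_winning ((\<Psi> -` S \<inter> U) \<union> (UNIV - K)))"

end

theory Submission
  imports Defs
begin

text \<open>
  Fix a chart \<open>\<Psi>\<close> of \<open>M\<close>; write \<open>k\<close>, \<open>d\<close> for the dimensions, \<open>N\<close> for \<open>N_kd k d\<close>, so that the exponent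
  is \<open>c = (d + 1) / N\<close>. The theorem rests on two facts about a ball \<open>B\<close> of radius \<open>\<rho>\<close> in the
  parameter space.

  \<^emph>\<open>Rational points of small height lie on a hyperplane.\<close> Take \<open>d + 1\<close> points of \<open>B\<close> and the determinant
  of the homogeneous coordinates \<open>(1, \<Psi> y)\<close> of their images. Expand every row in a Taylor polynomial
  of degree \<open>n = n_kd k d\<close> around the centre. By multilinearity the determinant is a sum of terms in
  which every row contributes one monomial or the remainder, and a term vanishes if two rows
  contribute the same monomial. The cheapest surviving terms use all monomials of degree at most \<open>n\<close>
  once and the remainder, of order \<open>n + 1\<close>, in the other rows; by definition of \<open>N\<close> they are of order
  \<open>\<rho> ^ N\<close> (\<open>jet_det_bound\<close>, \<open>N_kd_weight_bound\<close>). If the images are rational with heights at most \<open>H\<close>,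
  a nonzero determinant is at least \<open>H ^ (- (d + 1))\<close>. So all rational points \<open>\<Psi> y\<close> with \<open>y\<close> in \<open>B\<close>
  and \<open>H ^ (d + 1) * \<rho> ^ N\<close> below a constant, that is, \<open>\<rho>\<close> below a constant times \<open>H powr (- c)\<close>,
  satisfy one affine equation \<open>a \<bullet> \<Psi> y = b\<close> with \<open>norm a = 1\<close>
  (\<open>small_rationals_on_hyperplane\<close>).

  \<^emph>\<open>Alice can avoid the zero set of such an equation.\<close> Let \<open>f y = a \<bullet> \<Psi> y - b\<close>. By nondegeneracy and
  compactness some derivative of \<open>f\<close> of order between \<open>1\<close> and \<open>D\<close> is bounded away from zero,
  uniformly. On a small ball a smooth function with some first derivative bounded away from zero
  is close to a nonconstant affine one, hence small only near one hyperplane, which Alice deletes. Repeating this, she passes from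
  a derivative of order \<open>l\<close> to one of order \<open>l - 1\<close> and finally to \<open>f\<close>. After a number of moves that
  depends only on \<open>\<beta>\<close> and the chart, \<open>f\<close> is so large on Bob's ball that its points have distance at
  least \<open>\<epsilon> * \<rho>\<close> from all zeros of \<open>f\<close> near \<open>B\<close> (\<open>forces_away_from_zero_set\<close>).

  Alice plays this in consecutive blocks of moves of fixed length, starting each block with the
  hyperplane that belongs to Bob's current ball. The radii at the beginning of the blocks tend to
  zero but shrink by at most a fixed factor from block to block, so every rational point of height \<open>H\<close>
  is dealt with either in the first block whose ball is small enough for the above or in a block with \<open>\<rho>\<close> comparable to \<open>H powr (- c)\<close>
  (\<open>chart_winning\<close>).

  The hypothesis provides, at each point, one chart in which the osculating space is everything, but
  the game is played in an arbitrary chart. The transfer avoids higher chain rules: the derivatives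
  of \<open>f\<close> of orders \<open>1\<close> to \<open>D\<close> vanish at a point if and only if the difference of \<open>f\<close> and its value
  there is small of order \<open>D + 1\<close>, and this does not depend on the chart (\<open>nondegenerate_every_chart\<close>).
\<close>

section \<open>Balls of the max norm\<close>

lemma norm_le_sqrt_infnorm: "norm (x :: real ^ 'k::finite) \<le> sqrt (real CARD('k)) * infnorm x"
  using norm_le_infnorm[of x] by simp

lemma infnorm_le_iff: "infnorm (u :: real ^ 'k::finite) \<le> r \<longleftrightarrow> (\<forall>i. \<bar>u $ i\<bar> \<le> r)"
proof
  assume "infnorm u \<le> r"
  then show "\<forall>i. \<bar>u $ i\<bar> \<le> r" using component_le_infnorm_cart order_trans by blast
next
  assume "\<forall>i. \<bar>u $ i\<bar> \<le> r"
  then show "infnorm u \<le> r"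
    unfolding infnorm_cart by (intro cSup_least) auto
qed

lemma max_ball_shift_mem:
  fixes x :: "real ^ 'k::finite"
  assumes "\<bar>t\<bar> \<le> r"
  shows "x + t *\<^sub>R axis i 1 \<in> max_ball x r"
proof -
  have "infnorm (axis i 1 :: real ^ 'k) \<le> 1"
    using infnorm_le_norm[of "axis i 1 :: real ^ 'k"] by simp
  then have "\<bar>t\<bar> * infnorm (axis i 1 :: real ^ 'k) \<le> \<bar>t\<bar> * 1"
    by (intro mult_left_mono) auto
  then show ?thesis using assms by (simp add: max_ball_def infnorm_mul)
qed

lemma max_ball_subset:
  fixes x y :: "real ^ 'k::finite"
  assumes "infnorm (y - x) + r \<le> R"
  shows "max_ball y r \<subseteq> max_ball x R"
proof
  fix z assume "z \<in> max_ball y r"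
  then show "z \<in> max_ball x R"
    using assms infnorm_triangle[of "z - y" "y - x"] by (simp add: max_ball_def)
qed

lemma convex_max_ball: "convex (max_ball (x :: real ^ 'k::finite) r)"
proof (rule convexI)
  fix y z :: "real ^ 'k" and a b :: real
  assume y: "y \<in> max_ball x r" and z: "z \<in> max_ball x r" and ab: "0 \<le> a" "0 \<le> b" "a + b = 1"
  have "a *\<^sub>R y + b *\<^sub>R z - x = a *\<^sub>R (y - x) + b *\<^sub>R (z - x)"
    using ab(3) by (simp add: algebra_simps flip: scaleR_add_left)
  then have "infnorm (a *\<^sub>R y + b *\<^sub>R z - x) \<le> a * infnorm (y - x) + b * infnorm (z - x)"
    using infnorm_triangle[of "a *\<^sub>R (y - x)" "b *\<^sub>R (z - x)"] ab by (simp add: infnorm_mul)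
  also have "\<dots> \<le> a * r + b * r"
    using y z ab by (intro add_mono mult_left_mono) (auto simp: max_ball_def)
  also have "\<dots> = r" using ab(3) by (simp flip: distrib_right)
  finally show "a *\<^sub>R y + b *\<^sub>R z \<in> max_ball x r" by (simp add: max_ball_def)
qed

lemma compact_max_ball: "compact (max_ball (x :: real ^ 'k::finite) r)"
proof -
  have "max_ball x r \<subseteq> cball x (sqrt DIM(real ^ 'k) * r)"
  proof
    fix y assume "y \<in> max_ball x r"
    then have "infnorm (y - x) \<le> r" by (simp add: max_ball_def)
    then have "norm (y - x) \<le> sqrt DIM(real ^ 'k) * r"
      by (intro order_trans[OF norm_le_infnorm] mult_left_mono) auto
    then show "y \<in> cball x (sqrt DIM(real ^ 'k) * r)" by (simp add: dist_norm norm_minus_commute)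
  qed
  moreover have "closed (max_ball x r)"
    unfolding max_ball_def by (intro closed_Collect_le continuous_intros)
  ultimately show ?thesis
    using bounded_subset[OF bounded_cball] compact_eq_bounded_closed by blast
qed

lemma max_ball_in_open:
  fixes w :: "real ^ 'k::finite"
  assumes "open U" "w \<in> U"
  obtains r where "0 < r" "max_ball w r \<subseteq> U"
proof -
  obtain e where e: "0 < e" "cball w e \<subseteq> U" using assms open_contains_cball by blast
  have s: "0 < sqrt (real CARD('k))" by simp
  have "max_ball w (e / sqrt (real CARD('k))) \<subseteq> cball w e"
  proof
    fix y assume "y \<in> max_ball w (e / sqrt (real CARD('k)))"
    then have "infnorm (y - w) \<le> e / sqrt (real CARD('k))" by (simp add: max_ball_def)
    then have "sqrt (real CARD('k)) * infnorm (y - w) \<le> e"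
      using s by (simp only: pos_le_divide_eq mult.commute)
    then have "norm (y - w) \<le> e" using norm_le_infnorm[of "y - w"] by simp
    then show "y \<in> cball w e" by (simp add: dist_norm norm_minus_commute)
  qed
  then show thesis using that[of "e / sqrt (real CARD('k))"] e s by auto
qed

text \<open>Supplies a compact set on which all constants of the game can be chosen, and which contains a
  fourfold enlargement of every small ball that still matters.\<close>

lemma compact_neighbourhood:
  fixes K U :: "(real ^ 'k::finite) set"
  assumes "compact K" "open U" "K \<subseteq> U"
  obtains K' r where "compact K'" "K' \<subseteq> U" "0 < r"
    "\<And>x \<rho>. \<rho> \<le> r \<Longrightarrow> max_ball x \<rho> \<inter> K \<noteq> {} \<Longrightarrow> max_ball x (4 * \<rho>) \<subseteq> K'"
proof -
  obtain e where e: "0 < e" "(\<Union>x\<in>K. cball x e) \<subseteq> U"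
    using compact_subset_open_imp_cball_epsilon_subset[OF assms] by blast
  \<comment> \<open>\<open>q\<close> converts the max norm to the Euclidean one; \<open>5 = 4 + 1\<close> is the distance from \<open>K\<close>
    in radii.\<close>
  define q where "q = sqrt (real CARD('k))"
  have q: "0 < q" by (simp add: q_def)
  show thesis
  proof (rule that[of "\<Union>x\<in>K. cball x e" "e / (5 * q)"])
    show "compact (\<Union>x\<in>K. cball x e)" by (rule compact_minkowski_sum_cball[OF assms(1)])
    show "(\<Union>x\<in>K. cball x e) \<subseteq> U" by (rule e(2))
    show "0 < e / (5 * q)" using e q by simp
    fix x \<rho> assume \<rho>: "\<rho> \<le> e / (5 * q)" and "max_ball x \<rho> \<inter> K \<noteq> {}"
    then obtain z where z: "z \<in> K" "infnorm (z - x) \<le> \<rho>" by (auto simp: max_ball_def)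
    show "max_ball x (4 * \<rho>) \<subseteq> (\<Union>x\<in>K. cball x e)"
    proof
      fix y assume "y \<in> max_ball x (4 * \<rho>)"
      then have "infnorm (y - x) \<le> 4 * \<rho>" by (simp add: max_ball_def)
      then have "infnorm (y - z) \<le> 5 * \<rho>"
        using infnorm_triangle[of "y - x" "x - z"] z(2) by (simp add: infnorm_sub[of x])
      then have "q * infnorm (y - z) \<le> q * (5 * \<rho>)" using q by (intro mult_left_mono) auto
      also have "\<dots> \<le> e" using \<rho> q by (simp add: pos_le_divide_eq mult.commute mult.left_commute)
      finally have "norm (y - z) \<le> e" using norm_le_sqrt_infnorm[of "y - z"] by (simp add: q_def)
      then show "y \<in> (\<Union>x\<in>K. cball x e)" using z(1) by (auto simp: dist_norm norm_minus_commute)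
    qed
  qed
qed

section \<open>Forcing a property in finitely many moves\<close>

type_synonym 'k position = "(real ^ 'k) \<times> real"

definition pball :: "'k::finite position \<Rightarrow> (real ^ 'k) set" where
  "pball s = max_ball (fst s) (snd s)"

definition legal_reply ::
    "real \<Rightarrow> (real ^ 'k) set \<Rightarrow> 'k::finite position \<Rightarrow> 'k position \<Rightarrow> bool" where
  "legal_reply \<beta> A s t \<longleftrightarrow>
     0 < snd t \<and> pball t \<subseteq> pball s - thickening A (\<beta> * snd s) \<and> \<beta> * snd s \<le> snd t"

text \<open>The winning condition for a fixed number of moves. It is a property of the current ball alone,
  so that finite pieces of play can be composed without mentioning strategies; a strategy is
  extracted only once, in \<open>winning_by_blocks\<close>. As a ball that Bob cannot answer
  satisfies every \<open>forces\<close> statement with at least one move, his being stuck needs no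
  separate treatment.\<close>

primrec forces :: "real \<Rightarrow> nat \<Rightarrow> ('k::finite position \<Rightarrow> bool) \<Rightarrow> 'k position \<Rightarrow> bool" where
  "forces \<beta> 0 P s \<longleftrightarrow> P s"
| "forces \<beta> (Suc n) P s \<longleftrightarrow>
     (\<exists>A. affine_hyperplane A \<and> (\<forall>t. legal_reply \<beta> A s t \<longrightarrow> forces \<beta> n P t))"

lemma forces_mono:
  assumes "forces \<beta> n P s" "\<And>t. P t \<Longrightarrow> Q t"
  shows "forces \<beta> n Q s"
  using assms(1)
proof (induction n arbitrary: s)
  case 0
  then show ?case using assms(2) by simp
next
  case (Suc n)
  then show ?case unfolding forces.simps by blast
qed

lemma forces_add:
  assumes "forces \<beta> m P s" "\<And>t. P t \<Longrightarrow> forces \<beta> n Q t"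
  shows "forces \<beta> (m + n) Q s"
  using assms(1)
proof (induction m arbitrary: s)
  case 0
  then show ?case using assms(2) by simp
next
  case (Suc m)
  then show ?case unfolding add_Suc forces.simps by blast
qed

text \<open>Bob cannot leave his ball and cannot shrink it faster than by the factor \<open>\<beta>\<close>;
  so any forced property may be combined with these bounds.\<close>

lemma forces_inside:
  assumes "forces \<beta> n P s" "0 < \<beta>" "0 < snd s"
  shows "forces \<beta> n (\<lambda>t. P t \<and> pball t \<subseteq> pball s \<and> 0 < snd t \<and> \<beta> ^ n * snd s \<le> snd t) s"
  using assms(1,3)
proof (induction n arbitrary: s)
  case 0
  then show ?case by simp
next
  case (Suc n)
  then obtain A where A: "affine_hyperplane A" "\<And>t. legal_reply \<beta> A s t \<Longrightarrow> forces \<beta> n P t"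
    by auto
  have "forces \<beta> n (\<lambda>t. P t \<and> pball t \<subseteq> pball s \<and> 0 < snd t \<and> \<beta> ^ Suc n * snd s \<le> snd t) u"
    if "legal_reply \<beta> A s u" for u
  proof -
    have u: "0 < snd u" "pball u \<subseteq> pball s" "\<beta> * snd s \<le> snd u"
      using that by (auto simp: legal_reply_def)
    have "\<beta> ^ n * (\<beta> * snd s) \<le> \<beta> ^ n * snd u"
      using u assms(2) by (intro mult_left_mono) auto
    then have le: "\<beta> ^ Suc n * snd s \<le> \<beta> ^ n * snd u" by (simp add: ac_simps)
    show ?thesis
      using Suc.IH[OF A(2)[OF that] u(1)] by (rule forces_mono) (use u le in auto)
  qed
  then show ?case using A(1) by auto
qed

lemma thickening_memI:
  assumes "s \<in> S" "infnorm (x - s) \<le> e"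
  shows "x \<in> thickening S e"
proof -
  have "(INF s\<in>S. infnorm (x - s)) \<le> infnorm (x - s)"
    by (rule cINF_lower[OF bdd_belowI2[where m = 0] assms(1)]) (rule infnorm_pos_le)
  then have "(INF s\<in>S. infnorm (x - s)) \<le> e" using assms(2) by linarith
  moreover have "S \<noteq> {}" using assms(1) by blast
  ultimately show ?thesis unfolding thickening_def by blast
qed

text \<open>The max-norm distance from \<open>x\<close> to the hyperplane is \<open>\<bar>a \<bullet> x -
  b\<bar>\<close> divided by the sum of the \<open>\<bar>a $ i\<bar>\<close>. The weaker bound
  with one coordinate suffices, and moving along the \<open>i\<close>-th axis proves it.\<close>

lemma not_in_thickening_hyperplane:
  fixes a :: "real ^ 'k::finite"
  assumes "x \<notin> thickening {y. a \<bullet> y = b} e" "0 \<le> e"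
  shows "e * \<bar>a $ i\<bar> \<le> \<bar>a \<bullet> x - b\<bar>"
proof (cases "a $ i = 0")
  case False
  define t where "t = (a \<bullet> x - b) / a $ i"
  let ?y = "x + (- t) *\<^sub>R axis i 1"
  have "a \<bullet> ?y = b"
    using False by (simp add: inner_diff_right inner_axis t_def)
  then have "\<not> infnorm (x - ?y) \<le> e"
    using assms(1) thickening_memI[of ?y "{y. a \<bullet> y = b}" x e] by blast
  moreover have "infnorm (?y - x) \<le> \<bar>t\<bar>"
    using max_ball_shift_mem[of "- t" "\<bar>t\<bar>" x i] unfolding max_ball_def by simp
  ultimately have "e < \<bar>t\<bar>" by (simp only: infnorm_sub[of x])
  then have "e * \<bar>a $ i\<bar> \<le> \<bar>t\<bar> * \<bar>a $ i\<bar>" by (intro mult_right_mono) auto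
  also have "\<dots> = \<bar>a \<bullet> x - b\<bar>" using False by (simp add: t_def abs_divide)
  finally show ?thesis .
qed (use assms in auto)

lemma affine_hyperplane_axis: "affine_hyperplane {y :: real ^ 'k::finite. axis i 1 \<bullet> y = b}"
  unfolding affine_hyperplane_def by (intro exI[of _ "axis i 1"] exI[of _ b]) (simp add: axis_eq_0_iff)

text \<open>Bob is driven to one side of the hyperplane through the centre orthogonal to an axis, so the
  diameter of his next ball is at most the old radius. This move makes play progress when Alice
  has nothing else to do.\<close>

lemma reply_to_central_hyperplane:
  fixes s t :: "'k::finite position"
  assumes "legal_reply \<beta> {y. axis i 1 \<bullet> y = fst s $ i} s t" "0 < \<beta>" "0 < snd s"
  shows "snd t \<le> snd s / 2"
proof (rule ccontr)
  assume big: "\<not> snd t \<le> snd s / 2"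
  define d where "d = fst t $ i - fst s $ i"
  have sub: "pball t \<subseteq> pball s"
    and off: "pball t \<inter> thickening {y. axis i 1 \<bullet> y = fst s $ i} (\<beta> * snd s) = {}"
    and pos: "0 < snd t"
    using assms(1) by (auto simp: legal_reply_def)
  have close: "\<bar>d\<bar> \<le> snd t"
  proof -
    define e where "e = (if d \<ge> 0 then snd t else - snd t)"
    have "fst t + e *\<^sub>R axis i 1 \<in> pball s"
      using sub max_ball_shift_mem[of e "snd t" "fst t" i] pos by (auto simp: pball_def e_def)
    then have "\<bar>(fst t + e *\<^sub>R axis i 1 - fst s) $ i\<bar> \<le> snd s"
      by (simp only: pball_def max_ball_def mem_Collect_eq)
         (metis component_le_infnorm_cart order_trans)
    then have "\<bar>d + e\<bar> \<le> snd s" by (simp add: d_def algebra_simps)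
    then show ?thesis using big by (auto simp: e_def split: if_splits)
  qed
  have mem: "fst t + (- d) *\<^sub>R axis i 1 \<in> pball t"
    unfolding pball_def by (rule max_ball_shift_mem) (use close in simp)
  have "fst t + (- d) *\<^sub>R axis i 1 \<in> thickening {y. axis i 1 \<bullet> y = fst s $ i} (\<beta> * snd s)"
    by (rule thickening_memI[of "fst t + (- d) *\<^sub>R axis i 1"])
       (use assms(2,3) in \<open>auto simp: inner_add_right inner_diff_right inner_axis' d_def infnorm_0 algebra_simps\<close>)
  with mem off show False by blast
qed

lemma forces_shrink:
  assumes "0 < \<beta>" "0 < snd s"
  shows "forces \<beta> n (\<lambda>t. snd t \<le> snd s / 2 ^ n) s"
  using assms(2)
proof (induction n arbitrary: s)
  case 0
  then show ?case by simp
next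
  case (Suc n)
  let ?A = "{y. axis undefined 1 \<bullet> y = fst s $ undefined}"
  have "forces \<beta> n (\<lambda>t. snd t \<le> snd s / 2 ^ Suc n) u" if u: "legal_reply \<beta> ?A s u" for u
  proof -
    have half: "snd u \<le> snd s / 2"
      using reply_to_central_hyperplane[OF u assms(1) Suc.prems] .
    have "snd u / 2 ^ n \<le> snd s / 2 ^ Suc n"
      using divide_right_mono[OF half, of "2 ^ n"] by (simp add: field_simps)
    moreover have "0 < snd u" using u by (simp add: legal_reply_def)
    ultimately show ?thesis
      using forces_mono[OF Suc.IH[of u]] by (meson order_trans)
  qed
  then show ?case unfolding forces.simps using affine_hyperplane_axis by blast
qed

text \<open>Makes numbers of moves uniform: a property inherited by smaller balls survives surplus moves.\<close>

lemma forces_idle: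
  assumes "forces \<beta> n P s" "n \<le> m" "0 < \<beta>" "0 < snd s"
    and sub: "\<And>t u. P t \<Longrightarrow> pball u \<subseteq> pball t \<Longrightarrow> P u"
  shows "forces \<beta> m P s"
proof -
  have "forces \<beta> (n + (m - n)) P s"
  proof (rule forces_add[OF forces_inside[OF assms(1,3,4)]])
    fix t assume t: "P t \<and> pball t \<subseteq> pball s \<and> 0 < snd t \<and> \<beta> ^ n * snd s \<le> snd t"
    have "0 < snd t" using t by blast
    note * = forces_inside[OF forces_shrink[OF assms(3) this] assms(3) this, of "m - n"]
    show "forces \<beta> (m - n) P t"
      by (rule forces_mono[OF *]) (metis sub t)
  qed
  then show ?thesis using assms(2) by simp
qed

lemma pball_subset_radius:
  fixes s t :: "'k::finite position"
  assumes "pball t \<subseteq> pball s" "0 \<le> snd t"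
  shows "snd t \<le> snd s"
proof -
  obtain i :: 'k where True by blast
  have *: "\<bar>fst t $ i + e - fst s $ i\<bar> \<le> snd s" if "\<bar>e\<bar> \<le> snd t" for e
  proof -
    have "fst t + e *\<^sub>R axis i 1 \<in> pball s"
      using assms(1) max_ball_shift_mem[OF that] by (auto simp: pball_def)
    then have "\<bar>(fst t + e *\<^sub>R axis i 1 - fst s) $ i\<bar> \<le> snd s"
      unfolding pball_def max_ball_def mem_Collect_eq infnorm_le_iff by blast
    then show ?thesis by simp
  qed
  show ?thesis using *[of "snd t"] *[of "- snd t"] assms(2) by simp
qed

lemma center_mem_pball: "0 \<le> snd s \<Longrightarrow> fst s \<in> pball s"
  by (simp add: pball_def max_ball_def infnorm_0)

section \<open>Winning by playing in blocks\<close>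

text \<open>Alice's move after the history \<open>h\<close>: the last position is number \<open>n\<close>,
  the current block started at position \<open>n div N * N\<close>, which determines the target,
  and \<open>n mod N\<close> moves of the block have been played. She chooses a hyperplane after
  which the target can still be forced in the remaining moves.\<close>

definition block_strategy ::
    "real \<Rightarrow> nat \<Rightarrow> ('k::finite position \<Rightarrow> 'k position \<Rightarrow> bool) \<Rightarrow> 'k position list \<Rightarrow> (real ^ 'k) set" where
  "block_strategy \<beta> N Q h =
     (let n = length h - 1 in
      SOME A. affine_hyperplane A \<and>
        (0 < N \<longrightarrow> forces \<beta> (N - n mod N) (Q (h ! (n div N * N))) (h ! n) \<longrightarrow>
          (\<forall>t. legal_reply \<beta> A (h ! n) t \<longrightarrow>
             forces \<beta> (N - 1 - n mod N) (Q (h ! (n div N * N))) t)))"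

lemma block_strategy_spec:
  "affine_hyperplane (block_strategy \<beta> N Q h)"
  "\<lbrakk>0 < N; length h = Suc n; forces \<beta> (N - n mod N) (Q (h ! (n div N * N))) (h ! n);
    legal_reply \<beta> (block_strategy \<beta> N Q h) (h ! n) t\<rbrakk>
   \<Longrightarrow> forces \<beta> (N - 1 - n mod N) (Q (h ! (n div N * N))) t"
proof -
  define n' where "n' = length h - 1"
  let ?P = "\<lambda>A. affine_hyperplane A \<and>
        (0 < N \<longrightarrow> forces \<beta> (N - n' mod N) (Q (h ! (n' div N * N))) (h ! n') \<longrightarrow>
          (\<forall>t. legal_reply \<beta> A (h ! n') t \<longrightarrow>
             forces \<beta> (N - 1 - n' mod N) (Q (h ! (n' div N * N))) t))"
  have "\<exists>A. ?P A"
  proof (cases "0 < N \<and> forces \<beta> (N - n' mod N) (Q (h ! (n' div N * N))) (h ! n')")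
    case True
    then have "n' mod N < N" by simp
    then have "N - n' mod N = Suc (N - 1 - n' mod N)" by simp
    then show ?thesis using True by auto
  next
    case False
    then show ?thesis using affine_hyperplane_axis by blast
  qed
  then have *: "?P (block_strategy \<beta> N Q h)"
    unfolding block_strategy_def Let_def n'_def[symmetric] by (rule someI_ex)
  then show "affine_hyperplane (block_strategy \<beta> N Q h)" by blast
  assume "0 < N" "length h = Suc n" "forces \<beta> (N - n mod N) (Q (h ! (n div N * N))) (h ! n)"
    "legal_reply \<beta> (block_strategy \<beta> N Q h) (h ! n) t"
  then show "forces \<beta> (N - 1 - n mod N) (Q (h ! (n div N * N))) t"
    using * unfolding n'_def by (metis diff_Suc_1)
qed

lemma legal_play_alt:
  "legal_play \<beta> \<sigma> x \<rho> \<longleftrightarrow>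
     (\<forall>n. 0 < \<rho> n) \<and>
     (\<forall>n. legal_reply \<beta> (\<sigma> (map (\<lambda>i. (x i, \<rho> i)) [0..<Suc n])) (x n, \<rho> n) (x (Suc n), \<rho> (Suc n)))"
  unfolding legal_play_def legal_reply_def pball_def by auto

text \<open>The invariant of the strategy is that the target of the current block can be forced in the
  remaining moves of the block. Since the target of a block depends on the ball at its beginning,
  Alice can react to the scale she finds there. The intersection of the nested compact balls is
  nonempty.\<close>

lemma winning_by_blocks:
  fixes S :: "(real ^ 'k::finite) set"
  assumes "0 < N" "0 < \<beta>"
    and forces: "\<And>s. 0 < snd s \<Longrightarrow> forces \<beta> N (Q s) s"
    and target: "\<And>b y. \<lbrakk>\<And>m. 0 < snd (b m); \<And>m. Q (b m) (b (Suc m)); \<And>m. y \<in> pball (b m)\<rbrakk> \<Longrightarrow> y \<in> S"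
  shows "beta_hyperplane_winning \<beta> S"
  unfolding beta_hyperplane_winning_def
proof (intro exI conjI allI impI)
  let ?\<sigma> = "block_strategy \<beta> N Q"
  show "affine_hyperplane (?\<sigma> h)" for h by (rule block_strategy_spec)
  fix x :: "nat \<Rightarrow> real ^ 'k" and \<rho>
  assume play: "legal_play \<beta> ?\<sigma> x \<rho>"
  define p where "p n = (x n, \<rho> n)" for n
  have pos: "0 < snd (p n)" for n
    using play by (simp add: legal_play_alt p_def)
  have reply: "legal_reply \<beta> (?\<sigma> (map p [0..<Suc n])) (p n) (p (Suc n))" for n
    using play unfolding legal_play_alt p_def by blast
  have nth: "map p [0..<Suc n] ! i = p i" if "i \<le> n" for i n
    using that by (simp del: upt_Suc)
  have inv: "forces \<beta> (N - n mod N) (Q (p (n div N * N))) (p n)" for n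
  proof (induction n)
    case 0
    then show ?case using forces[OF pos] by simp
  next
    case (Suc n)
    have le: "n div N * N \<le> n" by simp
    have step: "forces \<beta> (N - 1 - n mod N) (Q (p (n div N * N))) (p (Suc n))"
      using block_strategy_spec(2)[of N "map p [0..<Suc n]" n \<beta> Q "p (Suc n)"]
        Suc reply[of n] assms(1) nth[OF le] nth[of n n] by simp
    show ?case
    proof (cases "Suc (n mod N) = N")
      case True
      have "Suc n = n div N * N + Suc (n mod N)" by simp
      also have "\<dots> = Suc (n div N) * N" by (subst True) simp
      finally obtain q where q: "Suc n = q * N" by blast
      have "Suc n mod N = 0" "Suc n div N * N = Suc n"
        unfolding q using assms(1) by simp_all
      then show ?thesis using forces[OF pos[of "Suc n"]] by simp
    next
      case False
      then have "Suc n mod N = Suc (n mod N)" by (simp add: mod_Suc)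
      moreover have "Suc n div N = n div N" using False by (simp add: div_Suc mod_Suc)
      ultimately show ?thesis using step by simp
    qed
  qed
  have block: "Q (p (m * N)) (p (Suc m * N))" for m
  proof -
    define n where "n = m * N + (N - 1)"
    have "n mod N = (N - 1) mod N" "n div N = m + (N - 1) div N"
      unfolding n_def using assms(1) by (simp_all only: mod_mult_self3 div_mult_self3)
    then have n: "N - 1 - n mod N = 0" "n div N = m" "Suc n = Suc m * N"
      using assms(1) by (simp_all add: n_def)
    have le: "n div N * N \<le> n" by simp
    have "forces \<beta> (N - 1 - n mod N) (Q (p (n div N * N))) (p (Suc n))"
      using block_strategy_spec(2)[of N "map p [0..<Suc n]" n \<beta> Q "p (Suc n)"]
        inv[of n] reply[of n] assms(1) nth[OF le] nth[of n n] by simp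
    then show ?thesis unfolding n by simp
  qed
  have nest1: "pball (p (Suc n)) \<subseteq> pball (p n)" for n
    using reply[of n] by (auto simp: legal_reply_def)
  have nest: "pball (p n) \<subseteq> pball (p m)" if "m \<le> n" for m n
    using lift_Suc_antimono_le[of "\<lambda>n. pball (p n)", OF nest1 that] .
  have comp: "compact (pball s)" for s :: "'k position"
    unfolding pball_def by (rule compact_max_ball)
  have "(\<Inter>n. pball (p n)) \<noteq> {}"
  proof (rule compact_nest)
    fix n show "pball (p n) \<noteq> {}"
      using max_ball_shift_mem[of 0 "snd (p n)" "fst (p n)"] pos[of n] by (auto simp: pball_def)
  qed (use comp nest in auto)
  then obtain y where y: "\<And>n. y \<in> pball (p n)" by blast
  have "y \<in> S" by (rule target[of "\<lambda>m. p (m * N)"]) (use pos block y in auto)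
  then show "(\<Inter>n\<in>{1..}. max_ball (x n) (\<rho> n)) \<inter> S \<noteq> {}"
    using y by (auto simp: pball_def p_def)
qed

section \<open>Families of partial derivatives and Taylor's formula\<close>

text \<open>\<open>g xs\<close> plays the role of the partial derivative of \<open>g []\<close> along the
  list \<open>xs\<close> of directions, the head being the last derivative taken. Lists avoid
  multi-indices and any appeal to the symmetry of higher derivatives, and since only the
  derivative relation is required, affine combinations and shifts \<open>\<lambda>ys. g (ys @
  xs)\<close> are families of the same kind.\<close>

definition jet :: "(real ^ 'k::finite) set \<Rightarrow> ('k list \<Rightarrow> real ^ 'k \<Rightarrow> real) \<Rightarrow> bool" where
  "jet U g \<longleftrightarrow>
     (\<forall>xs. \<forall>y\<in>U. (g xs has_derivative (\<lambda>u. \<Sum>i\<in>UNIV. u $ i * g (i # xs) y)) (at y))"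

lemma jetD: "jet U g \<Longrightarrow> y \<in> U \<Longrightarrow> (g xs has_derivative (\<lambda>u. \<Sum>i\<in>UNIV. u $ i * g (i # xs) y)) (at y)"
  by (simp add: jet_def)

lemma jet_subset: "jet U g \<Longrightarrow> V \<subseteq> U \<Longrightarrow> jet V g"
  by (auto simp: jet_def)

lemma jet_continuous_on: "jet U g \<Longrightarrow> continuous_on U (g xs)"
  by (meson continuous_at_imp_continuous_on has_derivative_continuous jetD)

text \<open>Apply the mean value theorem on the segment from \<open>x\<close> to \<open>y\<close>; each of
  the coordinates contributes at most \<open>B * infnorm (y - x)\<close>.\<close>

lemma mean_value_infnorm:
  fixes f :: "real ^ 'k::finite \<Rightarrow> real"
  fixes B :: real
  assumes "convex S" "x \<in> S" "y \<in> S"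
    and der: "\<And>z. z \<in> S \<Longrightarrow> (f has_derivative (\<lambda>u. \<Sum>i\<in>UNIV. u $ i * G i z)) (at z)"
    and bound: "\<And>i z. z \<in> S \<Longrightarrow> \<bar>G i z\<bar> \<le> B"
  shows "\<bar>f y - f x\<bar> \<le> CARD('k) * B * infnorm (y - x)"
proof -
  define \<gamma> where "\<gamma> t = x + t *\<^sub>R (y - x)" for t
  have mem: "\<gamma> t \<in> S" if "0 \<le> t" "t \<le> 1" for t
  proof -
    have "\<gamma> t = (1 - t) *\<^sub>R x + t *\<^sub>R y" by (simp add: \<gamma>_def algebra_simps)
    then show ?thesis using convexD[OF assms(1-3), of "1 - t" t] that by simp
  qed
  have "((\<lambda>t. f (\<gamma> t)) has_real_derivative (\<Sum>i\<in>UNIV. (y - x) $ i * G i (\<gamma> t))) (at t)"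
    if "0 \<le> t" "t \<le> 1" for t
  proof -
    have "(\<gamma> has_derivative (\<lambda>h. h *\<^sub>R (y - x))) (at t)"
      unfolding \<gamma>_def by (auto intro!: derivative_eq_intros)
    from has_derivative_compose[OF this der[OF mem[OF that]]]
    show ?thesis
      unfolding has_field_derivative_def
      by (rule has_derivative_eq_rhs) (auto simp: sum_distrib_left sum_distrib_right algebra_simps)
  qed
  then obtain t where t: "0 < t" "t < 1"
    "f (\<gamma> 1) - f (\<gamma> 0) = (1 - 0) * (\<Sum>i\<in>UNIV. (y - x) $ i * G i (\<gamma> t))"
    using MVT2[of 0 1 "\<lambda>t. f (\<gamma> t)" "\<lambda>t. \<Sum>i\<in>UNIV. (y - x) $ i * G i (\<gamma> t)"] by auto
  have "\<bar>\<Sum>i\<in>UNIV. (y - x) $ i * G i (\<gamma> t)\<bar> \<le> (\<Sum>i\<in>(UNIV::'k set). infnorm (y - x) * B)"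
  proof (rule order_trans[OF sum_abs sum_mono])
    fix i
    have "\<bar>(y - x) $ i\<bar> * \<bar>G i (\<gamma> t)\<bar> \<le> infnorm (y - x) * B"
      using t by (intro mult_mono component_le_infnorm_cart bound mem infnorm_pos_le) auto
    then show "\<bar>(y - x) $ i * G i (\<gamma> t)\<bar> \<le> infnorm (y - x) * B" by (simp add: abs_mult)
  qed
  then show ?thesis using t(3) by (simp add: \<gamma>_def algebra_simps)
qed

lemma jet_lipschitz:
  fixes B :: real
  assumes "jet S g" "convex S" "x \<in> S" "y \<in> S" "\<And>i z. z \<in> S \<Longrightarrow> \<bar>g (i # xs) z\<bar> \<le> B"
  shows "\<bar>g xs y - g xs x\<bar> \<le> CARD('k) * B * infnorm (y - x :: real ^ 'k::finite)"
  by (rule mean_value_infnorm[where G = "\<lambda>i. g (i # xs)"]) (use assms jetD in auto)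

lemma jet_affine_approx:
  fixes x :: "real ^ 'k::finite" and r B :: real
  assumes jet: "jet (max_ball x r) g" and y: "y \<in> max_ball x r"
    and bound: "\<And>i j z. z \<in> max_ball x r \<Longrightarrow> \<bar>g (j # i # xs) z\<bar> \<le> B"
    and "0 \<le> B"
  shows "\<bar>g xs y - g xs x - (\<Sum>i\<in>UNIV. (y - x) $ i * g (i # xs) x)\<bar> \<le> (CARD('k))\<^sup>2 * B * r\<^sup>2"
proof -
  let ?S = "max_ball x r"
  define a where "a i = g (i # xs) x" for i
  define f where "f z = g xs z - (\<Sum>i\<in>UNIV. z $ i * a i)" for z
  have r: "infnorm (y - x) \<le> r" using y by (simp add: max_ball_def)
  have r0: "0 \<le> r" using r infnorm_pos_le[of "y - x"] by linarith
  have x: "x \<in> ?S" using r0 by (simp add: max_ball_def infnorm_0)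
  have "\<bar>f y - f x\<bar> \<le> CARD('k) * (CARD('k) * B * r) * infnorm (y - x)"
  proof (rule mean_value_infnorm[OF convex_max_ball x y, where G = "\<lambda>i z. g (i # xs) z - a i"])
    fix z assume z: "z \<in> ?S"
    have lin: "((\<lambda>z. \<Sum>i\<in>UNIV. z $ i * a i) has_derivative (\<lambda>u. \<Sum>i\<in>UNIV. u $ i * a i)) (at z)"
      by (intro bounded_linear_imp_has_derivative bounded_linear_sum
          bounded_linear_mult_const bounded_linear_vec_nth)
    show "(f has_derivative (\<lambda>u. \<Sum>i\<in>UNIV. u $ i * (g (i # xs) z - a i))) (at z)"
      unfolding f_def
      by (rule has_derivative_eq_rhs[OF has_derivative_diff[OF jetD[OF jet z] lin]])
         (simp add: right_diff_distrib sum_subtractf)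
    fix i
    have "\<bar>g (i # xs) z - g (i # xs) x\<bar> \<le> CARD('k) * B * infnorm (z - x)"
      by (rule jet_lipschitz[OF jet convex_max_ball x z]) (use bound in auto)
    also have "\<dots> \<le> CARD('k) * B * r"
      using z \<open>0 \<le> B\<close> by (intro mult_left_mono) (auto simp: max_ball_def)
    finally show "\<bar>g (i # xs) z - a i\<bar> \<le> CARD('k) * B * r" by (simp add: a_def)
  qed
  also have "\<dots> \<le> CARD('k) * (CARD('k) * B * r) * r"
    using r \<open>0 \<le> B\<close> r0 by (intro mult_left_mono) auto
  also have "\<dots> = (CARD('k))\<^sup>2 * B * r\<^sup>2" by (simp add: power2_eq_square)
  finally show ?thesis
    by (simp add: f_def a_def algebra_simps sum_subtractf)
qed

lemma finite_lists_length: "finite {xs :: 'k::finite list. length xs = p}"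
  using finite_lists_length_eq[of "UNIV :: 'k set" p] by simp

lemma finite_lists_le: "finite {xs :: 'k::finite list. length xs \<le> n}"
  using finite_lists_length_le[of "UNIV :: 'k set" n] by simp

lemma card_lists_length: "card {xs :: 'k::finite list. length xs = p} = CARD('k) ^ p"
  using card_lists_length_eq[of "UNIV :: 'k set" p] by simp

lemma lists_Suc_eq:
  "{xs :: 'k list. length xs = Suc p} = (\<lambda>(i, xs). i # xs) ` (UNIV \<times> {xs. length xs = p})"
  by (auto simp: length_Suc_conv image_iff)

lemma sum_lists_Suc:
  fixes h :: "'k::finite list \<Rightarrow> real"
  shows "(\<Sum>xs | length xs = Suc p. h xs) = (\<Sum>xs | length xs = p. \<Sum>i\<in>UNIV. h (i # xs))"
  unfolding lists_Suc_eq
  by (subst sum.reindex) (auto simp: inj_on_def sum.cartesian_product' sum.swap[of _ UNIV])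

definition monom_list :: "real ^ 'k::finite \<Rightarrow> 'k list \<Rightarrow> real" where
  "monom_list u xs = (\<Prod>i\<leftarrow>xs. u $ i)"

lemma monom_list_bound:
  assumes "infnorm u \<le> r"
  shows "\<bar>monom_list u xs\<bar> \<le> r ^ length xs"
proof (induction xs)
  case (Cons i xs)
  have "0 \<le> r" using assms infnorm_pos_le[of u] by linarith
  then have "\<bar>u $ i\<bar> * \<bar>monom_list u xs\<bar> \<le> r * r ^ length xs"
    using Cons component_le_infnorm_cart[of u i] assms by (intro mult_mono) auto
  then show ?case by (simp add: monom_list_def abs_mult)
qed (simp add: monom_list_def)

text \<open>Restrict to the segment from \<open>x\<close> to \<open>x + u\<close>: the \<open>p\<close>-th
  derivative of the restriction is the sum, over all lists of length \<open>p\<close>, of the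
  derivatives along the list weighted by the product of the coordinates of \<open>u\<close>, so
  the one-dimensional formula applies.\<close>

lemma jet_taylor:
  fixes g :: "'k::finite list \<Rightarrow> real ^ 'k \<Rightarrow> real" and r B :: real
  assumes jet: "jet S g" and conv: "convex S" and x: "x \<in> S" and xu: "x + u \<in> S"
    and u: "infnorm u \<le> r" and n: "0 < n"
    and bound: "\<And>xs z. length xs = n \<Longrightarrow> z \<in> S \<Longrightarrow> \<bar>g xs z\<bar> \<le> B"
  shows "\<bar>g [] (x + u) - (\<Sum>p<n. (\<Sum>xs | length xs = p. monom_list u xs * g xs x) / fact p)\<bar>
           \<le> (CARD('k) * r) ^ n * B"
proof -
  define \<gamma> where "\<gamma> t = x + t *\<^sub>R u" for t
  define D where "D p t = (\<Sum>xs | length xs = p. monom_list u xs * g xs (\<gamma> t))" for p t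
  have r0: "0 \<le> r" using u infnorm_pos_le[of u] by linarith
  have mem: "\<gamma> t \<in> S" if "0 \<le> t" "t \<le> 1" for t
  proof -
    have "\<gamma> t = (1 - t) *\<^sub>R x + t *\<^sub>R (x + u)" by (simp add: \<gamma>_def algebra_simps)
    then show ?thesis using convexD[OF conv x xu, of "1 - t" t] that by simp
  qed
  have der: "(D p has_real_derivative D (Suc p) t) (at t)" if "0 \<le> t" "t \<le> 1" for p t
  proof -
    have "((\<lambda>t. g xs (\<gamma> t)) has_real_derivative (\<Sum>i\<in>UNIV. u $ i * g (i # xs) (\<gamma> t))) (at t)" for xs
    proof -
      have "(\<gamma> has_derivative (\<lambda>h. h *\<^sub>R u)) (at t)"
        unfolding \<gamma>_def by (auto intro!: derivative_eq_intros)
      from has_derivative_compose[OF this jetD[OF jet mem[OF that]]]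
      show ?thesis
        unfolding has_field_derivative_def
        by (rule has_derivative_eq_rhs) (auto simp: sum_distrib_left sum_distrib_right algebra_simps)
    qed
    then have "(D p has_real_derivative
        (\<Sum>xs | length xs = p. monom_list u xs * (\<Sum>i\<in>UNIV. u $ i * g (i # xs) (\<gamma> t)))) (at t)"
      unfolding D_def by (intro DERIV_sum DERIV_cmult)
    also have "(\<Sum>xs | length xs = p. monom_list u xs * (\<Sum>i\<in>UNIV. u $ i * g (i # xs) (\<gamma> t))) = D (Suc p) t"
      unfolding D_def sum_lists_Suc by (simp add: monom_list_def sum_distrib_left ac_simps)
    finally show ?thesis .
  qed
  obtain t where t: "0 < t" "t < 1" "D 0 1 = (\<Sum>m<n. D m 0 / fact m * 1 ^ m) + D n t / fact n * 1 ^ n"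
    using Maclaurin[of 1 n D "D 0"] n der by auto
  have "\<bar>D n t\<bar> \<le> (\<Sum>xs\<in>{xs :: 'k list. length xs = n}. r ^ n * B)"
    unfolding D_def
  proof (rule order_trans[OF sum_abs sum_mono])
    fix xs :: "'k list" assume "xs \<in> {xs. length xs = n}"
    then have "\<bar>monom_list u xs\<bar> * \<bar>g xs (\<gamma> t)\<bar> \<le> r ^ n * B"
      using t r0 monom_list_bound[OF u, of xs] by (intro mult_mono bound mem) auto
    then show "\<bar>monom_list u xs * g xs (\<gamma> t)\<bar> \<le> r ^ n * B" by (simp add: abs_mult)
  qed
  also have "\<dots> = (CARD('k) * r) ^ n * B" by (simp add: card_lists_length power_mult_distrib)
  finally have Dn: "\<bar>D n t\<bar> \<le> (CARD('k) * r) ^ n * B" .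
  have "\<bar>D n t / fact n\<bar> \<le> \<bar>D n t\<bar>"
    using divide_left_mono[of 1 "fact n" "\<bar>D n t\<bar>"] by simp
  moreover have "D 0 1 = g [] (x + u)" by (simp add: D_def \<gamma>_def monom_list_def)
  moreover have "D m 0 = (\<Sum>xs | length xs = m. monom_list u xs * g xs x)" for m
    by (simp add: D_def \<gamma>_def)
  ultimately have "g [] (x + u) - (\<Sum>p<n. (\<Sum>xs | length xs = p. monom_list u xs * g xs x) / fact p)
      = D n t / fact n"
    using t(3) by simp
  then show ?thesis using \<open>\<bar>D n t / fact n\<bar> \<le> \<bar>D n t\<bar>\<close> Dn by linarith
qed

lemma jet_bounded_on_compact:
  fixes g :: "'k::finite list \<Rightarrow> real ^ 'k \<Rightarrow> real"
  assumes "jet K g" "compact K"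
  shows "\<exists>B>0. \<forall>xs z. length xs \<le> n \<longrightarrow> z \<in> K \<longrightarrow> \<bar>g xs z\<bar> \<le> B"
proof -
  have "\<exists>B. \<forall>z\<in>K. \<bar>g xs z\<bar> \<le> B" for xs
  proof -
    have "bounded (g xs ` K)"
      using compact_continuous_image[OF jet_continuous_on[OF assms(1)] assms(2)] compact_imp_bounded by blast
    then show ?thesis by (auto simp: bounded_iff)
  qed
  then obtain b where b: "\<And>xs z. z \<in> K \<Longrightarrow> \<bar>g xs z\<bar> \<le> b xs" by metis
  let ?L = "{xs :: 'k list. length xs \<le> n}"
  show ?thesis
  proof (intro exI[of _ "1 + (\<Sum>xs\<in>?L. \<bar>b xs\<bar>)"] conjI allI impI)
    show "0 < 1 + (\<Sum>xs\<in>?L. \<bar>b xs\<bar>)" by (intro add_pos_nonneg sum_nonneg) auto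
    fix xs :: "'k list" and z assume xs: "length xs \<le> n" and z: "z \<in> K"
    have "\<bar>b xs\<bar> \<le> (\<Sum>xs\<in>?L. \<bar>b xs\<bar>)"
      by (rule member_le_sum) (use xs finite_lists_le in auto)
    then show "\<bar>g xs z\<bar> \<le> 1 + (\<Sum>xs\<in>?L. \<bar>b xs\<bar>)" using b[OF z, of xs] by linarith
  qed
qed

section \<open>Keeping away from the zero set of a nondegenerate function\<close>

lemma ex_half_power_le:
  fixes \<kappa> :: real
  assumes "0 < \<kappa>"
  obtains p :: nat where "1 / 2 ^ p \<le> \<kappa>"
proof -
  obtain p where "(1 / 2 :: real) ^ p < \<kappa>" using real_arch_pow_inv[OF assms, of "1 / 2"] by auto
  then show thesis using that[of p] by (simp add: power_divide)
qed

text \<open>The inductive step of the avoidance argument, in scale-free form: \<open>\<rho>\<close> is the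
  scale, \<open>\<bar>g ys z\<bar> * \<rho> ^ length ys\<close> a scaled derivative and
  \<open>\<eta>\<close> its unit. If a derivative of \<open>g xs\<close> is large, then after
  shrinking the ball \<open>g xs\<close> is affine up to a relatively small error, and off a strip
  around the zero set of the affine part it is large. The lower bound on the new radius prepares
  the next step.\<close>

lemma forces_lower_order_away:
  fixes \<beta> C \<gamma> :: real
  assumes pos: "0 < \<beta>" "0 < C" "0 < \<gamma>"
  obtains N \<epsilon> where "0 < \<epsilon>" and
    "\<And>g \<eta> \<rho> i xs (s :: 'k::finite position).
       \<lbrakk>0 < \<eta>; 0 < \<rho>; jet (pball s) g; \<gamma> * \<rho> \<le> snd s; snd s \<le> \<rho>;
        \<And>ys z. z \<in> pball s \<Longrightarrow> length ys = length xs + 2 \<Longrightarrow> \<bar>g ys z\<bar> * \<rho> ^ length ys \<le> C * \<eta>;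
        \<And>z. z \<in> pball s \<Longrightarrow> \<gamma> * \<eta> \<le> \<bar>g (i # xs) z\<bar> * \<rho> ^ (length xs + 1)\<rbrakk>
       \<Longrightarrow> forces \<beta> N (\<lambda>t. pball t \<subseteq> pball s \<and> \<epsilon> * \<rho> \<le> snd t \<and>
             (\<forall>z\<in>pball t. \<epsilon> * \<eta> \<le> \<bar>g xs z\<bar> * \<rho> ^ length xs)) s"
proof -
  define K where "K = (real CARD('k))\<^sup>2 * C"
  have K: "0 < K" unfolding K_def using pos by simp
  \<comment> \<open>\<open>p\<close> halvings make the ball so small that the Taylor remainder costs at most
    half of the gain \<open>\<beta> * \<gamma>\<close> that the forbidden strip provides.\<close>
  obtain p :: nat where p: "1 / 2 ^ p \<le> \<beta> * \<gamma> / (2 * K)"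
    using ex_half_power_le[of "\<beta> * \<gamma> / (2 * K)"] pos K by auto
  define \<epsilon> where "\<epsilon> = min (\<beta> ^ (p + 1) * \<gamma>) (\<beta> ^ (p + 1) * \<gamma>\<^sup>2 / 2)"
  show thesis
  proof (rule that[of \<epsilon> "p + 1"])
    show "0 < \<epsilon>" using pos by (simp add: \<epsilon>_def)
  next
    fix g \<eta> \<rho> i xs and s :: "'k position"
    assume \<eta>: "0 < \<eta>" and \<rho>: "0 < \<rho>" and jet: "jet (pball s) g"
      and s: "\<gamma> * \<rho> \<le> snd s" "snd s \<le> \<rho>"
      and C: "\<And>ys z. z \<in> pball s \<Longrightarrow> length ys = length xs + 2 \<Longrightarrow> \<bar>g ys z\<bar> * \<rho> ^ length ys \<le> C * \<eta>"
      and big: "\<And>z. z \<in> pball s \<Longrightarrow> \<gamma> * \<eta> \<le> \<bar>g (i # xs) z\<bar> * \<rho> ^ (length xs + 1)"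
    define l where "l = length xs"
    have "0 < \<gamma> * \<rho>" using pos \<rho> by simp
    with s have s0: "0 < snd s" by linarith
    show "forces \<beta> (p + 1) (\<lambda>t. pball t \<subseteq> pball s \<and> \<epsilon> * \<rho> \<le> snd t \<and>
             (\<forall>z\<in>pball t. \<epsilon> * \<eta> \<le> \<bar>g xs z\<bar> * \<rho> ^ length xs)) s" (is "forces _ _ ?P s")
    proof (rule forces_add[OF forces_inside[OF forces_shrink[OF pos(1) s0] pos(1) s0]])
      fix t :: "'k position"
      assume "snd t \<le> snd s / 2 ^ p \<and> pball t \<subseteq> pball s \<and> 0 < snd t \<and> \<beta> ^ p * snd s \<le> snd t"
      then have t: "snd t \<le> snd s / 2 ^ p" "pball t \<subseteq> pball s" "0 < snd t" "\<beta> ^ p * snd s \<le> snd t"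
        by auto
      define x where "x = fst t"
      define w where "w = snd t / \<rho>"
      have tw: "snd t = w * \<rho>" using \<rho> by (simp add: w_def)
      have w0: "0 < w" using t(3) \<rho> by (simp add: w_def)
      have x: "x \<in> pball s" using center_mem_pball[of t] t by (auto simp: x_def)
      have w_le: "K * w \<le> \<beta> * \<gamma> / 2"
      proof -
        have "snd t \<le> \<rho> * (1 / 2 ^ p)"
          using t(1) divide_right_mono[OF s(2), of "2 ^ p"] by simp
        also have "\<dots> \<le> \<rho> * (\<beta> * \<gamma> / (2 * K))" using p \<rho> by (intro mult_left_mono) auto
        finally have "w * \<rho> \<le> \<beta> * \<gamma> / (2 * K) * \<rho>" by (simp add: tw mult.commute)
        then have "w \<le> \<beta> * \<gamma> / (2 * K)" using \<rho> by (rule mult_right_le_imp_le)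
        then show ?thesis using K by (simp add: field_simps)
      qed
      have w_ge: "\<beta> ^ p * \<gamma> \<le> w"
      proof -
        have "\<beta> ^ p * (\<gamma> * \<rho>) \<le> \<beta> ^ p * snd s" using s pos by (intro mult_left_mono) auto
        then have "\<beta> ^ p * \<gamma> * \<rho> \<le> w * \<rho>" using t(4) tw by (simp add: ac_simps)
        then show ?thesis using \<rho> by (rule mult_right_le_imp_le)
      qed
      \<comment> \<open>Alice deletes the zero set of the affine Taylor approximation at the centre.\<close>
      define a where "a = (\<chi> j. g (j # xs) x)"
      define A where "A = {y. a \<bullet> y = a \<bullet> x - g xs x}"
      have ai: "\<gamma> * \<eta> \<le> \<bar>a $ i\<bar> * \<rho> ^ (l + 1)" using big[OF x] by (simp add: a_def l_def)
      have "0 < \<gamma> * \<eta>" using pos \<eta> by simp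
      then have "a $ i \<noteq> 0" using ai by auto
      then have "a \<noteq> 0" by (metis zero_index)
      then have hyp: "affine_hyperplane A" by (auto simp: affine_hyperplane_def A_def)
      have "?P u" if u: "legal_reply \<beta> A t u" for u
      proof (intro conjI ballI)
        have u': "0 < snd u" "pball u \<subseteq> pball t - thickening A (\<beta> * snd t)" "\<beta> * snd t \<le> snd u"
          using u by (auto simp: legal_reply_def)
        then show "pball u \<subseteq> pball s" using t(2) by blast
        have "\<epsilon> * \<rho> \<le> (\<beta> ^ (p + 1) * \<gamma>) * \<rho>" using \<rho> by (simp add: \<epsilon>_def)
        also have "\<dots> = \<beta> * ((\<beta> ^ p * \<gamma>) * \<rho>)" by simp
        also have "\<dots> \<le> \<beta> * snd t"
          unfolding tw using w_ge pos \<rho> by (intro mult_left_mono mult_right_mono) auto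
        finally show "\<epsilon> * \<rho> \<le> snd u" using u'(3) by linarith
        fix z assume z: "z \<in> pball u"
        define L where "L = a \<bullet> z - (a \<bullet> x - g xs x)"
        define B where "B = C * \<eta> / \<rho> ^ (l + 2)"
        have "z \<notin> thickening A (\<beta> * snd t)" and zt: "z \<in> pball t" using z u' by auto
        then have L1: "\<beta> * snd t * \<bar>a $ i\<bar> \<le> \<bar>L\<bar>"
          unfolding A_def L_def using pos t(3) by (intro not_in_thickening_hyperplane) auto
        have L: "L = g xs x + (\<Sum>j\<in>UNIV. (z - x) $ j * g (j # xs) x)"
          by (simp add: L_def a_def inner_vec_def algebra_simps sum_subtractf)
        have "\<bar>g xs z - g xs x - (\<Sum>j\<in>UNIV. (z - x) $ j * g (j # xs) x)\<bar> \<le> (CARD('k))\<^sup>2 * B * (snd t)\<^sup>2"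
        proof (rule jet_affine_approx)
          show "jet (max_ball x (snd t)) g"
            using jet_subset[OF jet t(2)] by (simp add: pball_def x_def)
          show "z \<in> max_ball x (snd t)" using zt by (simp add: pball_def x_def)
          show "0 \<le> B" using pos \<eta> \<rho> by (simp add: B_def)
          fix i j and z assume "z \<in> max_ball x (snd t)"
          then have "z \<in> pball s" using t(2) by (auto simp: pball_def x_def)
          from C[OF this, of "j # i # xs"] show "\<bar>g (j # i # xs) z\<bar> \<le> B"
            using \<rho> by (simp add: B_def l_def pos_le_divide_eq)
        qed
        then have "\<bar>L\<bar> \<le> \<bar>g xs z\<bar> + (CARD('k))\<^sup>2 * B * (snd t)\<^sup>2" unfolding L by linarith
        with L1 have "\<beta> * snd t * \<bar>a $ i\<bar> \<le> \<bar>g xs z\<bar> + (CARD('k))\<^sup>2 * B * (snd t)\<^sup>2" by linarith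
        then have "\<beta> * snd t * \<bar>a $ i\<bar> * \<rho> ^ l \<le> (\<bar>g xs z\<bar> + (CARD('k))\<^sup>2 * B * (snd t)\<^sup>2) * \<rho> ^ l"
          using \<rho> by (intro mult_right_mono) auto
        also have "\<dots> = \<bar>g xs z\<bar> * \<rho> ^ l + K * w * (w * \<eta>)"
          using \<rho> by (simp add: B_def K_def tw field_simps power2_eq_square)
        also have "\<beta> * snd t * \<bar>a $ i\<bar> * \<rho> ^ l = \<beta> * w * (\<bar>a $ i\<bar> * \<rho> ^ (l + 1))"
          by (simp add: tw)
        finally have "\<beta> * w * (\<bar>a $ i\<bar> * \<rho> ^ (l + 1)) \<le> \<bar>g xs z\<bar> * \<rho> ^ l + K * w * (w * \<eta>)" .
        moreover have "\<beta> * w * (\<gamma> * \<eta>) \<le> \<beta> * w * (\<bar>a $ i\<bar> * \<rho> ^ (l + 1))"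
          using ai pos w0 by (intro mult_left_mono) auto
        moreover have "K * w * (w * \<eta>) \<le> \<beta> * \<gamma> / 2 * (w * \<eta>)"
          using w_le w0 \<eta> by (intro mult_right_mono) auto
        ultimately have "\<beta> * \<gamma> / 2 * (w * \<eta>) \<le> \<bar>g xs z\<bar> * \<rho> ^ l" by (simp add: algebra_simps)
        moreover have "\<epsilon> * \<eta> \<le> \<beta> * \<gamma> / 2 * (w * \<eta>)"
        proof -
          have "\<epsilon> * \<eta> \<le> (\<beta> ^ (p + 1) * \<gamma>\<^sup>2 / 2) * \<eta>" using \<eta> by (simp add: \<epsilon>_def)
          also have "\<dots> = \<beta> * \<gamma> / 2 * ((\<beta> ^ p * \<gamma>) * \<eta>)" by (simp add: power2_eq_square)
          also have "\<dots> \<le> \<beta> * \<gamma> / 2 * (w * \<eta>)"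
            using w_ge pos \<eta> by (intro mult_left_mono mult_right_mono) auto
          finally show ?thesis .
        qed
        ultimately show "\<epsilon> * \<eta> \<le> \<bar>g xs z\<bar> * \<rho> ^ length xs" by (simp add: l_def)
      qed
      then show "forces \<beta> 1 ?P t" unfolding One_nat_def forces.simps using hyp by blast
    qed
  qed
qed

text \<open>Removes the directions in \<open>xs\<close> one at a time. The constants at each order depend on
  those of the order above, hence the quantification over \<open>\<gamma>\<close> in front of the
  number of moves and of \<open>\<epsilon>\<close>.\<close>

lemma forces_function_away:
  fixes \<beta> C :: real
  assumes "0 < \<beta>" "0 < C"
  shows "0 < \<gamma> \<Longrightarrow> \<exists>N \<epsilon>. 0 < \<epsilon> \<and>
    (\<forall>g \<eta> \<rho> xs (s :: 'k::finite position).
       length xs = l \<longrightarrow> 0 < \<eta> \<longrightarrow> 0 < \<rho> \<longrightarrow> jet (pball s) g \<longrightarrow> \<gamma> * \<rho> \<le> snd s \<longrightarrow> snd s \<le> \<rho> \<longrightarrow>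
       (\<forall>ys. \<forall>z\<in>pball s. 1 \<le> length ys \<longrightarrow> length ys \<le> l + 1 \<longrightarrow> \<bar>g ys z\<bar> * \<rho> ^ length ys \<le> C * \<eta>) \<longrightarrow>
       (\<forall>z\<in>pball s. \<gamma> * \<eta> \<le> \<bar>g xs z\<bar> * \<rho> ^ l) \<longrightarrow>
       forces \<beta> N (\<lambda>t. pball t \<subseteq> pball s \<and> (\<forall>z\<in>pball t. \<epsilon> * \<eta> \<le> \<bar>g [] z\<bar>)) s)"
    (is "_ \<Longrightarrow> \<exists>N \<epsilon>. ?P l \<gamma> N \<epsilon>")
proof (induction l arbitrary: \<gamma>)
  case 0
  then show ?case by (intro exI[of _ 0] exI[of _ \<gamma>]) auto
next
  case (Suc l)
  show ?case
  proof (rule forces_lower_order_away[OF assms Suc.prems, where ?'k = 'k])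
  fix N \<epsilon> assume \<epsilon>: "0 < \<epsilon>" and step:
    "\<And>g \<eta> \<rho> i xs (s :: 'k position).
       \<lbrakk>0 < \<eta>; 0 < \<rho>; jet (pball s) g; \<gamma> * \<rho> \<le> snd s; snd s \<le> \<rho>;
        \<And>ys z. z \<in> pball s \<Longrightarrow> length ys = length xs + 2 \<Longrightarrow> \<bar>g ys z\<bar> * \<rho> ^ length ys \<le> C * \<eta>;
        \<And>z. z \<in> pball s \<Longrightarrow> \<gamma> * \<eta> \<le> \<bar>g (i # xs) z\<bar> * \<rho> ^ (length xs + 1)\<rbrakk>
       \<Longrightarrow> forces \<beta> N (\<lambda>t. pball t \<subseteq> pball s \<and> \<epsilon> * \<rho> \<le> snd t \<and>
             (\<forall>z\<in>pball t. \<epsilon> * \<eta> \<le> \<bar>g xs z\<bar> * \<rho> ^ length xs)) s"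
  obtain N' \<epsilon>' where IH: "?P l \<epsilon> N' \<epsilon>'"
    using Suc.IH[OF \<epsilon>] by (elim exE)
  show ?case
  proof (rule exI[of _ "N + N'"], rule exI[of _ \<epsilon>'], intro conjI allI impI)
    show "0 < \<epsilon>'" by (rule IH[THEN conjunct1])
    fix g \<eta> \<rho> and xs :: "'k list" and s :: "'k position"
    assume len: "length xs = Suc l" and \<eta>: "0 < \<eta>" and \<rho>: "0 < \<rho>" and jet: "jet (pball s) g"
      and s: "\<gamma> * \<rho> \<le> snd s" "snd s \<le> \<rho>"
      and C: "\<forall>ys. \<forall>z\<in>pball s. 1 \<le> length ys \<longrightarrow> length ys \<le> Suc l + 1 \<longrightarrow> \<bar>g ys z\<bar> * \<rho> ^ length ys \<le> C * \<eta>"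
      and big: "\<forall>z\<in>pball s. \<gamma> * \<eta> \<le> \<bar>g xs z\<bar> * \<rho> ^ Suc l"
    obtain i ys where xs: "xs = i # ys" and ys: "length ys = l" using len by (cases xs) auto
    have "0 < \<gamma> * \<rho>" using Suc.prems \<rho> by simp
    with s have s0: "0 < snd s" by linarith
    have 1: "forces \<beta> N (\<lambda>t. pball t \<subseteq> pball s \<and> \<epsilon> * \<rho> \<le> snd t \<and>
             (\<forall>z\<in>pball t. \<epsilon> * \<eta> \<le> \<bar>g ys z\<bar> * \<rho> ^ length ys)) s"
    proof (rule step[OF \<eta> \<rho> jet s, where i = i])
      fix zs z assume "z \<in> pball s" "length (zs :: 'k list) = length ys + 2"
      then show "\<bar>g zs z\<bar> * \<rho> ^ length zs \<le> C * \<eta>"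
        by (intro C[rule_format]) (use ys in auto)
    next
      fix z assume "z \<in> pball s"
      then show "\<gamma> * \<eta> \<le> \<bar>g (i # ys) z\<bar> * \<rho> ^ (length ys + 1)" using big ys xs by simp
    qed
    show "forces \<beta> (N + N') (\<lambda>t. pball t \<subseteq> pball s \<and> (\<forall>z\<in>pball t. \<epsilon>' * \<eta> \<le> \<bar>g [] z\<bar>)) s"
    proof (rule forces_add[OF 1])
      fix t :: "'k position"
      assume t: "pball t \<subseteq> pball s \<and> \<epsilon> * \<rho> \<le> snd t \<and> (\<forall>z\<in>pball t. \<epsilon> * \<eta> \<le> \<bar>g ys z\<bar> * \<rho> ^ length ys)"
      have "0 < \<epsilon> * \<rho>" using \<epsilon> \<rho> by simp
      then have "0 \<le> snd t" using t by linarith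
      then have "snd t \<le> snd s" by (rule pball_subset_radius[OF t[THEN conjunct1]])
      have "forces \<beta> N' (\<lambda>u. pball u \<subseteq> pball t \<and> (\<forall>z\<in>pball u. \<epsilon>' * \<eta> \<le> \<bar>g [] z\<bar>)) t"
      proof (rule IH[THEN conjunct2, rule_format, OF ys \<eta> \<rho>])
        show "jet (pball t) g" using jet_subset[OF jet] t by blast
        show "\<epsilon> * \<rho> \<le> snd t" using t by blast
        show "snd t \<le> \<rho>" using \<open>snd t \<le> snd s\<close> s by linarith
        show "\<epsilon> * \<eta> \<le> \<bar>g ys z\<bar> * \<rho> ^ l" if "z \<in> pball t" for z
          using t[THEN conjunct2, THEN conjunct2, rule_format, OF that] unfolding ys .
        show "\<bar>g zs z\<bar> * \<rho> ^ length zs \<le> C * \<eta>"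
          if "z \<in> pball t" "1 \<le> length zs" "length zs \<le> l + 1" for zs z
        proof -
          have "z \<in> pball s" using t that by blast
          then show ?thesis by (intro C[rule_format]) (use that in linarith)+
        qed
      qed
      then show "forces \<beta> N' (\<lambda>t. pball t \<subseteq> pball s \<and> (\<forall>z\<in>pball t. \<epsilon>' * \<eta> \<le> \<bar>g [] z\<bar>)) t"
        by (rule forces_mono) (use t in blast)
    qed
  qed
  qed
qed

text \<open>If the derivatives of top order are under control everywhere and the lower ones at the centre,
  then all are under control everywhere: descend from order \<open>D + 1\<close> with the mean
  value estimate, losing the factor \<open>1 + 3 * k\<close> at each order.\<close>

lemma jet_scaled_bound:
  fixes C \<rho> \<eta> :: real and x :: "real ^ 'k::finite"
  assumes \<rho>: "0 < \<rho>" and \<eta>: "0 < \<eta>" and jet: "jet (max_ball x (3 * \<rho>)) g"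
    and top: "\<And>xs z. z \<in> max_ball x (3 * \<rho>) \<Longrightarrow> length xs = D + 1 \<Longrightarrow> \<bar>g xs z\<bar> * \<rho> ^ (D + 1) \<le> C * \<eta>"
    and C: "1 \<le> C"
    and center: "\<And>xs. 1 \<le> length xs \<Longrightarrow> length xs \<le> D \<Longrightarrow> \<bar>g xs x\<bar> * \<rho> ^ length xs \<le> \<eta>"
    and xs: "1 \<le> length xs" "length xs \<le> D + 1" and z: "z \<in> max_ball x (3 * \<rho>)"
  shows "\<bar>g xs z\<bar> * \<rho> ^ length xs \<le> C * (1 + 3 * real CARD('k)) ^ (D + 1) * \<eta>"
proof -
  define K where "K = 1 + 3 * real CARD('k)"
  have K: "1 \<le> K" by (simp add: K_def)
  have main: "\<bar>g xs z\<bar> * \<rho> ^ length xs \<le> C * K ^ j * \<eta>"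
    if "length xs + j = D + 1" "1 \<le> length xs" "z \<in> max_ball x (3 * \<rho>)" for j xs z
    using that
  proof (induction j arbitrary: xs z)
    case 0
    then have "length xs = D + 1" by simp
    with top[OF 0(3) this] show ?case by simp
  next
    case (Suc j)
    let ?l = "length xs"
    define B where "B = C * K ^ j * \<eta> / \<rho> ^ (?l + 1)"
    have "0 < C" "0 < K" using C K by auto
    then have B0: "0 \<le> B" using \<eta> \<rho> unfolding B_def by (intro divide_nonneg_pos mult_nonneg_nonneg zero_le_power zero_less_power) auto
    have x: "x \<in> max_ball x (3 * \<rho>)" using \<rho> by (simp add: max_ball_def infnorm_0)
    have "\<bar>g xs z - g xs x\<bar> \<le> CARD('k) * B * infnorm (z - x)"
    proof (rule jet_lipschitz[OF jet convex_max_ball x Suc.prems(3)])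
      fix i y assume "y \<in> max_ball x (3 * \<rho>)"
      then have "\<bar>g (i # xs) y\<bar> * \<rho> ^ (?l + 1) \<le> C * K ^ j * \<eta>"
        using Suc.IH[of "i # xs" y] Suc.prems(1) by simp
      then show "\<bar>g (i # xs) y\<bar> \<le> B" using \<rho> by (simp add: B_def pos_le_divide_eq)
    qed
    also have "\<dots> \<le> CARD('k) * B * (3 * \<rho>)"
      using Suc.prems(3) B0 by (intro mult_left_mono) (auto simp: max_ball_def)
    finally have "\<bar>g xs z\<bar> \<le> \<bar>g xs x\<bar> + CARD('k) * B * (3 * \<rho>)" by linarith
    then have "\<bar>g xs z\<bar> * \<rho> ^ ?l \<le> (\<bar>g xs x\<bar> + CARD('k) * B * (3 * \<rho>)) * \<rho> ^ ?l"
      using \<rho> by (intro mult_right_mono) auto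
    also have "\<dots> = \<bar>g xs x\<bar> * \<rho> ^ ?l + 3 * real CARD('k) * (B * \<rho> ^ (?l + 1))"
      by (simp add: algebra_simps)
    finally have le: "\<bar>g xs z\<bar> * \<rho> ^ ?l \<le> \<bar>g xs x\<bar> * \<rho> ^ ?l + 3 * real CARD('k) * (B * \<rho> ^ (?l + 1))" .
    have BT: "B * \<rho> ^ (?l + 1) = C * K ^ j * \<eta>" using \<rho> by (simp add: B_def)
    have c: "\<bar>g xs x\<bar> * \<rho> ^ ?l \<le> \<eta>" by (rule center) (use Suc.prems in auto)
    have "1 * 1 \<le> C * K ^ j" using C one_le_power[OF K, of j] by (intro mult_mono) auto
    then have "1 * \<eta> \<le> C * K ^ j * \<eta>" using \<eta> by (intro mult_right_mono) auto
    with le c have "\<bar>g xs z\<bar> * \<rho> ^ ?l \<le> C * K ^ j * \<eta> + 3 * real CARD('k) * (C * K ^ j * \<eta>)"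
      unfolding BT by linarith
    also have "\<dots> = K * (C * K ^ j * \<eta>)" unfolding K_def distrib_right by simp
    also have "\<dots> = C * K ^ Suc j * \<eta>" by simp
    finally show ?case .
  qed
  have "\<bar>g xs z\<bar> * \<rho> ^ length xs \<le> C * K ^ (D + 1 - length xs) * \<eta>"
    by (rule main) (use xs z in auto)
  also have "\<dots> \<le> C * K ^ (D + 1) * \<eta>"
    using K C \<eta> by (intro mult_left_mono mult_right_mono power_increasing) auto
  finally show ?thesis unfolding K_def .
qed

text \<open>At small scales a derivative bounded below by \<open>\<delta>\<close> need not dominate: lower
  derivatives may be far larger after scaling. So the argument starts from the scaled derivative
  that is largest at the centre of a suitably shrunken ball. Its size \<open>\<eta>\<close> is at
  least \<open>\<delta> * \<rho> ^ D\<close>, whereas the scaled derivatives of order \<open>D +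
  1\<close> are at most \<open>C0 * \<rho> ^ (D + 1)\<close>, so \<open>\<eta>\<close> bounds all
  scaled derivatives up to a constant. In particular \<open>g []\<close> is Lipschitz with
  constant of order \<open>\<eta> / \<rho>\<close>, and a lower bound of order
  \<open>\<eta>\<close> for it yields the distance \<open>\<epsilon> * \<rho>\<close> from its
  zeros.\<close>

lemma forces_away_from_zero_set:
  fixes \<beta> C0 \<delta> :: real and D :: nat
  assumes pos: "0 < \<beta>" "0 < C0" "0 < \<delta>"
  obtains N \<epsilon> where "0 < \<epsilon>" and
    "\<And>g (s :: 'k::finite position).
       \<lbrakk>0 < snd s; snd s \<le> 1; jet (max_ball (fst s) (4 * snd s)) g;
        \<And>xs z. z \<in> max_ball (fst s) (4 * snd s) \<Longrightarrow> length xs = D + 1 \<Longrightarrow> \<bar>g xs z\<bar> \<le> C0;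
        \<And>z. z \<in> max_ball (fst s) (4 * snd s) \<Longrightarrow>
          \<exists>xs. 1 \<le> length xs \<and> length xs \<le> D \<and> \<delta> \<le> \<bar>g xs z\<bar>\<rbrakk>
       \<Longrightarrow> forces \<beta> N (\<lambda>t. pball t \<subseteq> pball s \<and>
             (\<forall>z\<in>pball t. \<forall>y\<in>max_ball (fst s) (2 * snd s). g [] y = 0 \<longrightarrow> \<epsilon> * snd s \<le> infnorm (z - y))) s"
proof -
  define K where "K = real CARD('k)"
  define C1 where "C1 = max 1 (C0 / \<delta>)"
  define C where "C = C1 * (1 + 3 * K) ^ (D + 1)"
  have K: "0 < K" "1 \<le> 1 + 3 * K" by (simp_all add: K_def)
  have C1: "1 \<le> C1" by (simp add: C1_def)
  have "0 < (1 + 3 * K) ^ (D + 1)" using K by (intro zero_less_power) auto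
  then have C: "0 < C" using C1 unfolding C_def by (intro mult_pos_pos) auto
  \<comment> \<open>After \<open>p\<close> halvings the selected derivative varies by at most half of its value at
    the centre.\<close>
  obtain p :: nat where p: "1 / 2 ^ p \<le> 1 / (2 * K * C)"
    using ex_half_power_le[of "1 / (2 * K * C)"] K C by auto
  define \<gamma> where "\<gamma> = min (1 / 2) (\<beta> ^ p)"
  have \<gamma>: "0 < \<gamma>" using pos by (simp add: \<gamma>_def)
  define R where "R l N \<epsilon> \<longleftrightarrow> 0 < \<epsilon> \<and>
    (\<forall>g \<eta> \<rho> xs (s :: 'k position).
       length xs = l \<longrightarrow> 0 < \<eta> \<longrightarrow> 0 < \<rho> \<longrightarrow> jet (pball s) g \<longrightarrow> \<gamma> * \<rho> \<le> snd s \<longrightarrow> snd s \<le> \<rho> \<longrightarrow>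
       (\<forall>ys. \<forall>z\<in>pball s. 1 \<le> length ys \<longrightarrow> length ys \<le> l + 1 \<longrightarrow> \<bar>g ys z\<bar> * \<rho> ^ length ys \<le> C * \<eta>) \<longrightarrow>
       (\<forall>z\<in>pball s. \<gamma> * \<eta> \<le> \<bar>g xs z\<bar> * \<rho> ^ l) \<longrightarrow>
       forces \<beta> N (\<lambda>t. pball t \<subseteq> pball s \<and> (\<forall>z\<in>pball t. \<epsilon> * \<eta> \<le> \<bar>g [] z\<bar>)) s)" for l N \<epsilon>
  have "\<exists>N \<epsilon>. R l N \<epsilon>" for l
    unfolding R_def by (rule forces_function_away[OF pos(1) C \<gamma>])
  then obtain Nf \<epsilon>f where R: "\<And>l. R l (Nf l) (\<epsilon>f l)" by metis
  note away = R[unfolded R_def]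
  \<comment> \<open>The order of the selected derivative depends on the ball, so \<open>N\<close> has to serve all orders;
    surplus moves are spent idly.\<close>
  define N where "N = (\<Sum>l\<le>D. Nf l)"
  define \<epsilon>1 where "\<epsilon>1 = Min (\<epsilon>f ` {..D})"
  have \<epsilon>1: "0 < \<epsilon>1" using away[THEN conjunct1] by (simp add: \<epsilon>1_def)
  show thesis
  proof (rule that[of "\<epsilon>1 / (K * C)" "p + N"])
    show "0 < \<epsilon>1 / (K * C)" using \<epsilon>1 K C by simp
  next
    fix g and s :: "'k position"
    define \<rho> where "\<rho> = snd s"
    assume "0 < snd s" "snd s \<le> 1" and "jet (max_ball (fst s) (4 * snd s)) g"
      and "\<And>xs z. z \<in> max_ball (fst s) (4 * snd s) \<Longrightarrow> length xs = D + 1 \<Longrightarrow> \<bar>g xs z\<bar> \<le> C0"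
      and nondeg: "\<And>z. z \<in> max_ball (fst s) (4 * snd s) \<Longrightarrow>
          \<exists>xs. 1 \<le> length xs \<and> length xs \<le> D \<and> \<delta> \<le> \<bar>g xs z\<bar>"
    then have \<rho>: "0 < \<rho>" "\<rho> \<le> 1" and jet: "jet (max_ball (fst s) (4 * \<rho>)) g"
      and top: "\<And>xs z. z \<in> max_ball (fst s) (4 * \<rho>) \<Longrightarrow> length xs = D + 1 \<Longrightarrow> \<bar>g xs z\<bar> \<le> C0"
      by (auto simp: \<rho>_def)
    let ?P = "\<lambda>t. pball t \<subseteq> pball s \<and>
      (\<forall>z\<in>pball t. \<forall>y\<in>max_ball (fst s) (2 * snd s). g [] y = 0 \<longrightarrow> \<epsilon>1 / (K * C) * snd s \<le> infnorm (z - y))"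
    show "forces \<beta> (p + N) ?P s"
    proof (rule forces_add[OF forces_inside[OF forces_shrink[OF pos(1)] pos(1)]])
      show "0 < snd s" "0 < snd s" by fact+
      fix t :: "'k position"
      assume "snd t \<le> snd s / 2 ^ p \<and> pball t \<subseteq> pball s \<and> 0 < snd t \<and> \<beta> ^ p * snd s \<le> snd t"
      then have t: "snd t \<le> \<rho> / 2 ^ p" "pball t \<subseteq> pball s" "0 < snd t" "\<beta> ^ p * \<rho> \<le> snd t"
        by (auto simp: \<rho>_def)
      define x where "x = fst t"
      have "x \<in> pball s" using center_mem_pball[of t] t by (auto simp: x_def)
      then have xs: "infnorm (x - fst s) \<le> \<rho>" by (simp add: pball_def max_ball_def \<rho>_def)
      have sub43: "max_ball x (3 * \<rho>) \<subseteq> max_ball (fst s) (4 * \<rho>)"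
        by (rule max_ball_subset) (use xs in simp)
      have sub32: "max_ball (fst s) (2 * \<rho>) \<subseteq> max_ball x (3 * \<rho>)"
        by (rule max_ball_subset) (use xs in \<open>simp add: infnorm_sub[of "fst s"]\<close>)
      have sub31: "pball s \<subseteq> max_ball x (3 * \<rho>)"
        unfolding pball_def
        by (rule max_ball_subset) (use xs \<rho> in \<open>simp add: infnorm_sub[of "fst s"] \<rho>_def\<close>)
      have x: "x \<in> max_ball x (3 * \<rho>)" using \<rho> by (simp add: max_ball_def infnorm_0)
      have jet3: "jet (max_ball x (3 * \<rho>)) g" by (rule jet_subset[OF jet sub43])
      \<comment> \<open>Normalizing by the scaled derivative that is largest at the centre makes the
        estimates uniform in \<open>\<rho>\<close>: all scaled derivatives are then at most a constant times
        this one.\<close>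
      let ?L = "{xs :: 'k list. 1 \<le> length xs \<and> length xs \<le> D}"
      let ?w = "\<lambda>xs. \<bar>g xs x\<bar> * \<rho> ^ length xs"
      have finL: "finite ?L" by (rule finite_subset[OF _ finite_lists_le[of D]]) auto
      obtain xs0 where xs0: "xs0 \<in> ?L" "\<delta> \<le> \<bar>g xs0 x\<bar>"
        using nondeg[of x] sub43 x by (auto simp: \<rho>_def)
      define \<eta> where "\<eta> = Max (?w ` ?L)"
      have le_\<eta>: "?w xs \<le> \<eta>" if "xs \<in> ?L" for xs
        unfolding \<eta>_def by (rule Max_ge) (use finL that in auto)
      have "\<eta> \<in> ?w ` ?L" unfolding \<eta>_def by (rule Max_in) (use finL xs0 in auto)
      then obtain xs where xs: "xs \<in> ?L" "\<eta> = ?w xs" by blast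
      have "\<delta> * \<rho> ^ D \<le> \<bar>g xs0 x\<bar> * \<rho> ^ length xs0"
        using xs0 pos \<rho> by (intro mult_mono power_decreasing) auto
      then have \<eta>_ge: "\<delta> * \<rho> ^ D \<le> \<eta>" using le_\<eta>[OF xs0(1)] by linarith
      have "0 < \<delta> * \<rho> ^ D" using pos \<rho> by simp
      with \<eta>_ge have \<eta>: "0 < \<eta>" by linarith
      have bound: "\<bar>g ys z\<bar> * \<rho> ^ length ys \<le> C * \<eta>"
        if "1 \<le> length ys" "length ys \<le> D + 1" "z \<in> max_ball x (3 * \<rho>)" for ys z
        unfolding C_def K_def
      proof (rule jet_scaled_bound[OF \<rho>(1) \<eta> jet3 _ C1 _ that])
        fix ys :: "'k list" and z assume z: "z \<in> max_ball x (3 * \<rho>)" "length ys = D + 1"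
        have "\<bar>g ys z\<bar> * \<rho> ^ (D + 1) \<le> C0 * \<rho> ^ D"
          using top[of z ys] z sub43 \<rho> pos by (intro mult_mono power_decreasing) auto
        also have "\<dots> = C0 / \<delta> * (\<delta> * \<rho> ^ D)" using pos by simp
        also have "\<dots> \<le> C1 * \<eta>"
          using \<eta>_ge pos \<rho> C1 by (intro mult_mono) (auto simp: C1_def)
        finally show "\<bar>g ys z\<bar> * \<rho> ^ (D + 1) \<le> C1 * \<eta>" .
      qed (use le_\<eta> in auto)
      let ?l = "length xs"
      have big: "\<gamma> * \<eta> \<le> \<bar>g xs z\<bar> * \<rho> ^ ?l" if z: "z \<in> pball t" for z
      proof -
        have zx: "infnorm (z - x) \<le> \<rho> / 2 ^ p"
          using z t(1) by (simp add: pball_def max_ball_def x_def)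
        have z3: "z \<in> max_ball x (3 * \<rho>)" using z t sub31 by blast
        have "\<bar>g xs z - g xs x\<bar> \<le> CARD('k) * (C * \<eta> / \<rho> ^ (?l + 1)) * infnorm (z - x)"
        proof (rule jet_lipschitz[OF jet3 convex_max_ball x z3])
          fix i y assume "y \<in> max_ball x (3 * \<rho>)"
          then show "\<bar>g (i # xs) y\<bar> \<le> C * \<eta> / \<rho> ^ (?l + 1)"
            using bound[of "i # xs" y] xs \<rho> by (simp add: pos_le_divide_eq)
        qed
        also have "\<dots> \<le> CARD('k) * (C * \<eta> / \<rho> ^ (?l + 1)) * (\<rho> * (1 / (2 * K * C)))"
        proof (rule mult_left_mono)
          have "\<rho> * (1 / 2 ^ p) \<le> \<rho> * (1 / (2 * K * C))" using p \<rho> by (intro mult_left_mono) auto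
          then show "infnorm (z - x) \<le> \<rho> * (1 / (2 * K * C))" using zx by simp
        qed (use C \<eta> \<rho> in simp)
        also have "\<dots> = \<eta> / 2 / \<rho> ^ ?l" using C K \<rho> by (simp add: K_def field_simps)
        finally have "\<bar>g xs x\<bar> - \<bar>g xs z\<bar> \<le> \<eta> / 2 / \<rho> ^ ?l" by linarith
        then have "(\<bar>g xs x\<bar> - \<bar>g xs z\<bar>) * \<rho> ^ ?l \<le> \<eta> / 2"
          using \<rho> by (simp add: pos_le_divide_eq)
        then have "\<eta> / 2 \<le> \<bar>g xs z\<bar> * \<rho> ^ ?l" using xs(2) by (simp add: left_diff_distrib)
        moreover have "\<gamma> * \<eta> \<le> 1 / 2 * \<eta>" using \<eta> by (intro mult_right_mono) (auto simp: \<gamma>_def)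
        ultimately show ?thesis by simp
      qed
      have F: "forces \<beta> (Nf ?l) (\<lambda>u. pball u \<subseteq> pball t \<and> (\<forall>z\<in>pball u. \<epsilon>f ?l * \<eta> \<le> \<bar>g [] z\<bar>)) t"
      proof (rule away[of ?l, THEN conjunct2, rule_format, OF refl \<eta> \<rho>(1)])
        show "jet (pball t) g" using jet_subset[OF jet3] t(2) sub31 by blast
        have "\<gamma> * \<rho> \<le> \<beta> ^ p * \<rho>" using \<rho> by (intro mult_right_mono) (auto simp: \<gamma>_def)
        then show "\<gamma> * \<rho> \<le> snd t" using t(4) by linarith
        show "snd t \<le> \<rho>" using pball_subset_radius[OF t(2)] t(3) by (simp add: \<rho>_def)
        show "\<bar>g ys z\<bar> * \<rho> ^ length ys \<le> C * \<eta>"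
          if "z \<in> pball t" "1 \<le> length ys" "length ys \<le> ?l + 1" for ys z
          by (rule bound) (use that xs t sub31 in auto)
      qed (rule big)
      have le: "Nf ?l \<le> N" unfolding N_def using xs(1) by (intro member_le_sum) auto
      have \<epsilon>_le: "\<epsilon>1 \<le> \<epsilon>f ?l" unfolding \<epsilon>1_def using xs(1) by (intro Min_le) auto
      show "forces \<beta> N ?P t"
      proof (rule forces_mono)
        show "forces \<beta> N (\<lambda>u. pball u \<subseteq> pball t \<and> (\<forall>z\<in>pball u. \<epsilon>f ?l * \<eta> \<le> \<bar>g [] z\<bar>)) t"
          by (rule forces_idle[OF F le pos(1) t(3)]) blast
        fix u :: "'k position"
        assume u: "pball u \<subseteq> pball t \<and> (\<forall>z\<in>pball u. \<epsilon>f ?l * \<eta> \<le> \<bar>g [] z\<bar>)"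
        show "?P u"
        proof (intro conjI ballI impI)
          show "pball u \<subseteq> pball s" using u t by blast
          fix z y assume z: "z \<in> pball u" and y: "y \<in> max_ball (fst s) (2 * snd s)" "g [] y = 0"
          have zy: "z \<in> max_ball x (3 * \<rho>)" "y \<in> max_ball x (3 * \<rho>)"
            using z y u t sub31 sub32 by (auto simp: \<rho>_def)
          have "\<bar>g [] z - g [] y\<bar> \<le> CARD('k) * (C * \<eta> / \<rho>) * infnorm (z - y)"
          proof (rule jet_lipschitz[OF jet3 convex_max_ball zy(2,1)])
            fix i v assume "v \<in> max_ball x (3 * \<rho>)"
            then show "\<bar>g [i] v\<bar> \<le> C * \<eta> / \<rho>"
              using bound[of "[i]" v] \<rho> by (simp add: pos_le_divide_eq)
          qed
          moreover have "\<epsilon>f ?l * \<eta> \<le> \<bar>g [] z\<bar>" using u z by blast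
          moreover have "\<epsilon>1 * \<eta> \<le> \<epsilon>f ?l * \<eta>" using \<epsilon>_le \<eta> by (intro mult_right_mono) auto
          ultimately have "\<epsilon>1 * \<eta> \<le> K * (C * \<eta> / \<rho>) * infnorm (z - y)" using y by (simp add: K_def)
          also have "\<dots> = (K * C * infnorm (z - y) / \<rho>) * \<eta>" by simp
          finally have "\<epsilon>1 \<le> K * C * infnorm (z - y) / \<rho>" using \<eta> by (rule mult_right_le_imp_le)
          then show "\<epsilon>1 / (K * C) * snd s \<le> infnorm (z - y)"
            using K C \<rho> by (simp add: \<rho>_def field_simps)
        qed
      qed
    qed
  qed
qed

section \<open>Determinants of nearby points\<close>

lemma det_sum_rows:
  fixes a :: "'n::finite \<Rightarrow> 's \<Rightarrow> real ^ 'n"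
  assumes "finite S"
  shows "det (\<chi> i. \<Sum>s\<in>S. a i s) = (\<Sum>f\<in>PiE UNIV (\<lambda>_. S). det (\<chi> i. a i (f i)))"
proof -
  have "det (\<chi> i. \<Sum>s\<in>S. a i s)
      = (\<Sum>p | p permutes (UNIV :: 'n set). of_int (sign p) * (\<Prod>i\<in>UNIV. \<Sum>s\<in>S. a i s $ p i))"
    by (simp add: det_def)
  also have "\<dots> = (\<Sum>p | p permutes (UNIV :: 'n set). \<Sum>f\<in>PiE UNIV (\<lambda>_. S).
                   of_int (sign p) * (\<Prod>i\<in>UNIV. a i (f i) $ p i))"
    by (subst prod_sum_PiE) (use assms in \<open>auto simp: sum_distrib_left\<close>)
  also have "\<dots> = (\<Sum>f\<in>PiE UNIV (\<lambda>_. S). det (\<chi> i. a i (f i)))"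
    by (subst sum.swap) (simp add: det_def)
  finally show ?thesis .
qed

lemma abs_det_le:
  fixes A :: "real ^ 'n ^ 'n::finite"
  assumes "\<And>i j. \<bar>A $ i $ j\<bar> \<le> C"
  shows "\<bar>det A\<bar> \<le> fact CARD('n) * C ^ CARD('n)"
proof -
  have "\<bar>det A\<bar> \<le> (\<Sum>p | p permutes (UNIV :: 'n set). C ^ CARD('n))"
    unfolding det_def
  proof (rule order_trans[OF sum_abs sum_mono])
    fix p assume "p \<in> {p. p permutes (UNIV :: 'n set)}"
    have "\<bar>of_int (sign p) * (\<Prod>i\<in>UNIV. A $ i $ p i)\<bar> = (\<Prod>i\<in>UNIV. \<bar>A $ i $ p i\<bar>)"
      by (simp add: abs_mult abs_prod sign_def)
    also have "\<dots> \<le> (\<Prod>i\<in>(UNIV :: 'n set). C)" by (rule prod_mono) (use assms in auto)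
    finally show "\<bar>of_int (sign p) * (\<Prod>i\<in>UNIV. A $ i $ p i)\<bar> \<le> C ^ CARD('n)" by simp
  qed
  also have "\<dots> = fact CARD('n) * C ^ CARD('n)"
    by (simp add: card_permutations)
  finally show ?thesis .
qed

text \<open>Multilinear expansion in the rows. A choice of terms contributes nothing if two rows pick the
  same \<open>v s\<close>. Otherwise its degree is \<open>(n + 1) * CARD('n)\<close> minus the
  savings \<open>n + 1 - deg s\<close> for the picked \<open>s\<close>, and no \<open>s\<close> is
  picked twice; the hypothesis on \<open>E\<close> says that this is at least \<open>E\<close>.\<close>

lemma det_weighted_expansion_bound:
  fixes v :: "'s \<Rightarrow> real ^ 'n::finite" and e :: "'n \<Rightarrow> real ^ 'n" and r C :: real
  assumes S: "finite S" and r: "0 < r" "r \<le> 1"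
    and t: "\<And>i s. s \<in> S \<Longrightarrow> \<bar>t i s\<bar> \<le> 1"
    and v: "\<And>s c. s \<in> S \<Longrightarrow> \<bar>v s $ c\<bar> \<le> C" and e: "\<And>i c. \<bar>e i $ c\<bar> \<le> C"
    and deg: "\<And>s. s \<in> S \<Longrightarrow> deg s \<le> n"
    and E: "E + (\<Sum>s\<in>S. n + 1 - deg s) \<le> (n + 1) * CARD('n)"
    and w: "\<And>i. w i = (\<Sum>s\<in>S. (r ^ deg s * t i s) *s v s) + r ^ (n + 1) *s e i"
  shows "\<bar>det (\<chi> i. w i)\<bar> \<le> (real (card S) + 1) ^ CARD('n) * (fact CARD('n) * C ^ CARD('n)) * r ^ E"
proof -
  \<comment> \<open>\<open>None\<close> stands for the remainder, which counts as a term of degree \<open>n + 1\<close>.\<close>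
  define T where "T = insert None (Some ` S)"
  define dg where "dg o' = (case o' of None \<Rightarrow> n + 1 | Some s \<Rightarrow> deg s)" for o'
  define c where "c i o' = (case o' of None \<Rightarrow> 1 | Some s \<Rightarrow> t i s)" for i o'
  define b where "b i o' = (case o' of None \<Rightarrow> e i | Some s \<Rightarrow> v s)" for i o'
  have T: "finite T" "card T = card S + 1" using S by (auto simp: T_def card_image)
  have "w i = (\<Sum>o'\<in>T. (r ^ dg o' * c i o') *s b i o')" for i
    unfolding T_def using S by (simp add: w sum.reindex dg_def c_def b_def add.commute)
  then have "det (\<chi> i. w i) = (\<Sum>f\<in>PiE UNIV (\<lambda>_. T). det (\<chi> i. (r ^ dg (f i) * c i (f i)) *s b i (f i)))"
    using det_sum_rows[OF T(1), of "\<lambda>i o'. (r ^ dg o' * c i o') *s b i o'"] by simp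
  also have "\<bar>\<dots>\<bar> \<le> (\<Sum>f\<in>PiE (UNIV :: 'n set) (\<lambda>_. T). fact CARD('n) * C ^ CARD('n) * r ^ E)"
  proof (rule order_trans[OF sum_abs sum_mono])
    fix f :: "'n \<Rightarrow> 's option" assume "f \<in> PiE UNIV (\<lambda>_. T)"
    then have f: "f i \<in> T" for i by auto
    let ?D = "det (\<chi> i. (r ^ dg (f i) * c i (f i)) *s b i (f i))"
    have D: "?D = (\<Prod>i\<in>UNIV. r ^ dg (f i) * c i (f i)) * det (\<chi> i. b i (f i))"
      by (rule det_rows_mul)
    have C0: "0 \<le> C" using e[of undefined undefined] by linarith
    show "\<bar>?D\<bar> \<le> fact CARD('n) * C ^ CARD('n) * r ^ E"
    proof (cases "inj_on f {i. f i \<noteq> None}")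
      case False
      then obtain i j where ij: "i \<noteq> j" "f i = f j" "f i \<noteq> None" by (auto simp: inj_on_def)
      \<comment> \<open>Two rows are multiples of the same vector.\<close>
      then have "row i (\<chi> i. b i (f i)) = row j (\<chi> i. b i (f i))"
        by (auto simp: row_def b_def vec_eq_iff)
      then have "det (\<chi> i. b i (f i)) = 0" using det_identical_rows[OF ij(1)] by blast
      then show ?thesis unfolding D using C0 r by simp
    next
      case True
      have E_le: "E \<le> (\<Sum>i\<in>UNIV. dg (f i))"
      proof -
        let ?I = "{i. f i \<noteq> None}"
        have dgn: "dg (f i) \<le> n + 1" for i
          using f[of i] deg by (auto simp: T_def dg_def intro: le_SucI)
        have "(\<Sum>i\<in>UNIV. n + 1 - dg (f i)) = (\<Sum>i\<in>?I. n + 1 - dg (f i))"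
          by (rule sum.mono_neutral_right) (auto simp: dg_def)
        also have "\<dots> = (\<Sum>o'\<in>f ` ?I. n + 1 - dg o')"
          using True by (simp add: sum.reindex)
        also have "\<dots> \<le> (\<Sum>o'\<in>Some ` S. n + 1 - dg o')"
        proof (rule sum_mono2)
          show "f ` ?I \<subseteq> Some ` S"
          proof
            fix o' assume "o' \<in> f ` ?I"
            then obtain i where "o' = f i" "f i \<noteq> None" by blast
            then show "o' \<in> Some ` S" using f[of i] by (auto simp: T_def)
          qed
        qed (use S in auto)
        also have "\<dots> = (\<Sum>s\<in>S. n + 1 - deg s)" by (simp add: sum.reindex dg_def)
        finally have 1: "(\<Sum>i\<in>UNIV. n + 1 - dg (f i)) \<le> (\<Sum>s\<in>S. n + 1 - deg s)" .
        have "(\<Sum>i\<in>UNIV. dg (f i)) + (\<Sum>i\<in>UNIV. n + 1 - dg (f i)) = (\<Sum>i\<in>(UNIV :: 'n set). n + 1)"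
          unfolding sum.distrib[symmetric] using dgn by (intro sum.cong) auto
        also have "\<dots> = (n + 1) * CARD('n)" by simp
        finally show ?thesis using 1 E by linarith
      qed
      have c1: "\<bar>c i (f i)\<bar> \<le> 1" for i using f[of i] t by (auto simp: T_def c_def)
      have "\<bar>\<Prod>i\<in>UNIV. r ^ dg (f i) * c i (f i)\<bar> = (\<Prod>i\<in>UNIV. r ^ dg (f i) * \<bar>c i (f i)\<bar>)"
        using r by (simp add: abs_prod abs_mult)
      also have "\<dots> \<le> (\<Prod>i\<in>UNIV. r ^ dg (f i))"
        using r c1 by (intro prod_mono) (auto simp: mult_left_le)
      also have "\<dots> = r ^ (\<Sum>i\<in>UNIV. dg (f i))" by (simp add: power_sum)
      also have "\<dots> \<le> r ^ E" using r E_le by (intro power_decreasing) auto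
      finally have 1: "\<bar>\<Prod>i\<in>UNIV. r ^ dg (f i) * c i (f i)\<bar> \<le> r ^ E" .
      have "\<bar>det (\<chi> i. b i (f i))\<bar> \<le> fact CARD('n) * C ^ CARD('n)"
      proof (rule abs_det_le)
        fix i j show "\<bar>(\<chi> i. b i (f i)) $ i $ j\<bar> \<le> C" using f[of i] v e by (auto simp: T_def b_def)
      qed
      with 1 show ?thesis unfolding D abs_mult
        using C0 r by (subst mult.commute, intro mult_mono) auto
    qed
  qed
  also have "\<dots> = (real (card S) + 1) ^ CARD('n) * (fact CARD('n) * C ^ CARD('n)) * r ^ E"
    using T by (simp add: card_PiE add.commute)
  finally show ?thesis .
qed

lemma finite_multisets_size: "finite {\<alpha> :: 'k::finite multiset. size \<alpha> = j}"
proof -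
  have "{\<alpha> :: 'k multiset. size \<alpha> = j} \<subseteq> mset ` {xs. length xs = j}"
    by (auto simp: image_iff) (metis ex_mset size_mset)
  then show ?thesis using finite_lists_length finite_surj by blast
qed

text \<open>A multiset is determined by its list of multiplicities, so this is the count of lists of
  naturals with given length and sum.\<close>

lemma card_multisets_size_le: "card {\<alpha> :: 'k::finite multiset. size \<alpha> = j} \<le> bin (CARD('k) - 1) j"
proof -
  obtain ks :: "'k list" where ks: "set ks = UNIV" "distinct ks"
    using finite_distinct_list[of "UNIV :: 'k set"] by auto
  have len: "length ks = CARD('k)" using distinct_card[OF ks(2)] ks(1) by simp
  let ?f = "\<lambda>\<alpha> :: 'k multiset. map (count \<alpha>) ks"
  let ?T = "{l :: nat list. length l = CARD('k) \<and> sum_list l = j}"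
  have inj: "inj_on ?f {\<alpha>. size \<alpha> = j}"
    using ks(1) by (auto simp: inj_on_def multiset_eq_iff)
  have sum: "sum_list (?f \<alpha>) = size \<alpha>" for \<alpha>
  proof -
    have "sum_list (?f \<alpha>) = (\<Sum>i\<in>UNIV. count \<alpha> i)"
      using ks by (simp add: sum_list_distinct_conv_sum_set)
    also have "\<dots> = (\<Sum>i\<in>set_mset \<alpha>. count \<alpha> i)"
      by (rule sum.mono_neutral_right) (auto simp: not_in_iff)
    finally show ?thesis by (simp add: size_multiset_overloaded_eq)
  qed
  have fin: "finite ?T"
  proof (rule finite_subset)
    show "?T \<subseteq> {l. set l \<subseteq> {..j} \<and> length l = CARD('k)}"
      by (auto simp: member_le_sum_list)
  qed (simp add: finite_lists_length_eq)
  have "card {\<alpha> :: 'k multiset. size \<alpha> = j} \<le> card ?T"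
    by (rule card_inj_on_le[OF inj _ fin]) (use sum len in auto)
  also have "\<dots> = (j + CARD('k) - 1) choose j" by (rule card_length_sum_list)
  finally show ?thesis by (simp add: bin_def add.commute)
qed

lemma monom_list_mset: "monom_list u xs = prod_mset (image_mset (($) u) (mset xs))"
  unfolding monom_list_def by (metis mset_map prod_mset_prod_list)

text \<open>Grouping the lists in Taylor's formula by their multisets turns it into a sum over monomials, of
  which there are few enough for \<open>det_weighted_expansion_bound\<close> to give the exponent
  \<open>N_kd\<close> of the theorem; the lists are too many for that.\<close>

lemma jet_det_bound:
  fixes C0 :: real and n E :: nat
  assumes E: "E + (\<Sum>\<alpha> | size (\<alpha> :: 'k::finite multiset) \<le> n. n + 1 - size \<alpha>) \<le> (n + 1) * CARD('n::finite)"
    and C0: "0 < C0"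
  obtains C where "0 < C" and
    "\<And>(G :: 'n \<Rightarrow> 'k list \<Rightarrow> real ^ 'k \<Rightarrow> real) x r (y :: 'n \<Rightarrow> real ^ 'k).
       \<lbrakk>0 < r; r \<le> 1; \<And>c. jet (max_ball x r) (G c);
        \<And>c xs z. length xs \<le> n + 1 \<Longrightarrow> z \<in> max_ball x r \<Longrightarrow> \<bar>G c xs z\<bar> \<le> C0;
        \<And>i. y i \<in> max_ball x r\<rbrakk>
       \<Longrightarrow> \<bar>det (\<chi> i c. G c [] (y i) :: real ^ 'n ^ 'n)\<bar> \<le> C * r ^ E"
proof -
  define S where "S = {\<alpha> :: 'k multiset. size \<alpha> \<le> n}"
  define L where "L = {xs :: 'k list. length xs \<le> n}"
  have "S = (\<Union>j\<le>n. {\<alpha>. size \<alpha> = j})" by (auto simp: S_def)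
  then have finS: "finite S" using finite_multisets_size by auto
  have finL: "finite L" unfolding L_def by (rule finite_lists_le)
  have L_eq: "L = (\<Union>p\<in>{..<n + 1}. {xs. length xs = p})" by (auto simp: L_def)
  define C where "C = (real (card L) + real CARD('k) ^ (n + 1)) * C0"
  have C_pos: "0 < C" unfolding C_def using C0 by (intro mult_pos_pos add_nonneg_pos) auto
  let ?C = "(real (card S) + 1) ^ CARD('n) * (fact CARD('n) * C ^ CARD('n))"
  show thesis
  proof (rule that[of ?C])
    show "0 < ?C" using C_pos by (intro mult_pos_pos zero_less_power) auto
    fix G :: "'n \<Rightarrow> 'k list \<Rightarrow> real ^ 'k \<Rightarrow> real" and x r and y :: "'n \<Rightarrow> real ^ 'k"
    assume r: "0 < r" "r \<le> 1" and jet: "\<And>c. jet (max_ball x r) (G c)"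
      and bd: "\<And>c xs z. length xs \<le> n + 1 \<Longrightarrow> z \<in> max_ball x r \<Longrightarrow> \<bar>G c xs z\<bar> \<le> C0"
      and y: "\<And>i. y i \<in> max_ball x r"
    define u where "u i = y i - x" for i
    have u: "infnorm (u i) \<le> r" for i using y[of i] by (simp add: max_ball_def u_def)
    have x: "x \<in> max_ball x r" using r by (simp add: max_ball_def infnorm_0)
    define mon where "mon v \<alpha> = prod_mset (image_mset (($) v) \<alpha>)" for v :: "real ^ 'k" and \<alpha>
    have mon: "\<bar>mon (u i) \<alpha>\<bar> \<le> r ^ size \<alpha>" for i \<alpha>
      using monom_list_bound[OF u] monom_list_mset by (metis ex_mset mon_def size_mset)
    define v where "v \<alpha> = (\<chi> c. \<Sum>xs | xs \<in> L \<and> mset xs = \<alpha>. G c xs x / fact (length xs))" for \<alpha>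
    define T where "T i c = (\<Sum>p<n + 1. (\<Sum>xs | length xs = p. monom_list (u i) xs * G c xs x) / fact p)" for i c
    have T: "T i c = (\<Sum>\<alpha>\<in>S. mon (u i) \<alpha> * v \<alpha> $ c)" for i c
    proof -
      have "T i c = (\<Sum>p<n + 1. \<Sum>xs | length xs = p. monom_list (u i) xs * G c xs x / fact (length xs))"
        unfolding T_def by (simp add: sum_divide_distrib)
      also have "\<dots> = (\<Sum>xs\<in>L. monom_list (u i) xs * G c xs x / fact (length xs))"
        unfolding L_eq by (rule sum.UNION_disjoint[symmetric]) (auto simp: finite_lists_length)
      also have "\<dots> = (\<Sum>\<alpha>\<in>S. \<Sum>xs | xs \<in> L \<and> mset xs = \<alpha>. monom_list (u i) xs * G c xs x / fact (length xs))"
        by (rule sum.group[symmetric]) (use finL finS in \<open>auto simp: L_def S_def\<close>)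
      also have "\<dots> = (\<Sum>\<alpha>\<in>S. mon (u i) \<alpha> * v \<alpha> $ c)"
        unfolding v_def by (auto simp: sum_distrib_left mon_def monom_list_mset intro!: sum.cong)
      finally show ?thesis .
    qed
    define e where "e i = (\<chi> c. (G c [] (y i) - T i c) / r ^ (n + 1))" for i
    have "\<bar>det (\<chi> i. \<chi> c. G c [] (y i))\<bar> \<le> ?C * r ^ E"
    proof (rule det_weighted_expansion_bound[where t = "\<lambda>i \<alpha>. mon (u i) \<alpha> / r ^ size \<alpha>" and v = v
          and e = e and deg = size and n = n, OF finS r])
      show "\<bar>mon (u i) \<alpha> / r ^ size \<alpha>\<bar> \<le> 1" for i \<alpha>
        using mon[of i \<alpha>] r by (simp add: abs_divide)
      show "\<bar>v \<alpha> $ c\<bar> \<le> C" for \<alpha> c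
      proof -
        have "\<bar>v \<alpha> $ c\<bar> \<le> (\<Sum>xs | xs \<in> L \<and> mset xs = \<alpha>. \<bar>G c xs x / fact (length xs)\<bar>)"
          unfolding v_def vec_lambda_beta by (rule sum_abs)
        also have "\<dots> \<le> (\<Sum>xs\<in>L. \<bar>G c xs x / fact (length xs)\<bar>)"
          by (rule sum_mono2) (use finL in auto)
        also have "\<dots> \<le> (\<Sum>xs\<in>L. C0)"
        proof (rule sum_mono)
          fix xs assume "xs \<in> L"
          then have "\<bar>G c xs x\<bar> \<le> C0" using x by (intro bd) (auto simp: L_def)
          moreover have "\<bar>G c xs x / fact (length xs)\<bar> \<le> \<bar>G c xs x\<bar>"
            using divide_left_mono[of 1 "fact (length xs)" "\<bar>G c xs x\<bar>"] by simp
          ultimately show "\<bar>G c xs x / fact (length xs)\<bar> \<le> C0" by linarith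
        qed
        also have "\<dots> \<le> C" using C0 by (simp add: C_def)
        finally show ?thesis .
      qed
      show "\<bar>e i $ c\<bar> \<le> C" for i c
      proof -
        have "\<bar>G c [] (x + u i) - T i c\<bar> \<le> (CARD('k) * r) ^ (n + 1) * C0"
          unfolding T_def
          by (rule jet_taylor[OF jet convex_max_ball x _ u]) (use y bd in \<open>auto simp: u_def\<close>)
        then have "\<bar>e i $ c\<bar> \<le> real CARD('k) ^ (n + 1) * C0"
          using r by (simp add: e_def abs_divide u_def pos_divide_le_eq power_mult_distrib ac_simps)
        also have "\<dots> \<le> C" unfolding C_def using C0 by (intro mult_right_mono) auto
        finally show ?thesis .
      qed
      show "E + (\<Sum>\<alpha>\<in>S. n + 1 - size \<alpha>) \<le> (n + 1) * CARD('n)" using E by (simp add: S_def)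
      show "(\<chi> c. G c [] (y i)) = (\<Sum>\<alpha>\<in>S. (r ^ size \<alpha> * (mon (u i) \<alpha> / r ^ size \<alpha>)) *s v \<alpha>) + r ^ (n + 1) *s e i" for i
        using r by (simp add: vec_eq_iff e_def T)
    qed (auto simp: S_def)
    then show "\<bar>det (\<chi> i c. G c [] (y i))\<bar> \<le> ?C * r ^ E" .
  qed
qed

section \<open>The exponent\<close>

lemma n_kd_decomposition:
  assumes "1 \<le> k" "k \<le> d"
  shows "1 \<le> n_kd k d" "d = (\<Sum>j=1..n_kd k d. bin (k - 1) j) + m_kd k d"
proof -
  let ?P = "\<lambda>n. 1 \<le> n \<and> (\<exists>m. d = (\<Sum>j=1..n. bin (k - 1) j) + m)"
  have "(\<Sum>j=1..1. bin (k - 1) j) = k" using assms by (simp add: bin_def)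
  then have P1: "?P 1" using assms(2) le_Suc_ex by force
  have bd: "n \<le> d" if "?P n" for n
  proof -
    have "(\<Sum>j=1..n. 1) \<le> (\<Sum>j=1..n. bin (k - 1) j)"
      by (rule sum_mono) (simp add: bin_def Suc_le_eq)
    then show ?thesis using that by auto
  qed
  have P: "?P (n_kd k d)" unfolding n_kd_def by (rule GreatestI_nat[of ?P 1 d, OF P1]) (rule bd)
  then show "1 \<le> n_kd k d" by blast
  from P have "\<exists>!m. d = (\<Sum>j=1..n_kd k d. bin (k - 1) j) + m" by auto
  then show "d = (\<Sum>j=1..n_kd k d. bin (k - 1) j) + m_kd k d" unfolding m_kd_def by (rule theI')
qed

lemma N_kd_pos:
  assumes "1 \<le> k" "k \<le> d"
  shows "1 \<le> N_kd k d"
proof -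
  have n: "1 \<le> n_kd k d" using n_kd_decomposition[OF assms] by blast
  have "1 * bin (k - 1) 1 \<le> (\<Sum>j=1..n_kd k d. j * bin (k - 1) j)"
    using n by (intro member_le_sum) auto
  moreover have "1 \<le> bin (k - 1) 1" by (simp add: bin_def Suc_le_eq)
  ultimately show ?thesis by (simp add: N_kd_def)
qed

text \<open>\<open>N_kd\<close> is the total degree when all monomials of degree at most \<open>n\<close>
  are used once, including the constant one, and the other \<open>m_kd\<close> of the \<open>d +
  1\<close> rows have degree \<open>n + 1\<close>. Written as the maximal degree minus savings,
  this is the form that the determinant estimate needs.\<close>

lemma N_kd_weight_bound:
  assumes "CARD('k::finite) \<le> d"
  defines "n \<equiv> n_kd CARD('k) d"
  shows "N_kd CARD('k) d + (\<Sum>\<alpha> | size (\<alpha> :: 'k multiset) \<le> n. n + 1 - size \<alpha>) \<le> (n + 1) * (d + 1)"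
proof -
  define b where "b = bin (CARD('k) - 1)"
  define m where "m = m_kd CARD('k) d"
  have k: "1 \<le> CARD('k)" by (simp add: Suc_le_eq)
  have d: "d = (\<Sum>j=1..n. b j) + m" using n_kd_decomposition[OF k assms(1)] by (simp add: b_def m_def n_def)
  have un: "{\<alpha> :: 'k multiset. size \<alpha> \<le> n} = (\<Union>j\<in>{0..n}. {\<alpha>. size \<alpha> = j})" by auto
  have "(\<Sum>\<alpha> | size (\<alpha> :: 'k multiset) \<le> n. n + 1 - size \<alpha>)
      = (\<Sum>j=0..n. \<Sum>\<alpha> | size (\<alpha> :: 'k multiset) = j. n + 1 - size \<alpha>)"
    unfolding un by (rule sum.UNION_disjoint) (auto simp: finite_multisets_size)
  also have "\<dots> \<le> (\<Sum>j=0..n. (n + 1 - j) * b j)"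
    by (rule sum_mono) (use card_multisets_size_le in \<open>simp add: b_def mult.commute\<close>)
  also have "\<dots> = (n + 1) + (\<Sum>j=1..n. (n + 1 - j) * b j)"
    by (simp add: sum.atLeast_Suc_atMost b_def bin_def)
  finally have "N_kd CARD('k) d + (\<Sum>\<alpha> | size (\<alpha> :: 'k multiset) \<le> n. n + 1 - size \<alpha>)
      \<le> (\<Sum>j=1..n. j * b j) + (n + 1) * m + ((n + 1) + (\<Sum>j=1..n. (n + 1 - j) * b j))"
    by (simp add: N_kd_def n_def b_def m_def)
  also have "\<dots> = (\<Sum>j=1..n. j * b j + (n + 1 - j) * b j) + (n + 1) * m + (n + 1)"
    by (simp add: sum.distrib)
  also have "(\<Sum>j=1..n. j * b j + (n + 1 - j) * b j) = (\<Sum>j=1..n. (n + 1) * b j)"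
    by (rule sum.cong) (auto simp flip: distrib_right)
  also have "\<dots> = (n + 1) * (\<Sum>j=1..n. b j)" by (simp only: sum_distrib_left)
  also have "(n + 1) * (\<Sum>j=1..n. b j) + (n + 1) * m + (n + 1) = (n + 1) * (d + 1)"
    unfolding d by (simp only: distrib_left mult_1_right add.assoc)
  finally show ?thesis .
qed

text \<open>Turns the failure of the smallness condition for the height \<open>h\<close> at the scale
  \<open>x\<close> into a lower bound for \<open>x\<close> by a power of \<open>h\<close>; with
  \<open>p = d + 1\<close> and \<open>E = N_kd k d\<close> the exponent is \<open>- c_kd k
  d\<close>.\<close>

lemma powr_lower_bound:
  fixes A h x :: real
  assumes "0 < A" "0 < h" "0 < x" "1 \<le> E" "1 \<le> h ^ p * (A * x ^ E)"
  shows "A powr (- (1 / E)) * h powr (- (real p / E)) \<le> x"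
proof -
  have pos: "0 < A * h ^ p" using assms by simp
  have "1 / (A * h ^ p) \<le> x ^ E" using assms by (simp add: pos_divide_le_eq ac_simps)
  then have "(1 / (A * h ^ p)) powr (1 / E) \<le> (x ^ E) powr (1 / E)"
    using pos by (intro powr_mono2) auto
  also have "(x ^ E) powr (1 / E) = x"
    using assms by (simp add: powr_realpow[symmetric] powr_powr)
  also have "(1 / (A * h ^ p)) powr (1 / E) = (A * h ^ p) powr (- (1 / E))"
    using pos by (simp only: powr_divide powr_minus_divide) simp
  also have "\<dots> = A powr (- (1 / E)) * (h powr real p) powr (- (1 / E))"
    using assms by (simp add: powr_mult powr_realpow)
  also have "(h powr real p) powr (- (1 / E)) = h powr (- (real p / E))" by (simp add: powr_powr)
  finally show ?thesis .
qed

section \<open>Rational points of small height\<close>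

definition reduced_representation :: "real ^ 'd::finite \<Rightarrow> nat \<Rightarrow> int ^ 'd \<Rightarrow> bool" where
  "reduced_representation r q p \<longleftrightarrow> 0 < q \<and>
     Gcd (insert (int q) (range (\<lambda>i. p $ i))) = 1 \<and> r = (\<chi> i. of_int (p $ i) / of_nat q)"

text \<open>From \<open>q * p' = q' * p\<close>, the number \<open>q\<close> divides \<open>q'\<close> times
  each of \<open>q\<close> and the coordinates of \<open>p\<close>, hence \<open>q'\<close> times
  their greatest common divisor, which is \<open>1\<close>.\<close>

lemma reduced_denominator_dvd:
  fixes r :: "real ^ 'd::finite"
  assumes red: "reduced_representation r q p" and q': "0 < q'" "r = (\<chi> i. of_int (p' $ i) / of_nat q')"
  shows "q dvd q'"
proof -
  let ?A = "insert (int q) (range (\<lambda>i. p $ i))"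
  have q: "0 < q" and g: "Gcd ?A = 1" and r: "r = (\<chi> i. of_int (p $ i) / of_nat q)"
    using red by (auto simp: reduced_representation_def)
  have eq: "int q * p' $ i = int q' * p $ i" for i
  proof -
    have "real_of_int (p $ i) / q = real_of_int (p' $ i) / q'"
      using r q'(2) by (metis vec_lambda_beta)
    then have "real_of_int (int q * p' $ i) = real_of_int (int q' * p $ i)"
      using q q'(1) by (simp add: field_simps)
    then show ?thesis by (simp only: of_int_eq_iff)
  qed
  have "int q dvd Gcd ((*) (int q') ` ?A)"
  proof (rule Gcd_greatest)
    fix b assume "b \<in> (*) (int q') ` ?A"
    then consider "b = int q' * int q" | i where "b = int q' * p $ i" by auto
    then show "int q dvd b" by cases (auto simp flip: eq)
  qed
  also have "Gcd ((*) (int q') ` ?A) = int q'" unfolding Gcd_mult g by simp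
  finally show ?thesis by simp
qed

lemma rational_point_common_denominator:
  fixes r :: "real ^ 'd::finite"
  assumes "rational_point r"
  shows "\<exists>q p. 0 < q \<and> r = (\<chi> i. of_int (p $ i) / of_nat q)"
proof -
  have "\<exists>a b. 0 < b \<and> r $ i = of_int a / of_nat b" for i
  proof -
    have "r $ i \<in> \<rat>" using assms by (simp add: rational_point_def)
    then obtain a b where "b \<noteq> 0" "r $ i = real_of_int a / real b"
      by (auto simp: Rats_eq_int_div_nat)
    then show ?thesis by (intro exI[of _ a] exI[of _ b]) auto
  qed
  then obtain a b where ab: "\<And>i. 0 < b i" "\<And>i. r $ i = of_int (a i) / of_nat (b i)" by metis
  define q where "q = (\<Prod>i\<in>UNIV. b i)"
  define p where "p = (\<chi> i. a i * int (\<Prod>j\<in>UNIV - {i}. b j))"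
  have "0 < q" using ab(1) by (simp add: q_def prod_pos)
  moreover have "r $ i = of_int (p $ i) / of_nat q" for i
  proof -
    have q: "q = b i * (\<Prod>j\<in>UNIV - {i}. b j)" unfolding q_def by (rule prod.remove) auto
    have "0 < (\<Prod>j\<in>UNIV - {i}. b j)" using ab(1) by (simp add: prod_pos)
    then show ?thesis unfolding q p_def using ab(1)[of i] by (simp add: ab(2))
  qed
  then have "r = (\<chi> i. of_int (p $ i) / of_nat q)" by (simp add: vec_eq_iff)
  ultimately show ?thesis by blast
qed

lemma ex_reduced_representation:
  fixes r :: "real ^ 'd::finite"
  assumes "rational_point r"
  shows "\<exists>q p. reduced_representation r q p"
proof -
  let ?P = "\<lambda>q. \<exists>p. 0 < q \<and> r = (\<chi> i. of_int (p $ i) / of_nat q)"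
  \<comment> \<open>The least common denominator is reduced: a common factor could be cancelled.\<close>
  define q where "q = (LEAST q. ?P q)"
  have "?P q" unfolding q_def by (rule LeastI_ex) (rule rational_point_common_denominator[OF assms])
  then obtain p where q: "0 < q" and p: "r = (\<chi> i. of_int (p $ i) / of_nat q)" by blast
  define g where "g = Gcd (insert (int q) (range (\<lambda>i. p $ i)))"
  have g0: "0 \<le> g" by (simp add: g_def)
  have gdvd: "g dvd int q" "g dvd p $ i" for i unfolding g_def by (rule Gcd_dvd, simp)+
  then have "g \<noteq> 0" using q by auto
  with g0 have gp: "0 < g" by simp
  obtain n where g: "g = int n" using g0 nonneg_int_cases by blast
  have n: "0 < n" using gp g by simp
  obtain q' where q': "q = n * q'" using gdvd(1) unfolding g by auto
  have "\<forall>i. \<exists>c. p $ i = int n * c" using gdvd(2) unfolding g by (auto simp: dvd_def)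
  then obtain c where c: "\<And>i. p $ i = int n * c i" by metis
  have "?P q'"
  proof (intro exI conjI)
    show "0 < q'" using q q' by (cases q') auto
    show "r = (\<chi> i. of_int ((\<chi> i. c i) $ i) / of_nat q')"
      unfolding p using n by (simp add: vec_eq_iff c q')
  qed
  then have "q \<le> q'" unfolding q_def by (rule Least_le)
  moreover have "0 < q'" using q q' by (cases q') auto
  ultimately have "n = 1" using q' n by (cases n) auto
  then have "Gcd (insert (int q) (range (\<lambda>i. p $ i))) = 1" using g unfolding g_def by simp
  then have "reduced_representation r q p" using q p unfolding reduced_representation_def by blast
  then show ?thesis by blast
qed

text \<open>The reduced denominator exists and is unique, since two of them divide each other; so the
  definite description in \<open>height\<close> denotes.\<close>

lemma height_spec:
  fixes r :: "real ^ 'd::finite"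
  assumes "rational_point r"
  obtains p :: "int ^ 'd" where "0 < height r" "r = (\<chi> i. of_int (p $ i) / of_nat (height r))"
proof -
  obtain q p where qp: "reduced_representation r q p" using ex_reduced_representation[OF assms] by blast
  have "\<exists>!q. \<exists>p. reduced_representation r q p"
  proof (rule ex1I[of _ q])
    fix q' assume "\<exists>p. reduced_representation r q' p"
    then obtain p' where qp': "reduced_representation r q' p'" by blast
    show "q' = q"
    proof (rule dvd_antisym)
      show "q' dvd q" using reduced_denominator_dvd[OF qp'] qp unfolding reduced_representation_def by blast
      show "q dvd q'" using reduced_denominator_dvd[OF qp] qp' unfolding reduced_representation_def by blast
    qed
  qed (use qp in blast)
  from theI'[OF this] have "\<exists>p. reduced_representation r (height r) p"
    by (simp add: height_def reduced_representation_def)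
  then show thesis using that unfolding reduced_representation_def by blast
qed

definition homogenized :: "real ^ 'd::finite \<Rightarrow> real ^ ('d option)" where
  "homogenized z = (\<chi> c. case c of None \<Rightarrow> 1 | Some j \<Rightarrow> z $ j)"

text \<open>Multiplying the rows by the heights makes the determinant an integer, of absolute value less
  than \<open>1\<close>.\<close>

lemma rational_det_eq_0:
  fixes r :: "'d::finite option \<Rightarrow> real ^ 'd"
  assumes rat: "\<And>i. rational_point (r i)"
    and small: "\<And>i. \<bar>det (\<chi> i. homogenized (r i))\<bar> * real (height (r i)) ^ (CARD('d) + 1) < 1"
  shows "det (\<chi> i. homogenized (r i)) = 0"
proof -
  let ?D = "det (\<chi> i. homogenized (r i))"
  let ?h = "\<lambda>i. real (height (r i))"
  have h: "0 < ?h i" for i using height_spec[OF rat] by (metis of_nat_0_less_iff)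
  have int: "?h i * homogenized (r i) $ c \<in> \<int>" for i c
  proof (cases c)
    case None
    then show ?thesis by (simp add: homogenized_def)
  next
    case (Some j)
    obtain p :: "int ^ 'd" where "r i = (\<chi> j. of_int (p $ j) / of_nat (height (r i)))"
      by (rule height_spec[OF rat])
    then have "r i $ j = of_int (p $ j) / ?h i" by (metis vec_lambda_beta)
    then have "?h i * r i $ j = of_int (p $ j)" using h[of i] by simp
    then show ?thesis using Some by (simp add: homogenized_def)
  qed
  have "det (\<chi> i. ?h i *s homogenized (r i)) \<in> \<int>"
    unfolding det_def by (intro Ints_sum Ints_mult Ints_prod Ints_of_int) (simp add: int)
  then have I: "(\<Prod>i\<in>UNIV. ?h i) * ?D \<in> \<int>" unfolding det_rows_mul .
  obtain i0 where i0: "\<And>i. ?h i \<le> ?h i0"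
  proof -
    have fin: "finite (range ?h)" by simp
    have "Max (range ?h) \<in> range ?h" by (rule Max_in) auto
    then obtain i0 where "Max (range ?h) = ?h i0" by blast
    then have "?h i \<le> ?h i0" for i using Max_ge[OF fin, of "?h i"] by simp
    then show thesis using that by blast
  qed
  have "(\<Prod>i\<in>(UNIV :: 'd option set). ?h i) \<le> (\<Prod>i\<in>(UNIV :: 'd option set). ?h i0)"
    by (rule prod_mono) (use i0 h less_imp_le in auto)
  also have "\<dots> = ?h i0 ^ (CARD('d) + 1)" by (simp add: card_UNIV_option)
  finally have "(\<Prod>i\<in>UNIV. ?h i) * \<bar>?D\<bar> \<le> ?h i0 ^ (CARD('d) + 1) * \<bar>?D\<bar>" by (rule mult_right_mono) simp
  also have "\<dots> < 1" using small[of i0] by (simp add: mult.commute)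
  finally have "\<bar>(\<Prod>i\<in>UNIV. ?h i) * ?D\<bar> < 1" using h by (simp add: abs_mult abs_prod)
  with I have "(\<Prod>i\<in>UNIV. ?h i) * ?D = 0" by (metis Ints_nonzero_abs_less1)
  moreover have "(\<Prod>i\<in>UNIV. ?h i) \<noteq> 0" using h by (simp add: less_imp_neq[symmetric] flip: of_nat_prod)
  ultimately show ?thesis by simp
qed

text \<open>If the homogenized points spanned the whole space, a basis chosen among them would be the rows
  of a matrix with nonzero determinant. A vector orthogonal to their span gives the equation; its
  linear part is nonzero unless there are no points at all.\<close>

lemma common_affine_hyperplane:
  fixes Z :: "(real ^ 'd::finite) set"
  assumes det0: "\<And>r :: 'd option \<Rightarrow> real ^ 'd. (\<And>i. r i \<in> Z) \<Longrightarrow> det (\<chi> i. homogenized (r i)) = 0"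
  obtains a :: "real ^ 'd" and b where "norm a = 1" "\<And>z. z \<in> Z \<Longrightarrow> a \<bullet> z = b"
proof -
  have ne: "span (homogenized ` Z) \<noteq> UNIV"
  proof
    assume full: "span (homogenized ` Z) = UNIV"
    obtain B where B: "B \<subseteq> homogenized ` Z" "independent B" "homogenized ` Z \<subseteq> span B"
        "card B = dim (homogenized ` Z)"
      by (rule basis_exists)
    have spB: "span B = UNIV" using B(3) full by (metis span_mono span_span top.extremum_uniqueI)
    have finB: "finite B" using B(2) independent_imp_finite by blast
    have "card B = CARD('d option)"
      using B(4) full by (metis dim_span dim_UNIV DIM_cart DIM_real mult.right_neutral)
    then obtain f where f: "bij_betw f (UNIV :: 'd option set) B"
      using finB finite_same_card_bij[of "UNIV :: 'd option set" B] by auto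
    have "\<forall>i. \<exists>z\<in>Z. f i = homogenized z" using f B(1) by (auto simp: bij_betw_def)
    then obtain r where r: "\<And>i. r i \<in> Z" "\<And>i. f i = homogenized (r i)" by metis
    let ?A = "\<chi> i. homogenized (r i)"
    have "rows ?A = B"
      using f r(2) by (auto simp: rows_def row_def bij_betw_def image_iff vec_nth_inverse)
    then have "\<exists>C. C ** ?A = mat 1" using spB by (simp add: matrix_left_invertible_span_rows)
    then have "det ?A \<noteq> 0" by (metis invertible_det_nz invertible_left_inverse)
    then show False using det0[of r] r(1) by blast
  qed
  obtain w where w: "w \<noteq> 0" "span (homogenized ` Z) \<subseteq> {x. w \<bullet> x = 0}"
    using span_not_univ_subset_hyperplane[OF ne] by blast
  define a where "a = (\<chi> j. w $ Some j)"
  have wz: "a \<bullet> z = - (w $ None)" if "z \<in> Z" for z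
  proof -
    have "w \<bullet> homogenized z = 0" using w(2) that span_base by blast
    moreover have "w \<bullet> homogenized z = w $ None + a \<bullet> z"
      unfolding inner_vec_def a_def homogenized_def UNIV_option_conv
      by (simp add: sum.reindex)
    ultimately show ?thesis by simp
  qed
  show thesis
  proof (cases "a = 0")
    case True
    have "w $ None \<noteq> 0"
    proof
      assume "w $ None = 0"
      then have "w $ c = 0" for c
        using True by (cases c) (auto simp: a_def vec_eq_iff)
      then show False using w(1) by (simp add: vec_eq_iff)
    qed
    then have "Z = {}" using wz True by auto
    then show thesis using that[of "axis undefined 1" 0] by simp
  next
    case False
    show thesis
    proof (rule that[of "(1 / norm a) *\<^sub>R a" "- (w $ None) / norm a"])
      show "norm ((1 / norm a) *\<^sub>R a) = 1" using False by simp
    qed (use wz in simp)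
  qed
qed

lemma small_rationals_on_hyperplane:
  fixes \<Psi> :: "real ^ 'k::finite \<Rightarrow> real ^ 'd::finite" and \<epsilon> :: real
  assumes det: "\<And>y :: 'd option \<Rightarrow> real ^ 'k. (\<And>i. y i \<in> S) \<Longrightarrow>
      \<bar>det (\<chi> i. homogenized (\<Psi> (y i)))\<bar> \<le> \<epsilon>"
    and \<epsilon>: "0 \<le> \<epsilon>"
  obtains a b where "norm a = 1"
    "\<And>y. y \<in> S \<Longrightarrow> rational_point (\<Psi> y) \<Longrightarrow> real (height (\<Psi> y)) ^ (CARD('d) + 1) * \<epsilon> < 1 \<Longrightarrow> a \<bullet> \<Psi> y = b"
proof -
  define S' where "S' = {y \<in> S. rational_point (\<Psi> y) \<and> real (height (\<Psi> y)) ^ (CARD('d) + 1) * \<epsilon> < 1}"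
  have zero: "det (\<chi> i. homogenized (r i)) = 0" if r: "\<And>i. r i \<in> \<Psi> ` S'" for r :: "'d option \<Rightarrow> real ^ 'd"
  proof -
    have "\<forall>i. \<exists>y\<in>S'. r i = \<Psi> y" using r by blast
    then obtain y where y: "\<And>i. y i \<in> S'" "\<And>i. r i = \<Psi> (y i)" by metis
    have D: "\<bar>det (\<chi> i. homogenized (r i))\<bar> \<le> \<epsilon>"
      unfolding y(2) by (rule det) (use y(1) in \<open>auto simp: S'_def\<close>)
    show ?thesis
    proof (rule rational_det_eq_0)
      show "rational_point (r i)" for i using y[of i] by (simp add: S'_def)
      show "\<bar>det (\<chi> i. homogenized (r i))\<bar> * real (height (r i)) ^ (CARD('d) + 1) < 1" for i
      proof -
        have "\<bar>det (\<chi> i. homogenized (r i))\<bar> * real (height (r i)) ^ (CARD('d) + 1)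
            \<le> \<epsilon> * real (height (r i)) ^ (CARD('d) + 1)"
          using D by (intro mult_right_mono) auto
        also have "\<dots> < 1" using y[of i] by (simp add: S'_def mult.commute)
        finally show ?thesis .
      qed
    qed
  qed
  obtain a b where ab: "norm a = 1" "\<And>z. z \<in> \<Psi> ` S' \<Longrightarrow> a \<bullet> z = b"
    using common_affine_hyperplane[OF zero] by blast
  show thesis by (rule that[OF ab(1), of b]) (use ab(2) in \<open>auto simp: S'_def\<close>)
qed

section \<open>Smooth maps and charts\<close>

lemma Ck_on_cong:
  assumes "Ck_on n W f" "open W" "\<And>x. x \<in> W \<Longrightarrow> f x = g x"
  shows "Ck_on n W g"
  using assms(1,3)
proof (induction n arbitrary: f g)
  case 0
  then show ?case using continuous_on_cong[of W W f g] by simp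
next
  case (Suc n)
  have der: "(g has_derivative frechet_derivative f (at x)) (at x)" if "x \<in> W" for x
  proof -
    have "(f has_derivative frechet_derivative f (at x)) (at x)"
      using Suc.prems(1) that by (simp add: frechet_derivative_works)
    then show ?thesis
      by (rule has_derivative_transform_within_open[OF _ assms(2) that]) (rule Suc.prems(2))
  qed
  have eq: "frechet_derivative f (at x) = frechet_derivative g (at x)" if "x \<in> W" for x
    by (rule frechet_derivative_at[OF der[OF that]])
  have "Ck_on n W (\<lambda>x. frechet_derivative g (at x) v)" for v
  proof (rule Suc.IH)
    show "Ck_on n W (\<lambda>x. frechet_derivative f (at x) v)" using Suc.prems(1) by simp
  qed (simp add: eq)
  then show ?case using der by (auto simp: differentiable_def)
qed

lemma Ck_on_subset: "Ck_on n W f \<Longrightarrow> V \<subseteq> W \<Longrightarrow> Ck_on n V f"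
proof (induction n arbitrary: f)
  case 0
  then show ?case using continuous_on_subset by auto
next
  case (Suc n)
  then show ?case by (simp add: subset_iff)
qed

text \<open>The pieces may have different domains because the derivatives of \<open>f\<close> at a point do
  not refer to the domain.\<close>

lemma Ck_on_local:
  assumes "\<And>x. x \<in> U \<Longrightarrow> \<exists>V. open V \<and> x \<in> V \<and> Ck_on n V f"
  shows "Ck_on n U f"
  using assms
proof (induction n arbitrary: f)
  case 0
  have "isCont f x" if x: "x \<in> U" for x
  proof -
    obtain V where "open V" "x \<in> V" "continuous_on V f" using 0[OF x] unfolding Ck_on.simps by blast
    then show ?thesis using continuous_on_eq_continuous_at by blast
  qed
  then show ?case by (simp add: continuous_at_imp_continuous_on)
next
  case (Suc n)
  have "f differentiable (at x)" if "x \<in> U" for x using Suc.prems[OF that] by auto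
  moreover have "Ck_on n U (\<lambda>x. frechet_derivative f (at x) v)" for v
    by (rule Suc.IH) (use Suc.prems in fastforce)
  ultimately show ?case by simp
qed

text \<open>On an open set the local extension and the map agree near each point, so they have the same
  derivatives there.\<close>

lemma smooth_map_on_open:
  assumes "open U" "smooth_map_on U f"
  shows "Ck_on n U f"
proof (rule Ck_on_local)
  fix x assume x: "x \<in> U"
  obtain W F where W: "open W" "x \<in> W" "\<forall>n. Ck_on n W F" "\<forall>y\<in>U \<inter> W. F y = f y"
    using bspec[OF assms(2)[unfolded smooth_map_on_def] x] by blast
  have "Ck_on n (U \<inter> W) F" using W(3)[rule_format] by (rule Ck_on_subset) auto
  then have "Ck_on n (U \<inter> W) f" by (rule Ck_on_cong) (use assms W in auto)
  then show "\<exists>V. open V \<and> x \<in> V \<and> Ck_on n V f" using assms(1) W x by blast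
qed

lemma Ck_on_partials:
  assumes "\<And>n. Ck_on n U f"
  shows "Ck_on n U (foldr partial_deriv xs f)"
proof (induction xs arbitrary: n)
  case Nil
  then show ?case using assms by simp
next
  case (Cons i xs)
  have "Ck_on (Suc n) U (foldr partial_deriv xs f)" by (rule Cons.IH)
  moreover have "foldr partial_deriv (i # xs) f
      = (\<lambda>x. frechet_derivative (foldr partial_deriv xs f) (at x) (axis i 1))"
    by (simp add: fun_eq_iff partial_deriv_def)
  ultimately show ?case by simp
qed

text \<open>The constant \<open>b\<close> enters only the function itself; this covers both the coordinates
  of \<open>\<Phi>\<close> and the equations of hyperplanes.\<close>

lemma jet_of_smooth:
  fixes \<Phi> :: "real ^ 'k::finite \<Rightarrow> real ^ 'd::finite"
  assumes "\<And>n. Ck_on n U \<Phi>"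
  shows "jet U (\<lambda>xs y. a \<bullet> foldr partial_deriv xs \<Phi> y - (if xs = [] then b else 0))"
  unfolding jet_def
proof (intro allI ballI)
  fix xs :: "'k list" and y assume y: "y \<in> U"
  let ?f = "foldr partial_deriv xs \<Phi>"
  let ?D = "frechet_derivative ?f (at y)"
  have "Ck_on (Suc 0) U ?f" by (rule Ck_on_partials[OF assms])
  then have der: "(?f has_derivative ?D) (at y)" using y by (simp add: frechet_derivative_works)
  then have lin: "linear ?D" by (rule has_derivative_linear)
  have D: "?D u = (\<Sum>i\<in>UNIV. u $ i *\<^sub>R foldr partial_deriv (i # xs) \<Phi> y)" for u
  proof -
    have "?D u = ?D (\<Sum>i\<in>UNIV. u $ i *\<^sub>R axis i 1)"
      using basis_expansion[of u] by (simp add: scalar_mult_eq_scaleR)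
    then show ?thesis by (simp add: linear_sum[OF lin] linear_cmul[OF lin] partial_deriv_def)
  qed
  have "((\<lambda>y. a \<bullet> ?f y - (if xs = [] then b else 0)) has_derivative (\<lambda>u. a \<bullet> ?D u - 0)) (at y)"
    by (intro has_derivative_diff has_derivative_inner_right has_derivative_const der)
  then show "((\<lambda>y. a \<bullet> ?f y - (if xs = [] then b else 0)) has_derivative
      (\<lambda>u. \<Sum>i\<in>UNIV. u $ i * (a \<bullet> foldr partial_deriv (i # xs) \<Phi> y - (if i # xs = [] then b else 0)))) (at y)"
    by (simp add: D inner_sum_right)
qed

lemma local_parameterization_smooth:
  assumes "local_parameterization M U \<Psi>"
  shows "open U" "Ck_on n U \<Psi>"
proof -
  show "open U" using assms by (simp add: local_parameterization_def)
  moreover have "smooth_map_on U \<Psi>"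
    using assms by (auto simp: local_parameterization_def diffeomorphism_on_def)
  ultimately show "Ck_on n U \<Psi>" by (rule smooth_map_on_open)
qed

lemma differentiable_imp_pointwise_lipschitz:
  fixes f :: "real ^ 'a::finite \<Rightarrow> real ^ 'b::finite"
  assumes "f differentiable (at x)"
  shows "\<exists>B>0. \<exists>e>0. \<forall>y. infnorm (y - x) \<le> e \<longrightarrow> infnorm (f y - f x) \<le> B * infnorm (y - x)"
proof -
  obtain f' where f': "(f has_derivative f') (at x)" using assms by (auto simp: differentiable_def)
  obtain K where K: "0 < K" "\<forall>u. norm (f' u) \<le> norm u * K"
    using bounded_linear.pos_bounded[OF has_derivative_bounded_linear[OF f']] by blast
  obtain d where d: "0 < d" "\<forall>y. norm (y - x) < d \<longrightarrow> norm (f y - f x - f' (y - x)) \<le> 1 * norm (y - x)"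
    using f' unfolding has_derivative_at_alt by (metis zero_less_one)
  define q where "q = sqrt (real CARD('a))"
  have q: "0 < q" by (simp add: q_def)
  show ?thesis
  proof (rule exI[of _ "(1 + K) * q"], intro conjI exI[of _ "d / (2 * q)"] allI impI)
    show "0 < (1 + K) * q" "0 < d / (2 * q)" using K d q by auto
    fix y assume "infnorm (y - x) \<le> d / (2 * q)"
    then have "q * infnorm (y - x) \<le> d / 2" using q by (simp add: field_simps)
    then have "norm (y - x) < d" using norm_le_sqrt_infnorm[of "y - x"] d(1) by (simp add: q_def)
    then have "norm (f y - f x - f' (y - x)) \<le> norm (y - x)" using d(2) by simp
    then have "norm (f y - f x) \<le> norm (y - x) + norm (y - x) * K"
      using K(2)[rule_format, of "y - x"] norm_triangle_sub[of "f y - f x" "f' (y - x)"] by linarith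
    also have "\<dots> = (1 + K) * norm (y - x)" by (simp add: algebra_simps)
    also have "\<dots> \<le> (1 + K) * (q * infnorm (y - x))"
      using norm_le_sqrt_infnorm[of "y - x"] K by (intro mult_left_mono) (auto simp: q_def)
    finally show "infnorm (f y - f x) \<le> (1 + K) * q * infnorm (y - x)"
      using infnorm_le_norm[of "f y - f x"] by (simp add: mult.assoc)
  qed
qed

text \<open>The inverse of a chart extends smoothly to a neighbourhood in the ambient space, and a
  differentiable map is Lipschitz at each point with respect to that point. As the range of the
  chart is open in \<open>M\<close>, this describes all points of \<open>M\<close> near
  \<open>\<Psi> w\<close>.\<close>

lemma chart_inverse_lipschitz:
  fixes M :: "(real ^ 'd::finite) set" and \<Psi> :: "real ^ 'k::finite \<Rightarrow> real ^ 'd"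
  assumes par: "local_parameterization M U \<Psi>" and w: "w \<in> U"
  shows "\<exists>L>0. \<exists>e>0. \<forall>r\<in>M. infnorm (r - \<Psi> w) \<le> e \<longrightarrow>
           (\<exists>y\<in>U. \<Psi> y = r \<and> infnorm (y - w) \<le> L * infnorm (r - \<Psi> w))"
proof -
  let ?V = "\<Psi> ` U"
  obtain h where hom: "homeomorphism U ?V \<Psi> h" and sm: "smooth_map_on ?V h"
    using par by (auto simp: local_parameterization_def diffeomorphism_on_def)
  obtain T where T: "open T" "?V = M \<inter> T"
    using par by (auto simp: local_parameterization_def openin_open)
  have x: "\<Psi> w \<in> ?V" using w by blast
  obtain W F where W: "open W" "\<Psi> w \<in> W" "\<forall>n. Ck_on n W F" "\<forall>y\<in>?V \<inter> W. F y = h y"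
    using bspec[OF sm[unfolded smooth_map_on_def] x] by blast
  have "Ck_on (Suc 0) W F" using W(3) by blast
  then have "F differentiable (at (\<Psi> w))" using W(2) by simp
  then obtain B e where B: "0 < B" and e: "0 < e"
    and lip: "\<forall>y. infnorm (y - \<Psi> w) \<le> e \<longrightarrow> infnorm (F y - F (\<Psi> w)) \<le> B * infnorm (y - \<Psi> w)"
    using differentiable_imp_pointwise_lipschitz by blast
  have "open (T \<inter> W)" "\<Psi> w \<in> T \<inter> W" using T W x by auto
  then obtain e' where e': "0 < e'" "max_ball (\<Psi> w) e' \<subseteq> T \<inter> W" by (rule max_ball_in_open)
  show ?thesis
  proof (rule exI[of _ B], intro conjI exI[of _ "min e e'"] ballI impI)
    fix r assume r: "r \<in> M" "infnorm (r - \<Psi> w) \<le> min e e'"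
    then have "r \<in> T \<inter> W" using e'(2) by (auto simp: max_ball_def)
    then have rV: "r \<in> ?V \<inter> W" using T(2) r by blast
    have hw: "h (\<Psi> w) = w" using hom w by (simp add: homeomorphism_apply1)
    have "h r \<in> U" using rV hom by (auto simp: homeomorphism_def)
    moreover have "\<Psi> (h r) = r" using hom rV by (auto simp: homeomorphism_apply2)
    moreover have "infnorm (h r - w) \<le> B * infnorm (r - \<Psi> w)"
    proof -
      have "F r = h r" "F (\<Psi> w) = w" using W(2,4) rV x hw by auto
      then show ?thesis using lip[rule_format, of r] r(2) by simp
    qed
    ultimately show "\<exists>y\<in>U. \<Psi> y = r \<and> infnorm (y - w) \<le> B * infnorm (r - \<Psi> w)" by blast
  qed (use B e e' in auto)
qed

lemma derivatives_bounded_on_compact: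
  fixes \<Psi> :: "real ^ 'k::finite \<Rightarrow> real ^ 'd::finite"
  assumes cont: "\<And>xs. continuous_on K (foldr partial_deriv xs \<Psi>)" and K: "compact K"
  shows "\<exists>B\<ge>1. \<forall>xs z. length xs \<le> n \<longrightarrow> z \<in> K \<longrightarrow> norm (foldr partial_deriv xs \<Psi> z) \<le> B"
proof -
  have "\<exists>B. \<forall>z\<in>K. norm (foldr partial_deriv xs \<Psi> z) \<le> B" for xs
  proof -
    have "bounded (foldr partial_deriv xs \<Psi> ` K)"
      using compact_continuous_image[OF cont K] compact_imp_bounded by blast
    then show ?thesis by (auto simp: bounded_iff)
  qed
  then obtain b where b: "\<And>xs z. z \<in> K \<Longrightarrow> norm (foldr partial_deriv xs \<Psi> z) \<le> b xs" by metis
  let ?L = "{xs :: 'k list. length xs \<le> n}"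
  show ?thesis
  proof (intro exI[of _ "1 + (\<Sum>xs\<in>?L. \<bar>b xs\<bar>)"] conjI allI impI)
    show "1 \<le> 1 + (\<Sum>xs\<in>?L. \<bar>b xs\<bar>)" by (simp add: sum_nonneg)
    fix xs :: "'k list" and z assume xs: "length xs \<le> n" and z: "z \<in> K"
    have "\<bar>b xs\<bar> \<le> (\<Sum>xs\<in>?L. \<bar>b xs\<bar>)"
      by (rule member_le_sum) (use xs finite_lists_le in auto)
    then show "norm (foldr partial_deriv xs \<Psi> z) \<le> 1 + (\<Sum>xs\<in>?L. \<bar>b xs\<bar>)"
      using b[OF z, of xs] by linarith
  qed
qed

section \<open>Nondegeneracy in every chart\<close>

text \<open>Starting from a bound for the derivatives of order \<open>D + 1\<close>, each application of the
  mean value estimate gains one power of the distance to \<open>w\<close>.\<close>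

lemma jet_vanishing_imp_small:
  fixes w :: "real ^ 'k::finite"
  assumes "open U" "jet U g" "w \<in> U" and van: "\<And>xs. length xs \<le> D \<Longrightarrow> g xs w = 0"
  obtains C r where "0 < C" "0 < r" "\<And>y. infnorm (y - w) \<le> r \<Longrightarrow> \<bar>g [] y\<bar> \<le> C * infnorm (y - w) ^ (D + 1)"
proof -
  obtain r where r: "0 < r" "max_ball w r \<subseteq> U" using max_ball_in_open[OF assms(1,3)] .
  have jet: "jet (max_ball w r) g" using jet_subset[OF assms(2) r(2)] .
  obtain B where B: "0 < B" "\<And>xs z. length xs \<le> D + 1 \<Longrightarrow> z \<in> max_ball w r \<Longrightarrow> \<bar>g xs z\<bar> \<le> B"
    using jet_bounded_on_compact[OF jet compact_max_ball, where n = "D + 1"] by blast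
  define K where "K = real CARD('k)"
  have K: "0 < K" by (simp add: K_def)
  have main: "\<bar>g xs y\<bar> \<le> B * K ^ j * infnorm (y - w) ^ j"
    if "length xs + j = D + 1" "infnorm (y - w) \<le> r" for j xs y
    using that
  proof (induction j arbitrary: xs y)
    case 0
    then show ?case using B(2)[of xs y] by (simp add: max_ball_def)
  next
    case (Suc j)
    define s where "s = infnorm (y - w)"
    have s: "0 \<le> s" "s \<le> r" using Suc.prems infnorm_pos_le by (auto simp: s_def)
    have sub: "max_ball w s \<subseteq> max_ball w r" by (rule max_ball_subset) (use s in \<open>simp add: infnorm_0\<close>)
    have "\<bar>g xs y - g xs w\<bar> \<le> CARD('k) * (B * K ^ j * s ^ j) * infnorm (y - w)"
    proof (rule jet_lipschitz[OF jet_subset[OF jet sub] convex_max_ball])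
      show "w \<in> max_ball w s" using s by (simp add: max_ball_def infnorm_0)
      show "y \<in> max_ball w s" by (simp add: max_ball_def s_def)
      fix i z assume "z \<in> max_ball w s"
      then have z: "infnorm (z - w) \<le> s" by (simp add: max_ball_def)
      have "\<bar>g (i # xs) z\<bar> \<le> B * K ^ j * infnorm (z - w) ^ j"
        by (rule Suc.IH) (use Suc.prems z s in auto)
      also have "\<dots> \<le> B * K ^ j * s ^ j"
        using B K z by (intro mult_left_mono power_mono infnorm_pos_le) auto
      finally show "\<bar>g (i # xs) z\<bar> \<le> B * K ^ j * s ^ j" .
    qed
    moreover have "g xs w = 0" using Suc.prems by (intro van) auto
    ultimately show ?case by (simp add: K_def s_def ac_simps)
  qed
  show thesis
  proof (rule that[of "B * K ^ (D + 1)" r])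
    show "0 < B * K ^ (D + 1)" using B K by (intro mult_pos_pos zero_less_power)
    show "\<bar>g [] y\<bar> \<le> B * K ^ (D + 1) * infnorm (y - w) ^ (D + 1)" if "infnorm (y - w) \<le> r" for y
      by (rule main) (use that in auto)
  qed (rule r)
qed

text \<open>The combination \<open>2 ^ (m + 1) * p (s / 2) - p s\<close> of a polynomial \<open>p\<close> of
  degree \<open>m + 1\<close> has degree at most \<open>m\<close> and a linear coefficient that is
  no smaller, which reduces the degree to \<open>1\<close>.\<close>

lemma linear_coefficient_bound:
  assumes "1 \<le> m"
  shows "\<exists>C\<ge>0. \<forall>c M. (\<forall>s\<in>{0..1}. \<bar>\<Sum>j\<le>m. c j * s ^ j\<bar> \<le> M) \<longrightarrow> \<bar>c 1\<bar> \<le> C * (M :: real)"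
  using assms
proof (induction m rule: nat_induct_at_least)
  case base
  show ?case
  proof (intro exI[of _ 2] conjI allI impI)
    fix c :: "nat \<Rightarrow> real" and M
    assume b: "\<forall>s\<in>{0..1}. \<bar>\<Sum>j\<le>1. c j * s ^ j\<bar> \<le> M"
    have "\<bar>c 0 + c 1\<bar> \<le> M" "\<bar>c 0\<bar> \<le> M" using b[rule_format, of 1] b[rule_format, of 0] by auto
    then show "\<bar>c 1\<bar> \<le> 2 * M" by linarith
  qed simp
next
  case (Suc m)
  obtain C where C: "0 \<le> C"
    "\<And>c M. \<forall>s\<in>{0..1}. \<bar>\<Sum>j\<le>m. c j * s ^ j\<bar> \<le> M \<Longrightarrow> \<bar>c 1\<bar> \<le> C * (M :: real)"
    using Suc.IH by blast
  let ?q = "2 ^ Suc m :: real"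
  show ?case
  proof (intro exI[of _ "C * (?q + 1)"] conjI allI impI)
    show "0 \<le> C * (?q + 1)" using C(1) by simp
    fix c :: "nat \<Rightarrow> real" and M
    assume b: "\<forall>s\<in>{0..1}. \<bar>\<Sum>j\<le>Suc m. c j * s ^ j\<bar> \<le> M"
    \<comment> \<open>the coefficients of \<open>2 ^ (m + 1) * p (s / 2) - p s\<close>, whose top coefficient is zero\<close>
    define c' where "c' j = (?q / 2 ^ j - 1) * c j" for j
    have "\<bar>c' 1\<bar> \<le> C * ((?q + 1) * M)"
    proof (rule C(2), intro ballI)
      fix s :: real assume s: "s \<in> {0..1}"
      let ?p = "\<lambda>s. \<Sum>j\<le>Suc m. c j * s ^ j"
      have "(\<Sum>j\<le>m. c' j * s ^ j) = (\<Sum>j\<le>Suc m. c' j * s ^ j)" by (simp add: c'_def)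
      also have "\<dots> = ?q * ?p (s / 2) - ?p s"
        unfolding sum_distrib_left sum_subtractf[symmetric]
        by (rule sum.cong) (auto simp: c'_def field_simps power_divide)
      finally have eq: "(\<Sum>j\<le>m. c' j * s ^ j) = ?q * ?p (s / 2) - ?p s" .
      have "\<bar>?p (s / 2)\<bar> \<le> M" by (rule b[rule_format]) (use s in auto)
      moreover have "\<bar>?p s\<bar> \<le> M" by (rule b[rule_format, OF s])
      ultimately have "\<bar>?q * ?p (s / 2)\<bar> \<le> ?q * M" "\<bar>?p s\<bar> \<le> M"
        unfolding abs_mult by (auto intro: mult_left_mono)
      then have "\<bar>?q * ?p (s / 2) - ?p s\<bar> \<le> ?q * M + M" by linarith
      also have "\<dots> = (?q + 1) * M" by (simp add: distrib_right)
      finally show "\<bar>\<Sum>j\<le>m. c' j * s ^ j\<bar> \<le> (?q + 1) * M" unfolding eq .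
    qed
    moreover have "\<bar>c 1\<bar> \<le> \<bar>c' 1\<bar>"
    proof -
      have "(2::real) ^ 1 \<le> 2 ^ m" using Suc.hyps by (intro power_increasing) auto
      then have "1 * \<bar>c 1\<bar> \<le> (2 ^ m - 1) * \<bar>c 1\<bar>" by (intro mult_right_mono) auto
      also have "\<dots> = \<bar>c' 1\<bar>" using \<open>(2::real) ^ 1 \<le> 2 ^ m\<close> by (simp add: c'_def abs_mult)
      finally show ?thesis by simp
    qed
    ultimately show "\<bar>c 1\<bar> \<le> C * (?q + 1) * M" by (simp add: mult.assoc)
  qed
qed

text \<open>Converse to \<open>jet_vanishing_imp_small\<close>. If \<open>g xs\<close> is of size \<open>s ^
  (m + 1)\<close> on the balls of radius \<open>s\<close> around \<open>v\<close>, then on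
  segments of length \<open>s\<close> so is its Taylor polynomial of degree \<open>m\<close>; its
  linear coefficient is \<open>s\<close> times a first derivative of \<open>g xs\<close>, which is
  therefore of size \<open>s ^ m\<close>. So each derivative costs one power.\<close>

lemma jet_small_imp_vanishing:
  fixes v :: "real ^ 'k::finite"
  assumes "open U" "jet U g" "v \<in> U" "0 \<le> C" "0 < r"
    and small: "\<And>y. infnorm (y - v) \<le> r \<Longrightarrow> \<bar>g [] y\<bar> \<le> C * infnorm (y - v) ^ (D + 1)"
    and len: "length xs \<le> D"
  shows "g xs v = 0"
proof -
  have decay: "\<exists>C r. 0 \<le> C \<and> 0 < r \<and>
      (\<forall>s y. 0 < s \<longrightarrow> s \<le> r \<longrightarrow> infnorm (y - v) \<le> s \<longrightarrow> \<bar>g xs y\<bar> \<le> C * s ^ m)"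
    if "length xs + m = D + 1" "1 \<le> m" for xs m
    using that
  proof (induction xs arbitrary: m)
    case Nil
    have "\<bar>g [] y\<bar> \<le> C * s ^ m" if "0 < s" "s \<le> r" "infnorm (y - v) \<le> s" for s y
    proof -
      have "\<bar>g [] y\<bar> \<le> C * infnorm (y - v) ^ (D + 1)" using small that by simp
      also have "\<dots> \<le> C * s ^ (D + 1)"
        using that assms(4) by (intro mult_left_mono power_mono infnorm_pos_le) auto
      finally show ?thesis using Nil by simp
    qed
    then show ?case using assms(4,5) by blast
  next
    case (Cons i xs)
    obtain C1 r1 where C1: "0 \<le> C1" "0 < r1"
      "\<And>s y. 0 < s \<Longrightarrow> s \<le> r1 \<Longrightarrow> infnorm (y - v) \<le> s \<Longrightarrow> \<bar>g xs y\<bar> \<le> C1 * s ^ (m + 1)"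
      using Cons.IH[of "m + 1"] Cons.prems by auto
    obtain r2 where r2: "0 < r2" "max_ball v r2 \<subseteq> U" using max_ball_in_open[OF assms(1,3)] .
    \<comment> \<open>the derivative family of \<open>g xs\<close>, expanded along the \<open>i\<close>-th axis at points near \<open>v\<close>\<close>
    define g' where "g' ys = g (ys @ xs)" for ys
    have "jet U g'" using assms(2) unfolding jet_def g'_def append_Cons by blast
    then have jet: "jet (max_ball v r2) g'" using r2(2) by (rule jet_subset)
    obtain B where B: "0 < B" "\<And>xs z. length xs \<le> m + 1 \<Longrightarrow> z \<in> max_ball v r2 \<Longrightarrow> \<bar>g' xs z\<bar> \<le> B"
      using jet_bounded_on_compact[OF jet compact_max_ball, where n = "m + 1"] by blast
    obtain Cm where Cm: "0 \<le> Cm"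
      "\<And>c M. \<forall>s\<in>{0..1}. \<bar>\<Sum>j\<le>m. c j * s ^ j\<bar> \<le> M \<Longrightarrow> \<bar>c 1\<bar> \<le> Cm * (M :: real)"
      using linear_coefficient_bound[OF Cons.prems(2)] by blast
    define M where "M = C1 * 2 ^ (m + 1) + real CARD('k) ^ (m + 1) * B"
    have M0: "0 \<le> M" using C1 B by (simp add: M_def)
    have "\<bar>g (i # xs) y\<bar> \<le> (Cm * M) * s ^ m"
      if s: "0 < s" "s \<le> min r1 r2 / 2" and y: "infnorm (y - v) \<le> s" for s y
    proof -
      define e where "e = s *\<^sub>R axis i (1 :: real)"
      define c where "c p = (\<Sum>zs | length zs = p. monom_list e zs * g' zs y) / fact p" for p
      have mon: "monom_list (t *\<^sub>R e) zs = t ^ length zs * monom_list e zs" for t zs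
        by (induction zs) (auto simp: monom_list_def)
      have "\<forall>t\<in>{0..1}. \<bar>\<Sum>j\<le>m. c j * t ^ j\<bar> \<le> M * s ^ (m + 1)"
      proof
        fix t :: real assume t: "t \<in> {0..1}"
        have e_le: "infnorm (t *\<^sub>R e) \<le> s"
        proof -
          have "infnorm (0 + (t * s) *\<^sub>R axis i 1 - 0 :: real ^ 'k) \<le> s"
            using max_ball_shift_mem[of "t * s" s 0 i] t s by (simp add: max_ball_def abs_mult mult_left_le_one_le)
          then show ?thesis by (simp add: e_def)
        qed
        have z: "infnorm (y + t *\<^sub>R e - v) \<le> 2 * s"
          using infnorm_triangle[of "y - v" "t *\<^sub>R e"] y e_le by (simp add: algebra_simps)
        have "\<bar>g' [] (y + t *\<^sub>R e) - (\<Sum>p<m + 1. (\<Sum>zs | length zs = p. monom_list (t *\<^sub>R e) zs * g' zs y) / fact p)\<bar>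
            \<le> (CARD('k) * s) ^ (m + 1) * B"
          by (rule jet_taylor[OF jet convex_max_ball _ _ e_le])
             (use y z s B in \<open>auto simp: max_ball_def\<close>)
        moreover have "(\<Sum>p<m + 1. (\<Sum>zs | length zs = p. monom_list (t *\<^sub>R e) zs * g' zs y) / fact p)
            = (\<Sum>j\<le>m. c j * t ^ j)"
        proof -
          have "(\<Sum>zs | length zs = p. monom_list (t *\<^sub>R e) zs * g' zs y)
              = (\<Sum>zs | length zs = p. monom_list e zs * g' zs y) * t ^ p" for p
            by (subst sum_distrib_right) (auto simp: mon intro!: sum.cong)
          then have "(\<Sum>zs | length zs = p. monom_list (t *\<^sub>R e) zs * g' zs y) / fact p = c p * t ^ p" for p
            unfolding c_def by simp
          then show ?thesis by (simp add: lessThan_Suc_atMost)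
        qed
        moreover have "\<bar>g' [] (y + t *\<^sub>R e)\<bar> \<le> C1 * (2 * s) ^ (m + 1)"
          unfolding g'_def using C1(3)[of "2 * s" "y + t *\<^sub>R e"] s z by simp
        ultimately have "\<bar>\<Sum>j\<le>m. c j * t ^ j\<bar> \<le> C1 * (2 * s) ^ (m + 1) + (CARD('k) * s) ^ (m + 1) * B"
          by linarith
        also have "\<dots> = M * s ^ (m + 1)" by (simp only: M_def power_mult_distrib) (simp add: algebra_simps)
        finally show "\<bar>\<Sum>j\<le>m. c j * t ^ j\<bar> \<le> M * s ^ (m + 1)" .
      qed
      then have "\<bar>c 1\<bar> \<le> Cm * (M * s ^ (m + 1))" by (rule Cm(2))
      moreover have "c 1 = s * g (i # xs) y"
      proof -
        have "c 1 = (\<Sum>j\<in>UNIV. e $ j * g' [j] y)"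
          unfolding c_def One_nat_def sum_lists_Suc by (simp add: monom_list_def)
        also have "\<dots> = (\<Sum>j\<in>UNIV. if j = i then s * g' [i] y else 0)"
          by (rule sum.cong) (auto simp: e_def axis_def)
        finally show ?thesis by (simp add: g'_def)
      qed
      ultimately have "\<bar>g (i # xs) y\<bar> * s \<le> ((Cm * M) * s ^ m) * s"
        using s by (simp add: abs_mult ac_simps)
      then show ?thesis using s(1) by (rule mult_right_le_imp_le)
    qed
    moreover have "0 \<le> Cm * M" using Cm(1) M0 by simp
    moreover have "0 < min r1 r2 / 2" using C1 r2 by simp
    ultimately show ?case by blast
  qed
  have m: "length xs + (D + 1 - length xs) = D + 1" "1 \<le> D + 1 - length xs" using len by auto
  obtain C' r' where C': "0 \<le> C'" "0 < r'"
    "\<And>s y. 0 < s \<Longrightarrow> s \<le> r' \<Longrightarrow> infnorm (y - v) \<le> s \<Longrightarrow> \<bar>g xs y\<bar> \<le> C' * s ^ (D + 1 - length xs)"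
    using decay[OF m] by blast
  show ?thesis
  proof (rule ccontr)
    assume ne: "g xs v \<noteq> 0"
    \<comment> \<open>a scale at which \<open>C' * s\<close> is at most half of \<open>\<bar>g xs v\<bar>\<close>\<close>
    define s where "s = min (min 1 r') (\<bar>g xs v\<bar> / (2 * (C' + 1)))"
    have s: "0 < s" "s \<le> 1" "s \<le> r'" using C' ne by (auto simp: s_def)
    have "\<bar>g xs v\<bar> \<le> C' * s ^ (D + 1 - length xs)" using C'(3)[OF s(1,3), of v] s by (simp add: infnorm_0)
    also have "\<dots> \<le> C' * s ^ 1" using C' s len by (intro mult_left_mono power_decreasing) auto
    also have "\<dots> \<le> (C' + 1) * s" using s by (simp add: algebra_simps)
    also have "\<dots> \<le> (C' + 1) * (\<bar>g xs v\<bar> / (2 * (C' + 1)))" using C' by (intro mult_left_mono) (auto simp: s_def)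
    also have "\<dots> = \<bar>g xs v\<bar> / 2" using C' by (simp add: field_simps)
    finally show False using ne by simp
  qed
qed

text \<open>One list serves all \<open>f\<close>, because the choice in \<open>multi_partial\<close> depends
  on \<open>\<alpha>\<close> only; that some list has the prescribed multiplicities makes the
  choice meaningful.\<close>

lemma multi_partial_as_list:
  fixes \<alpha> :: "'k::finite \<Rightarrow> nat"
  obtains xs where "length xs = (\<Sum>i\<in>UNIV. \<alpha> i)"
    "\<And>f :: real ^ 'k \<Rightarrow> real ^ 'd::finite. multi_partial \<alpha> f = foldr partial_deriv xs f"
proof -
  obtain ys where ys: "mset ys = (\<Sum>i\<in>UNIV. replicate_mset (\<alpha> i) i)" using ex_mset by blast
  have "count_list ys i = \<alpha> i" for i
  proof -
    have "count_list ys i = count (mset ys) i" by (simp add: count_mset)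
    also have "\<dots> = \<alpha> i" unfolding ys count_sum by simp
    finally show ?thesis .
  qed
  then have "\<exists>xs. \<forall>i. count_list xs i = \<alpha> i" by blast
  then have count: "\<forall>i. count_list (SOME xs. \<forall>i. count_list xs i = \<alpha> i) i = \<alpha> i" by (rule someI_ex)
  define xs where "xs = (SOME xs. \<forall>i. count_list xs i = \<alpha> i)"
  have "length xs = (\<Sum>i\<in>UNIV. count_list xs i)" using sum_count_set[of xs UNIV] by simp
  then have "length xs = (\<Sum>i\<in>UNIV. \<alpha> i)" using count by (simp add: xs_def)
  then show thesis using that[of xs] by (simp add: multi_partial_def xs_def)
qed

text \<open>If all derivatives of \<open>a \<bullet> \<Psi>\<close> up to order \<open>D\<close> vanish at
  \<open>w\<close>, then \<open>a \<bullet> (\<Psi> y - \<Psi> w)\<close> is small of order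
  \<open>D + 1\<close>. The change of charts is Lipschitz at the point, so the same holds in the
  chart \<open>\<Phi>\<close> that witnesses nondegeneracy; there \<open>a\<close> is then
  orthogonal to the osculating space, which is everything.\<close>

lemma nondegenerate_every_chart:
  fixes M :: "(real ^ 'd::finite) set" and \<Psi> :: "real ^ 'k::finite \<Rightarrow> real ^ 'd"
  assumes par: "local_parameterization M U \<Psi>" and w: "w \<in> U"
    and nd: "nondegenerate_at TYPE('k) D M (\<Psi> w)" and a: "a \<noteq> 0"
  shows "\<exists>xs. 1 \<le> length xs \<and> length xs \<le> D \<and> a \<bullet> foldr partial_deriv xs \<Psi> w \<noteq> 0"
proof (rule ccontr)
  assume "\<not> ?thesis"
  then have van: "a \<bullet> foldr partial_deriv xs \<Psi> w = 0" if "1 \<le> length xs" "length xs \<le> D" for xs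
    using that by blast
  obtain V and \<Phi> :: "real ^ 'k \<Rightarrow> real ^ 'd" and v where par': "local_parameterization M V \<Phi>"
    and v: "v \<in> V" "\<Phi> v = \<Psi> w" and full: "osculating_space D \<Phi> v = UNIV"
    using nd unfolding nondegenerate_at_def by blast
  define b where "b = a \<bullet> \<Psi> w"
  define f where "f xs y = a \<bullet> foldr partial_deriv xs \<Psi> y - (if xs = [] then b else 0)" for xs y
  define g where "g xs y = a \<bullet> foldr partial_deriv xs \<Phi> y - (if xs = [] then b else 0)" for xs y
  note smU = local_parameterization_smooth[OF par] and smV = local_parameterization_smooth[OF par']
  have jf: "jet U f" unfolding f_def by (rule jet_of_smooth[OF smU(2)])
  have jg: "jet V g" unfolding g_def by (rule jet_of_smooth[OF smV(2)])
  have f0: "f xs w = 0" if "length xs \<le> D" for xs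
  proof (cases "xs = []")
    case False
    then have "1 \<le> length xs" by (cases xs) auto
    then show ?thesis using van that False by (simp add: f_def)
  qed (simp add: f_def b_def)
  obtain C r where C: "0 < C" "0 < r"
    "\<And>y. infnorm (y - w) \<le> r \<Longrightarrow> \<bar>f [] y\<bar> \<le> C * infnorm (y - w) ^ (D + 1)"
    by (rule jet_vanishing_imp_small[OF smU(1) jf w f0]) blast+
  obtain L e where L: "0 < L" "0 < e" "\<forall>x\<in>M. infnorm (x - \<Psi> w) \<le> e \<longrightarrow>
      (\<exists>y\<in>U. \<Psi> y = x \<and> infnorm (y - w) \<le> L * infnorm (x - \<Psi> w))"
    using chart_inverse_lipschitz[OF par w] by blast
  have "Ck_on (Suc 0) V \<Phi>" by (rule smV(2))
  then have "\<Phi> differentiable (at v)" using v(1) by simp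
  then obtain B e1 where B: "0 < B" "0 < e1"
    "\<forall>z. infnorm (z - v) \<le> e1 \<longrightarrow> infnorm (\<Phi> z - \<Phi> v) \<le> B * infnorm (z - v)"
    using differentiable_imp_pointwise_lipschitz by blast
  obtain r2 where r2: "0 < r2" "max_ball v r2 \<subseteq> V" using max_ball_in_open[OF smV(1) v(1)] .
  \<comment> \<open>so small that \<open>\<Phi> z\<close> lies in the range of \<open>\<Psi>\<close>, at a parameter where the bound on \<open>f\<close> holds\<close>
  define \<rho> where "\<rho> = min (min e1 r2) (min (e / B) (r / (L * B)))"
  have \<rho>: "0 < \<rho>" using B r2 L C by (simp add: \<rho>_def)
  have VM: "\<Phi> ` V \<subseteq> M" using par' openin_imp_subset unfolding local_parameterization_def by blast
  have g_small: "\<bar>g [] z\<bar> \<le> C * (L * B) ^ (D + 1) * infnorm (z - v) ^ (D + 1)" if z: "infnorm (z - v) \<le> \<rho>" for z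
  proof -
    have le: "infnorm (z - v) \<le> e1" "infnorm (z - v) \<le> r2"
      "infnorm (z - v) \<le> e / B" "infnorm (z - v) \<le> r / (L * B)"
      using z by (auto simp: \<rho>_def)
    have "z \<in> V" using le(2) r2(2) by (auto simp: max_ball_def)
    then have zM: "\<Phi> z \<in> M" using VM by blast
    have \<Phi>z: "infnorm (\<Phi> z - \<Psi> w) \<le> B * infnorm (z - v)" using B(3) le(1) v(2) by simp
    also have "\<dots> \<le> e" using le(3) B by (simp add: pos_le_divide_eq mult.commute)
    finally obtain y where y: "y \<in> U" "\<Psi> y = \<Phi> z" "infnorm (y - w) \<le> L * infnorm (\<Phi> z - \<Psi> w)"
      using L(3) zM by blast
    have "L * infnorm (\<Phi> z - \<Psi> w) \<le> L * (B * infnorm (z - v))"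
      using \<Phi>z L(1) by (intro mult_left_mono) auto
    then have yw: "infnorm (y - w) \<le> L * B * infnorm (z - v)" using y(3) by (simp add: mult.assoc)
    also have "\<dots> \<le> r" using le(4) L(1) B(1) by (simp add: pos_le_divide_eq mult.commute)
    finally have "\<bar>f [] y\<bar> \<le> C * infnorm (y - w) ^ (D + 1)" by (rule C(3))
    also have "\<dots> \<le> C * (L * B * infnorm (z - v)) ^ (D + 1)"
      using C(1) yw by (intro mult_left_mono power_mono infnorm_pos_le) auto
    finally show ?thesis using y(2) by (simp add: f_def g_def power_mult_distrib ac_simps)
  qed
  have g0: "g xs v = 0" if "length xs \<le> D" for xs
    by (rule jet_small_imp_vanishing[OF smV(1) jg v(1) _ \<rho> g_small that]) (use C L B in auto)
  have "osculating_space D \<Phi> v \<subseteq> {x. a \<bullet> x = 0}"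
    unfolding osculating_space_def
  proof (rule span_minimal)
    show "{multi_partial \<alpha> \<Phi> v |\<alpha>. 0 < sum \<alpha> UNIV \<and> sum \<alpha> UNIV \<le> D} \<subseteq> {x. a \<bullet> x = 0}"
    proof clarify
      fix \<alpha> :: "'k \<Rightarrow> nat" assume \<alpha>: "0 < sum \<alpha> UNIV" "sum \<alpha> UNIV \<le> D"
      obtain xs where xs: "length xs = sum \<alpha> UNIV" "multi_partial \<alpha> \<Phi> = foldr partial_deriv xs \<Phi>"
        by (rule multi_partial_as_list[of \<alpha>]) blast
      have "xs \<noteq> []" using \<alpha>(1) xs(1) by auto
      then show "a \<bullet> multi_partial \<alpha> \<Phi> v = 0" using g0[of xs] \<alpha>(2) xs by (simp add: g_def)
    qed
    show "subspace {x. a \<bullet> x = 0}" by (rule subspace_hyperplane)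
  qed
  then have "a \<bullet> a = 0" using full by blast
  then show False using a by simp
qed

text \<open>The sum of the absolute values of the finitely many derivatives is continuous and positive on
  the compact set of pairs \<open>(w, a)\<close>.\<close>

lemma uniform_nondegeneracy:
  fixes \<Psi> :: "real ^ 'k::finite \<Rightarrow> real ^ 'd::finite"
  assumes cont: "\<And>xs. continuous_on K (foldr partial_deriv xs \<Psi>)" and K: "compact K"
    and nd: "\<And>w a. w \<in> K \<Longrightarrow> a \<noteq> 0 \<Longrightarrow>
      \<exists>xs. 1 \<le> length xs \<and> length xs \<le> D \<and> a \<bullet> foldr partial_deriv xs \<Psi> w \<noteq> 0"
  shows "\<exists>\<delta>>0. \<forall>w\<in>K. \<forall>a. norm a = 1 \<longrightarrow>
      (\<exists>xs. 1 \<le> length xs \<and> length xs \<le> D \<and> \<delta> \<le> \<bar>a \<bullet> foldr partial_deriv xs \<Psi> w\<bar>)"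
proof (cases "K = {}")
  case False
  let ?L = "{xs :: 'k list. 1 \<le> length xs \<and> length xs \<le> D}"
  have fin: "finite ?L" by (rule finite_subset[OF _ finite_lists_le[of D]]) auto
  define h where "h p = (\<Sum>xs\<in>?L. \<bar>snd p \<bullet> foldr partial_deriv xs \<Psi> (fst p)\<bar>)" for p
  let ?S = "sphere (0 :: real ^ 'd) 1"
  have comp: "compact (K \<times> ?S)" using K by (intro compact_Times compact_sphere)
  have "axis undefined 1 \<in> ?S" by simp
  then have ne: "K \<times> ?S \<noteq> {}" using False by blast
  have "continuous_on (K \<times> ?S) h"
    unfolding h_def
    by (intro continuous_on_sum continuous_on_rabs continuous_on_inner continuous_on_snd
        continuous_on_compose2[OF cont] continuous_on_fst continuous_on_id) auto
  from continuous_attains_inf[OF comp ne this]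
  obtain p where p: "p \<in> K \<times> ?S" "\<forall>q\<in>K \<times> ?S. h p \<le> h q" by blast
  have "snd p \<noteq> 0" using p(1) by auto
  then obtain xs0 where xs0: "xs0 \<in> ?L" "snd p \<bullet> foldr partial_deriv xs0 \<Psi> (fst p) \<noteq> 0"
    using nd[of "fst p" "snd p"] p(1) by auto
  have "\<bar>snd p \<bullet> foldr partial_deriv xs0 \<Psi> (fst p)\<bar> \<le> h p"
    unfolding h_def using xs0(1) fin by (intro member_le_sum) auto
  then have hp: "0 < h p" using xs0(2) by linarith
  have card: "0 < card ?L" using xs0(1) fin by (auto simp: card_gt_0_iff)
  show ?thesis
  proof (intro exI[of _ "h p / card ?L"] conjI ballI allI impI)
    show "0 < h p / card ?L" using hp card by simp
    fix w and a :: "real ^ 'd" assume w: "w \<in> K" and a: "norm a = 1"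
    have "h p \<le> h (w, a)" using p(2) w a by simp
    show "\<exists>xs. 1 \<le> length xs \<and> length xs \<le> D \<and> h p / card ?L \<le> \<bar>a \<bullet> foldr partial_deriv xs \<Psi> w\<bar>"
    proof (rule ccontr)
      assume "\<not> ?thesis"
      then have "\<bar>a \<bullet> foldr partial_deriv xs \<Psi> w\<bar> < h p / card ?L" if "xs \<in> ?L" for xs
        using that by force
      then have "h (w, a) < of_nat (card ?L) * (h p / card ?L)"
        unfolding h_def fst_conv snd_conv using card by (intro sum_bounded_above_strict) auto
      then show False using \<open>h p \<le> h (w, a)\<close> card by simp
    qed
  qed
qed (intro exI[of _ 1], auto)

section \<open>Badly approximable points are winning\<close>

text \<open>One block of moves: it takes care of all rational points near the ball whose height is small
  compared with its radius. The radius \<open>2 * snd s\<close> leaves a margin, so that points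
  further out are automatically at distance \<open>snd s\<close> from Bob's ball.\<close>

lemma chart_stage:
  fixes M :: "(real ^ 'd::finite) set" and \<Psi> :: "real ^ 'k::finite \<Rightarrow> real ^ 'd" and \<beta> :: real
  assumes card: "CARD('k) \<le> CARD('d)" and nd: "\<forall>x\<in>M. nondegenerate_at TYPE('k) D M x"
    and par: "local_parameterization M U \<Psi>" and K: "compact K" "K \<subseteq> U" and \<beta>: "0 < \<beta>"
  obtains N A \<epsilon> r where "0 < A" "0 < \<epsilon>" "0 < r" and
    "\<And>s. 0 < snd s \<Longrightarrow> snd s \<le> r \<Longrightarrow> pball s \<inter> K \<noteq> {} \<Longrightarrow>
       forces \<beta> N (\<lambda>t. pball t \<subseteq> pball s \<and>
         (\<forall>z\<in>pball t. \<forall>y\<in>max_ball (fst s) (2 * snd s). rational_point (\<Psi> y) \<longrightarrow>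
            real (height (\<Psi> y)) ^ (CARD('d) + 1) * (A * snd s ^ N_kd CARD('k) CARD('d)) < 1 \<longrightarrow>
            \<epsilon> * snd s \<le> infnorm (z - y))) s"
proof -
  let ?k = "CARD('k)" and ?d = "CARD('d)"
  define n where "n = n_kd ?k ?d"
  define E where "E = N_kd ?k ?d"
  note sm = local_parameterization_smooth[OF par]
  let ?D = "\<lambda>xs. foldr partial_deriv xs \<Psi>"
  obtain K' r0 where K': "compact K'" "K' \<subseteq> U" and r0: "0 < r0"
    and near: "\<And>x \<rho>. \<rho> \<le> r0 \<Longrightarrow> max_ball x \<rho> \<inter> K \<noteq> {} \<Longrightarrow> max_ball x (4 * \<rho>) \<subseteq> K'"
    by (rule compact_neighbourhood[OF K(1) sm(1) K(2)]) blast+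
  have "continuous_on U (?D xs)" for xs using Ck_on_partials[OF sm(2), of 0 xs] by simp
  then have cont: "continuous_on K' (?D xs)" for xs using continuous_on_subset K'(2) by blast
  have UM: "\<Psi> ` U \<subseteq> M" using par openin_imp_subset unfolding local_parameterization_def by blast
  have "\<exists>\<delta>>0. \<forall>w\<in>K'. \<forall>a. norm a = 1 \<longrightarrow>
      (\<exists>xs. 1 \<le> length xs \<and> length xs \<le> D \<and> \<delta> \<le> \<bar>a \<bullet> ?D xs w\<bar>)"
  proof (rule uniform_nondegeneracy[OF cont K'(1)])
    fix w and a :: "real ^ 'd" assume "w \<in> K'" "a \<noteq> 0"
    then have "w \<in> U" "\<Psi> w \<in> M" using K'(2) UM by auto
    then show "\<exists>xs. 1 \<le> length xs \<and> length xs \<le> D \<and> a \<bullet> ?D xs w \<noteq> 0"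
      using nondegenerate_every_chart[OF par _ _ \<open>a \<noteq> 0\<close>] nd by blast
  qed
  then obtain \<delta> where \<delta>: "0 < \<delta>" "\<forall>w\<in>K'. \<forall>a. norm a = 1 \<longrightarrow>
      (\<exists>xs. 1 \<le> length xs \<and> length xs \<le> D \<and> \<delta> \<le> \<bar>a \<bullet> ?D xs w\<bar>)" by blast
  obtain C0 where C0: "1 \<le> C0" "\<forall>xs z. length xs \<le> max n D + 1 \<longrightarrow> z \<in> K' \<longrightarrow> norm (?D xs z) \<le> C0"
    using derivatives_bounded_on_compact[OF cont K'(1)] by blast
  have C0pos: "0 < C0" using C0(1) by linarith
  have inner_le: "\<bar>a \<bullet> ?D xs z\<bar> \<le> C0" if "norm a = 1" "length xs \<le> max n D + 1" "z \<in> K'" for a xs z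
  proof -
    have "\<bar>a \<bullet> ?D xs z\<bar> \<le> norm a * norm (?D xs z)" by (rule Cauchy_Schwarz_ineq2)
    also have "\<dots> \<le> C0" using that C0(2) by simp
    finally show ?thesis .
  qed
  have weight: "E + (\<Sum>\<alpha> | size (\<alpha> :: 'k multiset) \<le> n. n + 1 - size \<alpha>) \<le> (n + 1) * CARD('d option)"
    using N_kd_weight_bound[OF card] by (simp add: E_def n_def card_UNIV_option)
  obtain Cd where Cd: "0 < Cd" and det:
    "\<And>(G :: 'd option \<Rightarrow> 'k list \<Rightarrow> real ^ 'k \<Rightarrow> real) x r (y :: 'd option \<Rightarrow> real ^ 'k).
       \<lbrakk>0 < r; r \<le> 1; \<And>c. jet (max_ball x r) (G c);
        \<And>c xs z. length xs \<le> n + 1 \<Longrightarrow> z \<in> max_ball x r \<Longrightarrow> \<bar>G c xs z\<bar> \<le> C0;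
        \<And>i. y i \<in> max_ball x r\<rbrakk>
       \<Longrightarrow> \<bar>det (\<chi> i c. G c [] (y i) :: real ^ 'd option ^ 'd option)\<bar> \<le> Cd * r ^ E"
    by (rule jet_det_bound[OF weight C0pos]) blast
  obtain N \<epsilon> where \<epsilon>: "0 < \<epsilon>" and force:
    "\<And>g (s :: 'k position).
       \<lbrakk>0 < snd s; snd s \<le> 1; jet (max_ball (fst s) (4 * snd s)) g;
        \<And>xs z. z \<in> max_ball (fst s) (4 * snd s) \<Longrightarrow> length xs = D + 1 \<Longrightarrow> \<bar>g xs z\<bar> \<le> C0;
        \<And>z. z \<in> max_ball (fst s) (4 * snd s) \<Longrightarrow>
          \<exists>xs. 1 \<le> length xs \<and> length xs \<le> D \<and> \<delta> \<le> \<bar>g xs z\<bar>\<rbrakk>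
       \<Longrightarrow> forces \<beta> N (\<lambda>t. pball t \<subseteq> pball s \<and>
             (\<forall>z\<in>pball t. \<forall>y\<in>max_ball (fst s) (2 * snd s). g [] y = 0 \<longrightarrow> \<epsilon> * snd s \<le> infnorm (z - y))) s"
    by (rule forces_away_from_zero_set[OF \<beta> C0pos \<delta>(1), where D = D and ?'k = 'k]) blast
  show thesis
  proof (rule that[of "Cd * 2 ^ E" \<epsilon> "min r0 (1 / 2)" N])
    \<comment> \<open>The determinant is estimated on a ball of twice the radius, whence \<open>2 ^ E\<close>, and the
      doubled radius has to be at most \<open>1\<close>.\<close>
    show "0 < Cd * 2 ^ E" "0 < \<epsilon>" "0 < min r0 (1 / 2)" using Cd \<epsilon> r0 by auto
    fix s :: "'k position"
    assume s: "0 < snd s" "snd s \<le> min r0 (1 / 2)" "pball s \<inter> K \<noteq> {}"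
    define x where "x = fst s"
    define \<rho> where "\<rho> = snd s"
    have \<rho>: "0 < \<rho>" "\<rho> \<le> 1 / 2" using s by (auto simp: \<rho>_def)
    have sub4: "max_ball x (4 * \<rho>) \<subseteq> K'" unfolding x_def \<rho>_def
      by (rule near) (use s in \<open>auto simp: pball_def\<close>)
    have "max_ball x (2 * \<rho>) \<subseteq> max_ball x (4 * \<rho>)"
      by (rule max_ball_subset) (use \<rho> in \<open>simp add: infnorm_0\<close>)
    then have sub2: "max_ball x (2 * \<rho>) \<subseteq> K'" using sub4 by blast
    \<comment> \<open>the derivative families of the homogeneous coordinates of \<open>\<Psi>\<close>\<close>
    define G where "G c xs y = (case c of None \<Rightarrow> if xs = [] then 1 else 0 | Some j \<Rightarrow> axis j 1 \<bullet> ?D xs y)"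
      for c and xs :: "'k list" and y
    have jetG: "jet (max_ball x (2 * \<rho>)) (G c)" for c
    proof (cases c)
      case None
      then have "G c xs = (\<lambda>_. if xs = [] then 1 else 0)" for xs by (simp add: G_def fun_eq_iff)
      then show ?thesis by (simp add: jet_def)
    next
      case (Some j)
      have "jet U (\<lambda>xs y. axis j 1 \<bullet> ?D xs y - (if xs = [] then 0 else 0))" by (rule jet_of_smooth[OF sm(2)])
      moreover have "G c = (\<lambda>xs y. axis j 1 \<bullet> ?D xs y - (if xs = [] then 0 else 0))"
        using Some by (simp add: G_def fun_eq_iff)
      ultimately have "jet U (G c)" by simp
      then show ?thesis by (rule jet_subset) (use sub2 K' in blast)
    qed
    have G_le: "\<bar>G c xs z\<bar> \<le> C0" if "length xs \<le> n + 1" "z \<in> max_ball x (2 * \<rho>)" for c xs z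
    proof (cases c)
      case (Some j)
      then show ?thesis using inner_le[of "axis j 1" xs z] that sub2 by (auto simp: G_def)
    qed (use C0 in \<open>auto simp: G_def\<close>)
    have hom: "homogenized (\<Psi> y) = (\<chi> c. G c [] y)" for y
      by (auto simp: homogenized_def G_def vec_eq_iff inner_axis' split: option.splits)
    have det_le: "\<bar>det (\<chi> i. homogenized (\<Psi> (y i)))\<bar> \<le> Cd * (2 * \<rho>) ^ E"
      if "\<And>i. y i \<in> max_ball x (2 * \<rho>)" for y :: "'d option \<Rightarrow> real ^ 'k"
      unfolding hom by (rule det[OF _ _ jetG G_le that]) (use \<rho> in auto)
    have "0 \<le> Cd * (2 * \<rho>) ^ E" using Cd \<rho> by simp
    obtain a b where ab: "norm a = 1"
      "\<And>y. y \<in> max_ball x (2 * \<rho>) \<Longrightarrow> rational_point (\<Psi> y) \<Longrightarrow>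
         real (height (\<Psi> y)) ^ (?d + 1) * (Cd * (2 * \<rho>) ^ E) < 1 \<Longrightarrow> a \<bullet> \<Psi> y = b"
      by (rule small_rationals_on_hyperplane[where S = "max_ball x (2 * \<rho>)" and \<Psi> = \<Psi>,
            OF det_le \<open>0 \<le> Cd * (2 * \<rho>) ^ E\<close>]) blast+
    define g where "g xs y = a \<bullet> ?D xs y - (if xs = [] then b else 0)" for xs y
    have F: "forces \<beta> N (\<lambda>t. pball t \<subseteq> pball s \<and>
        (\<forall>z\<in>pball t. \<forall>y\<in>max_ball (fst s) (2 * snd s). g [] y = 0 \<longrightarrow> \<epsilon> * snd s \<le> infnorm (z - y))) s"
    proof (rule force)
      have "jet U g" unfolding g_def by (rule jet_of_smooth[OF sm(2)])
      then show "jet (max_ball (fst s) (4 * snd s)) g"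
        by (rule jet_subset) (use sub4 K' in \<open>auto simp: x_def \<rho>_def\<close>)
      fix z assume z: "z \<in> max_ball (fst s) (4 * snd s)"
      then have zK: "z \<in> K'" using sub4 by (auto simp: x_def \<rho>_def)
      show "\<bar>g xs z\<bar> \<le> C0" if "length xs = D + 1" for xs
        using inner_le[OF ab(1), of xs z] that zK by (auto simp: g_def)
      obtain xs where "1 \<le> length xs" "length xs \<le> D" "\<delta> \<le> \<bar>a \<bullet> ?D xs z\<bar>"
        using \<delta>(2) zK ab(1) by blast
      then show "\<exists>xs. 1 \<le> length xs \<and> length xs \<le> D \<and> \<delta> \<le> \<bar>g xs z\<bar>"
        by (intro exI[of _ xs]) (auto simp: g_def)
    qed (use s in auto)
    show "forces \<beta> N (\<lambda>t. pball t \<subseteq> pball s \<and>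
         (\<forall>z\<in>pball t. \<forall>y\<in>max_ball (fst s) (2 * snd s). rational_point (\<Psi> y) \<longrightarrow>
            real (height (\<Psi> y)) ^ (?d + 1) * (Cd * 2 ^ E * snd s ^ N_kd ?k ?d) < 1 \<longrightarrow>
            \<epsilon> * snd s \<le> infnorm (z - y))) s"
    proof (rule forces_mono[OF F], intro conjI ballI impI)
      fix t :: "'k position" and z y
      assume t: "pball t \<subseteq> pball s \<and> (\<forall>z\<in>pball t. \<forall>y\<in>max_ball (fst s) (2 * snd s).
          g [] y = 0 \<longrightarrow> \<epsilon> * snd s \<le> infnorm (z - y))"
      then show "pball t \<subseteq> pball s" by blast
      assume z: "z \<in> pball t" and y: "y \<in> max_ball (fst s) (2 * snd s)" and rat: "rational_point (\<Psi> y)"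
        and h: "real (height (\<Psi> y)) ^ (?d + 1) * (Cd * 2 ^ E * snd s ^ N_kd ?k ?d) < 1"
      have "a \<bullet> \<Psi> y = b"
        by (rule ab(2)) (use y rat h in \<open>auto simp: x_def \<rho>_def E_def power_mult_distrib mult.assoc\<close>)
      then have "g [] y = 0" by (simp add: g_def)
      then show "\<epsilon> * snd s \<le> infnorm (z - y)" using t z y by blast
    qed
  qed
qed

text \<open>In the parameter space: the limit point \<open>w\<close> of the play has distance at least a
  constant times \<open>\<psi> H\<close> from every \<open>y\<close> whose image is rational of
  height \<open>H\<close>. This carries over to \<open>M\<close> because the inverse of the chart
  is Lipschitz at \<open>\<Psi> w\<close>, and rational points away from the chart are at a
  positive distance anyway. If \<open>w\<close> is not in \<open>K\<close> there is nothing to do,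
  so only balls that meet \<open>K\<close> are relevant.\<close>

lemma chart_winning:
  fixes M :: "(real ^ 'd::finite) set" and \<Psi> :: "real ^ 'k::finite \<Rightarrow> real ^ 'd" and \<beta> :: real
  assumes card: "CARD('k) \<le> CARD('d)" and nd: "\<forall>x\<in>M. nondegenerate_at TYPE('k) D M x"
    and par: "local_parameterization M U \<Psi>" and K: "compact K" "K \<subseteq> U" and \<beta>: "0 < \<beta>"
  shows "beta_hyperplane_winning \<beta>
    ((\<Psi> -` BA M (psi (c_kd CARD('k) CARD('d))) \<inter> U) \<union> (UNIV - K))"
proof -
  let ?d = "CARD('d)"
  define E where "E = N_kd CARD('k) ?d"
  define c where "c = c_kd CARD('k) ?d"
  have E: "1 \<le> E" unfolding E_def by (rule N_kd_pos) (use card in \<open>auto simp: Suc_le_eq\<close>)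
  have c: "c = real (?d + 1) / E" by (simp add: c_def c_kd_def E_def)
  obtain N A \<epsilon> r where A: "0 < A" and \<epsilon>: "0 < \<epsilon>" and r: "0 < r" and stage:
    "\<And>s. 0 < snd s \<Longrightarrow> snd s \<le> r \<Longrightarrow> pball s \<inter> K \<noteq> {} \<Longrightarrow>
       forces \<beta> N (\<lambda>t. pball t \<subseteq> pball s \<and>
         (\<forall>z\<in>pball t. \<forall>y\<in>max_ball (fst s) (2 * snd s). rational_point (\<Psi> y) \<longrightarrow>
            real (height (\<Psi> y)) ^ (?d + 1) * (A * snd s ^ N_kd CARD('k) ?d) < 1 \<longrightarrow>
            \<epsilon> * snd s \<le> infnorm (z - y))) s"
    by (rule chart_stage[OF card nd par K \<beta>]) blast
  define avoids where "avoids s t \<longleftrightarrow> (snd s \<le> r \<longrightarrow> pball s \<inter> K \<noteq> {} \<longrightarrow>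
      (\<forall>z\<in>pball t. \<forall>y\<in>max_ball (fst s) (2 * snd s). rational_point (\<Psi> y) \<longrightarrow>
            real (height (\<Psi> y)) ^ (?d + 1) * (A * snd s ^ E) < 1 \<longrightarrow>
            \<epsilon> * snd s \<le> infnorm (z - y)))" for s t :: "'k position"
  \<comment> \<open>One extra move halves the radius, so that the radii tend to zero.\<close>
  define Q where "Q s t \<longleftrightarrow> avoids s t \<and> snd t \<le> snd s / 2 \<and> \<beta> ^ (N + 1) * snd s \<le> snd t"
    for s t :: "'k position"
  show ?thesis
  proof (rule winning_by_blocks[where N = "N + 1" and Q = Q])
    show "0 < N + 1" "0 < \<beta>" using \<beta> by auto
    fix s :: "'k position" assume s: "0 < snd s"
    have 1: "forces \<beta> N (avoids s) s"
    proof (cases "snd s \<le> r \<and> pball s \<inter> K \<noteq> {}")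
      case True
      show ?thesis
        by (rule forces_mono[OF stage[OF s conjunct1[OF True] conjunct2[OF True]]])
           (simp add: avoids_def E_def)
    next
      case False
      then have "avoids s t" for t unfolding avoids_def by blast
      then show ?thesis by (rule forces_mono[OF forces_shrink[OF \<beta> s]])
    qed
    have "forces \<beta> (N + 1) (\<lambda>u. avoids s u \<and> snd u \<le> snd s / 2) s"
    proof (rule forces_add[OF forces_inside[OF 1 \<beta> s]])
      fix t :: "'k position"
      assume t: "avoids s t \<and> pball t \<subseteq> pball s \<and> 0 < snd t \<and> \<beta> ^ N * snd s \<le> snd t"
      then have t0: "0 < snd t" and ts: "snd t \<le> snd s" using pball_subset_radius[of t s] by auto
      show "forces \<beta> 1 (\<lambda>u. avoids s u \<and> snd u \<le> snd s / 2) t"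
      proof (rule forces_mono[OF forces_inside[OF forces_shrink[OF \<beta> t0] \<beta> t0]])
        fix u :: "'k position"
        assume u: "snd u \<le> snd t / 2 ^ 1 \<and> pball u \<subseteq> pball t \<and> 0 < snd u \<and> \<beta> ^ 1 * snd t \<le> snd u"
        have "pball u \<subseteq> pball t" using u by blast
        then have "avoids s u" using t unfolding avoids_def by (meson subsetD)
        moreover have "snd u \<le> snd s / 2" using u ts by simp
        ultimately show "avoids s u \<and> snd u \<le> snd s / 2" by blast
      qed
    qed
    then show "forces \<beta> (N + 1) (Q s) s"
      by (rule forces_mono[OF forces_inside[OF _ \<beta> s]]) (auto simp: Q_def)
  next
    fix b :: "nat \<Rightarrow> 'k position" and w
    assume b: "\<And>m. 0 < snd (b m)" "\<And>m. Q (b m) (b (Suc m))" "\<And>m. w \<in> pball (b m)"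
    define R where "R m = snd (b m)" for m
    have R0: "0 < R m" for m using b(1) by (simp add: R_def)
    have R_half: "R (Suc m) \<le> R m / 2" and R_ge: "\<beta> ^ (N + 1) * R m \<le> R (Suc m)" for m
      using b(2)[of m] by (auto simp: Q_def R_def)
    have R_geo: "R m \<le> R 0 * (1 / 2) ^ m" for m
    proof (induction m)
      case (Suc m)
      then show ?case using R_half[of m] by simp
    qed simp
    have "(\<lambda>m. R 0 * (1 / 2) ^ m) \<longlonglongrightarrow> R 0 * 0"
      by (intro tendsto_mult_left LIMSEQ_realpow_zero) auto
    then have R_lim: "R \<longlonglongrightarrow> 0"
      by (intro tendsto_sandwich[of "\<lambda>_. 0" R sequentially "\<lambda>m. R 0 * (1 / 2) ^ m"])
         (use R0 R_geo less_imp_le in \<open>auto intro!: always_eventually\<close>)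
    have "w \<in> \<Psi> -` BA M (psi c) \<inter> U" if wK: "w \<in> K"
    proof -
      have wU: "w \<in> U" using wK K by blast
      have "eventually (\<lambda>m. R m < r) sequentially" using R_lim r by (rule order_tendstoD)
      then obtain m0 where m0: "\<And>m. m0 \<le> m \<Longrightarrow> R m < r" by (auto simp: eventually_sequentially)
      define p where "p h = psi c (real h)" for h :: nat
      have p01: "0 < p h" "p h \<le> 1" if "1 \<le> h" for h
        using that ge_one_powr_ge_zero[of "real h" c] unfolding p_def psi_def powr_minus_divide
        by (auto simp: c)
      define c2 where "c2 = min (R m0) (\<beta> ^ (N + 1) * A powr (- (1 / E)))"
      have c2: "0 < c2" using R0 \<beta> A by (simp add: c2_def)
      define c1 where "c1 = min \<epsilon> 1 * c2"
      have c1: "0 < c1" using c2 \<epsilon> by (simp add: c1_def)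
      have far: "c1 * p (height (\<Psi> y)) \<le> infnorm (w - y)" if rat: "rational_point (\<Psi> y)" for y
      proof -
        define h where "h = height (\<Psi> y)"
        have h: "1 \<le> h" using height_spec[OF rat] unfolding h_def by (metis Suc_le_eq One_nat_def)
        define T where "T m = real h ^ (?d + 1) * (A * R m ^ E)" for m
        have "(\<lambda>m. real h ^ (?d + 1) * (A * R m ^ E)) \<longlonglongrightarrow> real h ^ (?d + 1) * (A * 0 ^ E)"
          by (intro tendsto_mult_left tendsto_power R_lim)
        moreover have "(0::real) ^ E = 0" using E by (simp add: power_0_left)
        ultimately have "T \<longlonglongrightarrow> 0" by (simp add: T_def[abs_def])
        then have "eventually (\<lambda>m. T m < 1) sequentially" by (rule order_tendstoD) simp
        then obtain m1 where "\<And>m. m1 \<le> m \<Longrightarrow> T m < 1" by (auto simp: eventually_sequentially)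
        then have ex: "\<exists>m. m0 \<le> m \<and> T m < 1" by (intro exI[of _ "max m0 m1"]) auto
        \<comment> \<open>The first stage responsible for this height. If it is not the initial one, its
          predecessor was not, and this bounds \<open>R m\<close> below by the height.\<close>
        define m where "m = (LEAST m. m0 \<le> m \<and> T m < 1)"
        have m: "m0 \<le> m" "T m < 1" using LeastI_ex[OF ex] by (auto simp: m_def)
        have R_p: "c2 * p h \<le> R m"
        proof (cases "m = m0")
          case True
          have "c2 * p h \<le> c2 * 1" using p01[OF h] c2 by (intro mult_left_mono) auto
          then show ?thesis using True by (simp add: c2_def)
        next
          case False
          then obtain m' where m': "m = Suc m'" "m0 \<le> m'" using m(1) by (cases m) auto
          have "\<not> (m0 \<le> m' \<and> T m' < 1)" by (rule not_less_Least) (use m' in \<open>simp add: m_def\<close>)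
          then have "1 \<le> T m'" using m' by simp
          then have "A powr (- (1 / E)) * real h powr (- (real (?d + 1) / E)) \<le> R m'"
            unfolding T_def by (intro powr_lower_bound) (use A h R0 E in auto)
          then have low: "A powr (- (1 / E)) * p h \<le> R m'" by (simp add: p_def psi_def c)
          have "c2 * p h \<le> (\<beta> ^ (N + 1) * A powr (- (1 / E))) * p h"
            using p01[OF h] by (intro mult_right_mono) (auto simp: c2_def)
          also have "\<dots> = \<beta> ^ (N + 1) * (A powr (- (1 / E)) * p h)" by (simp only: mult.assoc)
          also have "\<dots> \<le> \<beta> ^ (N + 1) * R m'" using low \<beta> by (intro mult_left_mono) auto
          also have "\<dots> \<le> R m" using R_ge[of m'] m' by simp
          finally show ?thesis .
        qed
        have "min \<epsilon> 1 * R m \<le> infnorm (w - y)"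
        proof (cases "y \<in> max_ball (fst (b m)) (2 * R m)")
          case True
          have "avoids (b m) (b (Suc m))" using b(2)[of m] by (simp add: Q_def)
          moreover have "snd (b m) \<le> r" using m0[OF m(1)] by (simp add: R_def)
          moreover have "pball (b m) \<inter> K \<noteq> {}" using b(3)[of m] wK by blast
          ultimately have "\<epsilon> * R m \<le> infnorm (w - y)"
            using b(3)[of "Suc m"] True rat m(2) unfolding avoids_def R_def T_def h_def by blast
          moreover have "min \<epsilon> 1 * R m \<le> \<epsilon> * R m" using R0[of m] by (intro mult_right_mono) auto
          ultimately show ?thesis by linarith
        next
          case False
          have "infnorm (w - fst (b m)) \<le> R m" using b(3)[of m] by (simp add: pball_def max_ball_def R_def)
          moreover have "2 * R m < infnorm (y - fst (b m))" using False by (simp add: max_ball_def)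
          moreover have "infnorm (y - fst (b m)) \<le> infnorm (y - w) + infnorm (w - fst (b m))"
            using infnorm_triangle[of "y - w" "w - fst (b m)"] by simp
          moreover have "min \<epsilon> 1 * R m \<le> 1 * R m" using R0[of m] by (intro mult_right_mono) auto
          ultimately show ?thesis by (simp add: infnorm_sub[of w])
        qed
        moreover have "c1 * p h \<le> min \<epsilon> 1 * R m"
          unfolding c1_def mult.assoc using R_p \<epsilon> by (intro mult_left_mono) auto
        ultimately show ?thesis by (simp add: h_def)
      qed
      obtain L e where L: "0 < L" and e: "0 < e" and inv: "\<forall>x\<in>M. infnorm (x - \<Psi> w) \<le> e \<longrightarrow>
          (\<exists>y\<in>U. \<Psi> y = x \<and> infnorm (y - w) \<le> L * infnorm (x - \<Psi> w))"
        using chart_inverse_lipschitz[OF par wU] by blast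
      have bad: "min (c1 / L) e * psi c (real (height q)) \<le> infnorm (\<Psi> w - q)"
        if q: "q \<in> M" "rational_point q" for q
      proof -
        have h: "1 \<le> height q" using height_spec[OF q(2)] by (metis Suc_le_eq One_nat_def)
        note p = p01[OF h]
        show ?thesis
        proof (cases "infnorm (q - \<Psi> w) \<le> e")
          case True
          then obtain y where y: "\<Psi> y = q" "infnorm (y - w) \<le> L * infnorm (q - \<Psi> w)"
            using inv q(1) by blast
          have "c1 * p (height q) \<le> L * infnorm (q - \<Psi> w)"
            using far[of y] q(2) y by (simp add: infnorm_sub[of w])
          then have "c1 / L * p (height q) \<le> infnorm (\<Psi> w - q)"
            using L by (simp add: field_simps infnorm_sub[of q])
          moreover have "min (c1 / L) e * p (height q) \<le> c1 / L * p (height q)"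
            using p by (intro mult_right_mono) auto
          ultimately show ?thesis by (simp add: p_def)
        next
          case False
          have "min (c1 / L) e * p (height q) \<le> e * 1" using p e L c1 by (intro mult_mono) auto
          then show ?thesis using False by (simp add: p_def infnorm_sub[of q])
        qed
      qed
      have "\<Psi> w \<in> M"
        using par wU openin_imp_subset unfolding local_parameterization_def by blast
      moreover have "0 < min (c1 / L) e" using c1 L e by simp
      ultimately show ?thesis using bad wU unfolding BA_def by blast
    qed
    then show "w \<in> (\<Psi> -` BA M (psi (c_kd CARD('k) CARD('d))) \<inter> U) \<union> (UNIV - K)"
      unfolding c_def by blast
  qed
qed

theorem theorem3p3:
  fixes M :: "(real ^ 'd) set" and D :: nat
  assumes "CARD('k::finite) \<le> CARD('d)"
    and "smooth_submanifold TYPE('k) M"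
    and "D \<ge> 1"
    and "\<forall>x\<in>M. nondegenerate_at TYPE('k) D M x"
  shows "hyperplane_winning_rel TYPE('k) M (BA M (psi (c_kd CARD('k) CARD('d))))"
  unfolding hyperplane_winning_rel_def hyperplane_winning_def
  using chart_winning[OF assms(1,4)] by blast

end
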